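(* Let $\varepsilon>0$ be real. As $n\to\infty$, the scaled simplified avalanche length $\frac1n L_{\lfloor n\varepsilon\rfloor}$ of the simple symmetric random walk converges in distribution to the simplified Brownian avalanche length $L^{W}_\varepsilon$. Moreover, for every $\lambda$ with $\Re(\lambda)>0$, $$\lim_{n\to\infty} E\left[e^{-\frac{\lambda}{n}L_{\lfloor n\varepsilon\rfloor}}\right]= \frac{1}{\sqrt{\lambda\varepsilon\pi}\,\operatorname{erf}(\sqrt{\lambda\varepsilon})+e^{-\lambda\varepsilon}},$$ and $$\lim_{n\to\infty}E\left[\tfrac1{n}L_{\lfloor n\varepsilon\rfloor}\right]=\varepsilon,\qquad \lim_{n\to\infty}\operatorname{Var}\left[\tfrac1{n}L_{\lfloor n\varepsilon\rfloor}\right]=\frac{4}{3}\varepsilon^2.$$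
   Context: $(S_n)_{n\ge0}$ is a simple symmetric random walk on $\mathbb{Z}$ with $S_0=0$; write $S(k)=S_k$. Define $\rho_0=0$, $\rho_i=\inf\{n>\rho_{i-1}:S_n>S(\rho_{i-1})\}$ and $R_i=\rho_i-\rho_{i-1}$ for $i\ge1$. For a window size $w\ge0$ the simplified avalanche length $L_w$ is defined by: if $k\ge0$ and $R_1\le w,\ldots,R_k\le w$, $R_{k+1}>w$, then $L_w=R_1+\cdots+R_k$ (so $L_w=0$ if $R_1>w$). The function $\operatorname{erf}(x)=\frac{2}{\sqrt\pi}\int_0^x e^{-t^2}dt$ is the error function (an entire function), and square roots are principal. The simplified Brownian avalanche length with window $\varepsilon$ is the first time after which a standard Brownian motion has no new maximum during a time interval of length $\varepsilon$: with $W$ a standard Brownian motion started at $0$ and $M_t=\max_{0\le s\le t}W_s$, it is $L^W_\varepsilon=\inf\{t\ge0: M_{t+\varepsilon}=M_t\}$. *)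

theory Defs
  imports "HOL-Probability.Probability" "HOL-Complex_Analysis.Complex_Analysis"
begin

locale simple_symmetric_random_walk = prob_space M
  for M :: "'a measure" +
  fixes S :: "nat \<Rightarrow> 'a \<Rightarrow> int"
  assumes start: "\<And>\<omega>. \<omega> \<in> space M \<Longrightarrow> S 0 \<omega> = 0"
    and indep_steps: "indep_vars (\<lambda>_. count_space UNIV) (\<lambda>n \<omega>. S (Suc n) \<omega> - S n \<omega>) UNIV"
    and distr_steps:
      "\<And>n. distr M (count_space UNIV) (\<lambda>\<omega>. S (Suc n) \<omega> - S n \<omega>) = measure_pmf (pmf_of_set {-1, 1})"

text \<open>
  The ladder times take the value \<open>\<infinity>\<close> if no further record occurs, since
  \<open>Inf {} = \<infinity>\<close> in \<^typ>\<open>enat\<close>. Because \<open>\<infinity> - m = \<infinity>\<close> in \<^typ>\<open>enat\<close>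
  (even for \<open>m = \<infinity>\<close>), every ladder gap from that point on is \<open>\<infinity>\<close>.
\<close>

fun ladder_time :: "(nat \<Rightarrow> int) \<Rightarrow> nat \<Rightarrow> enat" where
  "ladder_time s 0 = 0"
| "ladder_time s (Suc i) =
    (case ladder_time s i of
       enat m \<Rightarrow> Inf {enat n | n. n > m \<and> s n > s m}
     | \<infinity> \<Rightarrow> \<infinity>)"

definition ladder_gap :: "(nat \<Rightarrow> int) \<Rightarrow> nat \<Rightarrow> enat" where
  "ladder_gap s i = ladder_time s i - ladder_time s (i - 1)"

text \<open>
  For a random walk, some ladder gap almost surely exceeds \<open>w\<close>; on the remaining null event
  the length is set to \<open>0\<close>. In the sum all summands are at most \<open>w\<close>, so that
  \<^const>\<open>the_enat\<close> is only applied to a finite value.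
\<close>

definition avalanche_length :: "nat \<Rightarrow> (nat \<Rightarrow> int) \<Rightarrow> nat" where
  "avalanche_length w s =
    (if \<exists>k. ladder_gap s (k + 1) > enat w
     then the_enat (\<Sum>i = 1..(LEAST k. ladder_gap s (k + 1) > enat w). ladder_gap s i)
     else 0)"

locale standard_brownian_motion = prob_space M
  for M :: "'a measure" +
  fixes W :: "real \<Rightarrow> 'a \<Rightarrow> real"
  assumes random_variable: "\<And>t. t \<ge> 0 \<Longrightarrow> random_variable borel (W t)"
    and start: "\<And>\<omega>. \<omega> \<in> space M \<Longrightarrow> W 0 \<omega> = 0"
    and indep_increments:
      "\<And>t k. 0 \<le> t 0 \<Longrightarrow> (\<And>i. i < k \<Longrightarrow> t i < t (Suc i)) \<Longrightarrow>
        indep_vars (\<lambda>_. borel) (\<lambda>i \<omega>. W (t (Suc i)) \<omega> - W (t i) \<omega>) {..<k::nat}"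
    and normal_increments:
      "\<And>r t. 0 \<le> r \<Longrightarrow> r < t \<Longrightarrow>
        distributed M lborel (\<lambda>\<omega>. W t \<omega> - W r \<omega>) (normal_density 0 (sqrt (t - r)))"
    and continuous_paths: "\<And>\<omega>. \<omega> \<in> space M \<Longrightarrow> continuous_on {0..} (\<lambda>t. W t \<omega>)"

definition running_max :: "(real \<Rightarrow> real) \<Rightarrow> real \<Rightarrow> real" where
  "running_max f t = (SUP s\<in>{0..t}. f s)"

text \<open>
  For a Brownian path the set below is almost surely nonempty; \<open>Inf {}\<close> is an unspecified
  real constant, which affects the length on a null event only.
\<close>

definition path_avalanche_length :: "real \<Rightarrow> (real \<Rightarrow> real) \<Rightarrow> real" where
  "path_avalanche_length \<epsilon> f = Inf {t. t \<ge> 0 \<and> running_max f (t + \<epsilon>) = running_max f t}"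

definition erf :: "complex \<Rightarrow> complex" where
  "erf z = 2 / of_real (sqrt pi) * contour_integral (linepath 0 z) (\<lambda>t. exp (- (t\<^sup>2)))"

end

theory Submission
  imports Defs "HOL-Real_Asymp.Real_Asymp"
begin

text \<open>
  Call a time \<open>k\<close> a stall if the walk is at a strict record at time \<open>k\<close> and does not exceed it during
  the next \<open>w\<close> steps; \<open>L\<^sub>w\<close> is the first stall. For any random walk, decomposing at the last record
  before \<open>k\<close> shows that the probabilities of reaching a record at \<open>k\<close> without an earlier stall form a
  renewal sequence. With \<open>p\<^sub>n = P(S\<^sub>1 \<le> 0, \<dots>, S\<^sub>n \<le> 0)\<close> and a summation by parts this gives
  \<open>E x\<^bsup>L\<^esup> = p\<^sub>w / (p\<^sub>w x\<^bsup>w\<^esup> + (1 - x) \<Sum>r<w. p\<^sub>r x\<^bsup>r\<^esup>)\<close> and the first two moments of \<open>L\<close>, so that only the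
  asymptotics \<open>p\<^sub>n \<sim> c / \<surd>n\<close> matter, and not the constant \<open>c\<close>.

  Decomposing at the first maximum of \<open>S\<^sub>0, \<dots>, S\<^sub>n\<close> and reversing time determines the generating
  function of \<open>p\<close>, both for the simple walk and for any symmetric walk that almost surely does not
  return to \<open>0\<close>. The second case covers Brownian motion sampled on the grid of mesh \<open>1 / m\<close>, whose
  discrete avalanche lengths therefore have the same limiting Laplace transform \<open>\<psi>(\<lambda>\<epsilon>)\<close>. Pathwise,
  the limits of the grid lengths for window \<open>\<epsilon>\<close> are at least \<open>L\<^bsup>W\<^esup>\<^sub>\<epsilon>\<close>, and, since the maxima of
  Brownian motion over disjoint intervals almost surely differ, those for a smaller window are at most
  \<open>L\<^bsup>W\<^esup>\<^sub>\<epsilon>\<close>. Continuity of \<open>\<psi>\<close> then identifies the Laplace transform of \<open>L\<^bsup>W\<^esup>\<^sub>\<epsilon>\<close>, and convergence of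
  Laplace transforms yields convergence in distribution.
\<close>

subsection \<open>Records and ladder times\<close>

text \<open>The walk and the Brownian motion are never compared with each other: there is no
  coupling and no invariance principle. Each has its own constant \<open>c\<close>, namely
  \<open>sqrt 2 / Gamma (1 / 2)\<close> for the simple walk and \<open>1 / Gamma (1 / 2)\<close> for
  the grid walks, and the limits agree because only ratios such as
  \<open>(\<Sum>r<w. p r * x ^ r) / (w * p w)\<close> survive. For \<open>p r\<close> of order
  r^(-1/2) and x = exp (- z / n) this ratio tends to the integral of u^(-1/2) exp (- a u) over 0
  \<le> u \<le> 1 with a = z \<epsilon>; this is the origin of the error function.

  The obstacle on the Brownian side is that the avalanche length is not a continuous functional of
  the path: a second time at which the same maximum is attained could make a grid walk stall much
  later than the path. A smaller window and the absence of ties exclude this, but they yield two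
  one-sided bounds with different windows, not pointwise convergence. The bounds are therefore
  compared in expectation, where explicit transforms are available. Almost sure finiteness of the
  length is an outcome of this comparison, read off from the transform near 0.\<close>

definition is_record :: "(nat \<Rightarrow> 'b::linorder) \<Rightarrow> nat \<Rightarrow> bool" where
  "is_record s k \<longleftrightarrow> (\<forall>i<k. s i < s k)"

definition stalls :: "nat \<Rightarrow> (nat \<Rightarrow> 'b::linorder) \<Rightarrow> nat \<Rightarrow> bool" where
  "stalls w s k \<longleftrightarrow> is_record s k \<and> (\<forall>j\<in>{k<..k+w}. s j \<le> s k)"

definition stall_time :: "nat \<Rightarrow> (nat \<Rightarrow> 'b::linorder) \<Rightarrow> nat" where
  "stall_time w s = (if \<exists>k. stalls w s k then LEAST k. stalls w s k else 0)"

lemma ex_first_max: "\<exists>k\<le>n. is_record s k \<and> (\<forall>j\<le>n. s j \<le> s k)"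
proof (induction n)
  case 0
  show ?case by (simp add: is_record_def)
next
  case (Suc n)
  then obtain k where k: "k \<le> n" "is_record s k" "\<forall>j\<le>n. s j \<le> s k" by blast
  show ?case
  proof (cases "s (Suc n) \<le> s k")
    case True
    with k show ?thesis by (intro exI[of _ k]) (auto simp: le_Suc_eq)
  next
    case False
    then have "s j < s (Suc n)" if "j \<le> n" for j
      using k(3) that by (auto simp: not_le intro: le_less_trans)
    then have "is_record s (Suc n)" "\<forall>j\<le>Suc n. s j \<le> s (Suc n)"
      by (auto simp: is_record_def less_Suc_eq_le le_Suc_eq intro: less_imp_le)
    then show ?thesis by blast
  qed
qed

lemma enat_Inf_eq_enatD:
  assumes "Inf {enat n |n. P n} = enat m"
  shows "P m" "\<And>n. P n \<Longrightarrow> m \<le> n"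
proof -
  have ne: "{enat n |n. P n} \<noteq> {}"
  proof
    assume "{enat n |n. P n} = {}"
    then show False using assms by (simp add: Inf_enat_def)
  qed
  then have "Inf {enat n |n. P n} \<in> {enat n |n. P n}"
    by (metis (no_types, lifting) LeastI_ex Inf_enat_def equals0I)
  with assms show "P m" by auto
  fix n assume "P n"
  then have "Inf {enat n |n. P n} \<le> enat n" by (intro Inf_lower) auto
  with assms show "m \<le> n" by simp
qed

lemma enat_less_Inf_iff:
  "enat m < Inf {enat n |n. P n} \<longleftrightarrow> (\<forall>n\<le>m. \<not> P n)"
proof
  assume *: "enat m < Inf {enat n |n. P n}"
  show "\<forall>n\<le>m. \<not> P n"
  proof (intro allI impI notI)
    fix n assume "n \<le> m" "P n"
    then have "Inf {enat n |n. P n} \<le> enat n" by (intro Inf_lower) auto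
    also have "\<dots> \<le> enat m" using \<open>n \<le> m\<close> by simp
    finally show False using * by simp
  qed
next
  assume *: "\<forall>n\<le>m. \<not> P n"
  have "enat (Suc m) \<le> Inf {enat n |n. P n}"
    using * by (intro Inf_greatest) (auto simp: not_le[symmetric] Suc_le_eq)
  then show "enat m < Inf {enat n |n. P n}"
    by (meson enat_ord_simps(2) lessI less_le_trans)
qed

lemma record_ladder_time: "ladder_time s i = enat m \<Longrightarrow> is_record s m"
proof (induction i arbitrary: m)
  case 0
  then show ?case by (simp add: is_record_def zero_enat_def)
next
  case (Suc i)
  then obtain l where l: "ladder_time s i = enat l" by (cases "ladder_time s i") auto
  from Suc.prems l have inf: "Inf {enat n |n. n > l \<and> s n > s l} = enat m" by simp
  note m = enat_Inf_eq_enatD[OF inf]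
  show ?case unfolding is_record_def
  proof (intro allI impI)
    fix j assume "j < m"
    have "s j \<le> s l"
    proof (cases j l rule: linorder_cases)
      case greater
      then show ?thesis using m(2)[of j] \<open>j < m\<close> by (auto simp: not_less[symmetric])
    next
      case less
      then show ?thesis using Suc.IH[OF l] by (auto simp: is_record_def)
    qed simp
    then show "s j < s m" using m(1) by simp
  qed
qed

lemma ladder_time_record:
  assumes "is_record s g"
  shows "\<exists>i. ladder_time s i = enat g"
proof (rule ccontr)
  assume no: "\<nexists>i. ladder_time s i = enat g"
  \<comment> \<open>If the record \<open>g\<close> is missed, every ladder time stays below it,
    since the next ladder time never jumps over a record. Ladder times increase strictly, hence are
    at least their index, which is absurd for index \<open>g\<close>.\<close>
  have "\<exists>m<g. ladder_time s i = enat m \<and> i \<le> m" for i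
  proof (induction i)
    case 0
    have "g \<noteq> 0" using no by (metis ladder_time.simps(1) zero_enat_def)
    then show ?case by (auto simp: zero_enat_def)
  next
    case (Suc i)
    then obtain m where m: "m < g" "ladder_time s i = enat m" "i \<le> m" by blast
    have "Inf {enat n |n. n > m \<and> s n > s m} \<le> enat g"
      using assms m by (intro Inf_lower) (auto simp: is_record_def)
    moreover have e: "ladder_time s (Suc i) = Inf {enat n |n. n > m \<and> s n > s m}"
      using m by simp
    ultimately obtain m' where m': "ladder_time s (Suc i) = enat m'" "m' \<le> g"
      by (metis enat_ile enat_ord_simps(1))
    have "m < m'" using enat_Inf_eq_enatD(1)[of "\<lambda>n. n > m \<and> s n > s m" m'] e m' by simp
    moreover have "m' \<noteq> g" using no m' by metis
    ultimately show ?case using m' m by (intro exI[of _ m']) auto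
  qed
  from this[of g] show False by auto
qed

lemma ladder_gap_gt_iff:
  assumes "ladder_time s k = enat m"
  shows "ladder_gap s (k + 1) > enat w \<longleftrightarrow> (\<forall>j\<in>{m<..m+w}. s j \<le> s m)"
proof -
  have e: "ladder_gap s (k + 1) = Inf {enat n |n. n > m \<and> s n > s m} - enat m"
    using assms by (simp add: ladder_gap_def)
  have "enat w < x - enat m \<longleftrightarrow> enat (m + w) < x" for x
    by (cases x) auto
  then have "ladder_gap s (k + 1) > enat w \<longleftrightarrow> (\<forall>n\<le>m+w. \<not> (n > m \<and> s n > s m))"
    by (simp only: e enat_less_Inf_iff)
  also have "\<dots> \<longleftrightarrow> (\<forall>j\<in>{m<..m+w}. s j \<le> s m)"
    by (auto simp: not_less)
  finally show ?thesis .
qed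

lemma ladder_time_mono: "i \<le> j \<Longrightarrow> ladder_time s i \<le> ladder_time s j"
proof (induction j rule: dec_induct)
  case (step n)
  have "ladder_time s n \<le> ladder_time s (Suc n)"
  proof (cases "ladder_time s n")
    case (enat m)
    then show ?thesis by (auto intro!: Inf_greatest)
  qed simp
  with step show ?case by order
qed simp

text \<open>Subtraction on \<open>enat\<close> telescopes only while the times are finite, so
  finiteness is carried through the induction; a gap of at most \<open>w\<close> preserves
  it.\<close>

lemma ladder_time_eq_sum_gap:
  assumes "\<And>i. i < K \<Longrightarrow> ladder_gap s (i + 1) \<le> enat w"
  shows "\<exists>m. ladder_time s K = enat m \<and> (\<Sum>i=1..K. ladder_gap s i) = enat m"
  using assms
proof (induction K)
  case 0
  then show ?case by (simp add: zero_enat_def)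
next
  case (Suc K)
  then obtain m where m: "ladder_time s K = enat m" "(\<Sum>i=1..K. ladder_gap s i) = enat m"
    by (metis less_Suc_eq)
  have g: "ladder_gap s (Suc K) = ladder_time s (Suc K) - enat m"
    using m by (simp add: ladder_gap_def)
  have "ladder_gap s (Suc K) \<le> enat w" using Suc.prems[of K] by simp
  with g obtain m' where m': "ladder_time s (Suc K) = enat m'"
    by (cases "ladder_time s (Suc K)") auto
  have "m \<le> m'" using ladder_time_mono[of K "Suc K" s] m m' by simp
  then show ?case using m m' g by auto
qed

text \<open>Finite ladder times are exactly the records, and a gap above \<open>w\<close> after a
  ladder time is exactly a stall. The identity holds for every path: if no gap exceeds
  \<open>w\<close> there is no stall, and both sides take their default value 0.\<close>

lemma avalanche_length_eq_stall_time: "avalanche_length w s = stall_time w s"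
proof (cases "\<exists>k. ladder_gap s (k + 1) > enat w")
  case True
  define K where "K = (LEAST k. ladder_gap s (k + 1) > enat w)"
  have K: "ladder_gap s (K + 1) > enat w"
    unfolding K_def using True by (rule LeastI_ex)
  have below: "ladder_gap s (i + 1) \<le> enat w" if "i < K" for i
    using not_less_Least[of i "\<lambda>k. ladder_gap s (k + 1) > enat w"] that by (auto simp: K_def)
  obtain m where m: "ladder_time s K = enat m" "(\<Sum>i=1..K. ladder_gap s i) = enat m"
    using ladder_time_eq_sum_gap[of K s w] below by blast
  have st: "stalls w s m"
    using K ladder_gap_gt_iff[OF m(1)] record_ladder_time[OF m(1)] by (simp add: stalls_def)
  have "m \<le> g" if g: "stalls w s g" for g
  proof -
    obtain i where i: "ladder_time s i = enat g"
      using ladder_time_record g by (metis stalls_def)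
    have "ladder_gap s (i + 1) > enat w"
      using ladder_gap_gt_iff[OF i] g by (simp add: stalls_def)
    then have "K \<le> i" by (simp add: K_def Least_le)
    then show "m \<le> g" using ladder_time_mono[of K i s] m i by simp
  qed
  with st have "(LEAST k. stalls w s k) = m" by (intro Least_equality) auto
  then have "stall_time w s = m" using st by (auto simp: stall_time_def)
  then show ?thesis using True m
    by (simp only: avalanche_length_def K_def[symmetric] if_True the_enat.simps)
next
  case False
  have "\<not> stalls w s g" for g
    using False ladder_time_record ladder_gap_gt_iff by (metis stalls_def)
  then show ?thesis using False by (simp add: avalanche_length_def stall_time_def)
qed

lemma stalls_cong_strict_mono:
  assumes "strict_mono h" shows "stalls w (\<lambda>k. h (s k)) k = stalls w s k"
  by (simp add: stalls_def is_record_def strict_mono_less[OF assms] strict_mono_less_eq[OF assms])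

text \<open>Carries stall times from the integer-valued walk to its real image, on which the
  probabilistic part works.\<close>

lemma stall_time_strict_mono:
  assumes "strict_mono h" shows "stall_time w (\<lambda>k. h (s k)) = stall_time w s"
  by (simp only: stall_time_def stalls_cong_strict_mono[OF assms])

lemma stall_time_eq_iff:
  assumes "\<exists>k. stalls w s k"
  shows "stall_time w s = k \<longleftrightarrow> stalls w s k \<and> (\<forall>i<k. \<not> stalls w s i)"
proof -
  have "stall_time w s = (LEAST k. stalls w s k)" using assms by (simp only: stall_time_def if_True)
  then show ?thesis
    using LeastI_ex[OF assms] not_less_Least[of _ "stalls w s"]
    by (metis (no_types, lifting) linorder_neqE_nat)
qed

text \<open>\<open>reaches w s k\<close>: the walk sets a record at \<open>k\<close> before having stalled. Unlike the
  absence of earlier stalls, it depends on \<open>s 0, \<dots>, s k\<close> only.\<close>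

definition reaches :: "nat \<Rightarrow> (nat \<Rightarrow> 'b::linorder) \<Rightarrow> nat \<Rightarrow> bool" where
  "reaches w s k \<longleftrightarrow> is_record s k \<and>
     (\<forall>i<k. is_record s i \<longrightarrow> (\<exists>j\<in>{i<..k}. j \<le> i + w \<and> s i < s j))"

lemma reaches_0 [simp]: "reaches w s 0"
  by (simp add: reaches_def is_record_def)

text \<open>Splits the first stall into an event of the first \<open>k\<close> steps and one of the
  following \<open>w\<close> steps, so that independence applies. An overshoot of an earlier record
  \<open>i\<close> at a time \<open>j > k\<close> within its window can be replaced by
  \<open>k\<close> itself: \<open>k\<close> lies in the same window and, being a record, exceeds
  \<open>s i\<close>.\<close>

lemma first_stall_iff:
  "stalls w s k \<and> (\<forall>i<k. \<not> stalls w s i) \<longleftrightarrow>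
   reaches w s k \<and> (\<forall>j\<in>{1..w}. s (k + j) \<le> s k)"
proof -
  have tail: "(\<forall>j\<in>{k<..k+w}. s j \<le> s k) \<longleftrightarrow> (\<forall>j\<in>{1..w}. s (k + j) \<le> s k)"
  proof safe
    fix j assume "\<forall>j\<in>{1..w}. s (k + j) \<le> s k" "j \<in> {k<..k+w}"
    show "s j \<le> s k"
    proof -
      from \<open>j \<in> {k<..k+w}\<close> obtain i where "j = k + i" "i \<in> {1..w}"
        by (auto intro!: that[of "j - k"])
      with \<open>\<forall>j\<in>{1..w}. s (k + j) \<le> s k\<close> show ?thesis by blast
    qed
  qed auto
  have "\<not> stalls w s i \<longleftrightarrow> (is_record s i \<longrightarrow> (\<exists>j\<in>{i<..k}. j \<le> i + w \<and> s i < s j))"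
    if rk: "is_record s k" and "i < k" for i
  proof -
    have "\<exists>j\<in>{i<..k}. j \<le> i + w \<and> s i < s j" if "j \<in> {i<..i+w}" "s i < s j" for j
    proof (cases "j \<le> k")
      case True
      then show ?thesis using that by auto
    next
      case False
      then show ?thesis using that rk \<open>i < k\<close> by (intro bexI[of _ k]) (auto simp: is_record_def)
    qed
    note long = this
    show ?thesis
    proof
      assume "\<not> stalls w s i"
      then have "is_record s i \<Longrightarrow> \<exists>j\<in>{i<..i+w}. s i < s j" by (auto simp: stalls_def not_le)
      then show "is_record s i \<longrightarrow> (\<exists>j\<in>{i<..k}. j \<le> i + w \<and> s i < s j)" using long by blast
    next
      assume *: "is_record s i \<longrightarrow> (\<exists>j\<in>{i<..k}. j \<le> i + w \<and> s i < s j)"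
      show "\<not> stalls w s i"
      proof
        assume st: "stalls w s i"
        with * obtain j where "j \<in> {i<..k}" "j \<le> i + w" "s i < s j" by (auto simp: stalls_def)
        moreover from this st have "s j \<le> s i" by (simp add: stalls_def)
        ultimately show False by simp
      qed
    qed
  qed
  then have "is_record s k \<Longrightarrow> (\<forall>i<k. \<not> stalls w s i) \<longleftrightarrow>
      (\<forall>i<k. is_record s i \<longrightarrow> (\<exists>j\<in>{i<..k}. j \<le> i + w \<and> s i < s j))"
    by simp
  moreover have "stalls w s k \<longleftrightarrow> is_record s k \<and> (\<forall>j\<in>{1..w}. s (k + j) \<le> s k)"
    by (simp only: stalls_def tail)
  ultimately show ?thesis unfolding reaches_def by blast
qed

text \<open>For a record \<open>i\<close> and \<open>r > 0\<close>, the event that the next ladder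
  gap equals \<open>r\<close>.\<close>

definition passes_at :: "(nat \<Rightarrow> 'b::linorder) \<Rightarrow> nat \<Rightarrow> nat \<Rightarrow> bool" where
  "passes_at s i r \<longleftrightarrow> (\<forall>j\<in>{1..<r}. s (i + j) \<le> s i) \<and> s i < s (i + r)"

lemma reaches_step:
  assumes "reaches w s i" "passes_at s i r" "1 \<le> r" "r \<le> w"
  shows "reaches w s (i + r)"
proof -
  have mid: "s j \<le> s i" if "i \<le> j" "j < i + r" for j
    using assms(2) that bspec[of "{1..<r}" "\<lambda>j. s (i + j) \<le> s i" "j - i"]
    by (cases "j = i") (auto simp: passes_at_def less_diff_conv2 Suc_le_eq)
  have up: "s i < s (i + r)" using assms(2) by (simp add: passes_at_def)
  have ri: "is_record s i" using assms(1) by (simp add: reaches_def)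
  have "is_record s (i + r)" unfolding is_record_def
  proof (intro allI impI)
    fix j assume "j < i + r"
    then have "s j \<le> s i"
      using mid[of j] ri unfolding is_record_def by (metis linorder_not_less order_less_imp_le)
    then show "s j < s (i + r)" using up by simp
  qed
  moreover have "\<exists>j\<in>{i'<..i + r}. j \<le> i' + w \<and> s i' < s j"
    if "i' < i + r" "is_record s i'" for i'
  proof (cases i' i rule: linorder_cases)
    case less
    then have "\<exists>j\<in>{i'<..i}. j \<le> i' + w \<and> s i' < s j"
      using assms(1) that by (auto simp: reaches_def)
    then show ?thesis by fastforce
  next
    case equal
    then show ?thesis using assms up by (intro bexI[of _ "i + r"]) auto
  next
    case greater
    then have "s i < s i'" using that by (auto simp: is_record_def)
    then show ?thesis using mid[of i'] greater that by auto
  qed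
  ultimately show ?thesis by (auto simp: reaches_def)
qed

text \<open>Between the last record \<open>i\<close> before \<open>k\<close> and \<open>k\<close>
  itself the path cannot exceed \<open>s i\<close>, since the first excess would be a record. Hence
  the overshoot that \<open>reaches\<close> demands from \<open>i\<close> can only occur at
  \<open>k\<close>, and the gap \<open>k - i\<close> is at most \<open>w\<close>.\<close>

lemma reaches_last_record:
  assumes "reaches w s k" "k > 0"
  shows "\<exists>r\<in>{1..min w k}. reaches w s (k - r) \<and> passes_at s (k - r) r"
proof -
  define i where "i = (GREATEST i. i < k \<and> is_record s i)"
  have ex: "\<exists>i. i < k \<and> is_record s i" using assms by (intro exI[of _ 0]) (auto simp: is_record_def)
  have i: "i < k" "is_record s i"
    using GreatestI_ex_nat[OF ex, of k] by (auto simp: i_def)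
  have mx: "i' \<le> i" if "i' < k" "is_record s i'" for i'
    unfolding i_def using that by (intro Greatest_le_nat[of _ i' k]) auto
  have rk: "is_record s k" using assms by (simp add: reaches_def)
  have mid: "s j \<le> s i" if "i < j" "j < k" for j
    using that
  proof (induction j rule: less_induct)
    case (less j)
    then have "\<not> is_record s j" using mx[of j] by auto
    then obtain l where l: "l < j" "s j \<le> s l" by (auto simp: is_record_def not_less)
    have "s l \<le> s i"
    proof (cases l i rule: linorder_cases)
      case less
      then show ?thesis using i by (auto simp: is_record_def)
    next
      case greater
      then show ?thesis using less.IH[of l] l less.prems by auto
    qed simp
    with l show ?case by simp
  qed
  obtain j where j: "j \<in> {i<..k}" "j \<le> i + w" "s i < s j"
    using assms(1) i by (auto simp: reaches_def)
  then have "j = k" using mid[of j] by (cases "j = k") auto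
  then have kw: "k \<le> i + w" using j by simp
  have "reaches w s i" unfolding reaches_def
  proof (intro conjI allI impI)
    fix i' assume i': "i' < i" "is_record s i'"
    then have "\<exists>j\<in>{i'<..k}. j \<le> i' + w \<and> s i' < s j"
      using assms(1) i by (auto simp: reaches_def)
    then obtain j where j: "j \<in> {i'<..k}" "j \<le> i' + w" "s i' < s j" by blast
    show "\<exists>j\<in>{i'<..i}. j \<le> i' + w \<and> s i' < s j"
    proof (cases "j \<le> i")
      case True
      then show ?thesis using j by auto
    next
      case False
      then show ?thesis using j i i' by (intro bexI[of _ i]) (auto simp: is_record_def)
    qed
  qed (fact i(2))
  moreover have "passes_at s i (k - i)"
    using mid i rk by (auto simp: passes_at_def is_record_def)
  ultimately show ?thesis using i kw by (intro bexI[of _ "k - i"]) auto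
qed

lemma reaches_iff:
  assumes "k > 0"
  shows "reaches w s k \<longleftrightarrow> (\<exists>r\<in>{1..min w k}. reaches w s (k - r) \<and> passes_at s (k - r) r)"
proof
  assume "\<exists>r\<in>{1..min w k}. reaches w s (k - r) \<and> passes_at s (k - r) r"
  then obtain r where "r \<in> {1..min w k}" "reaches w s (k - r)" "passes_at s (k - r) r" by blast
  with reaches_step[of w s "k - r" r] show "reaches w s k" by simp
qed (use reaches_last_record assms in blast)

text \<open>If \<open>0 < r < r'\<close>, the record at \<open>k - r\<close> lies after
  \<open>k - r'\<close> but before the first passage above \<open>s (k - r')\<close>, where the path
  is too low for a record. This makes the decomposition in \<open>reaches_iff\<close>
  disjoint.\<close>

lemma passes_at_unique:
  assumes "is_record s (k - r)" "passes_at s (k - r) r" "is_record s (k - r')" "passes_at s (k - r') r'"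
    "r \<le> k" "r' \<le> k"
  shows "r = r'"
proof (rule ccontr)
  have contra: False if "r < r'" "is_record s (k - r)" "passes_at s (k - r) r"
    "passes_at s (k - r') r'" "r' \<le> k" for r r'
  proof -
    have "s (k - r) \<le> s (k - r')" 
      if "r > 0" using \<open>passes_at s (k - r') r'\<close> \<open>r < r'\<close> \<open>r' \<le> k\<close> that
      bspec[of "{1..<r'}" "\<lambda>j. s (k - r' + j) \<le> s (k - r')" "r' - r"]
      by (auto simp: passes_at_def)
    moreover have "s (k - r') < s (k - r)" using that by (auto simp: is_record_def)
    ultimately show False using that by (cases "r > 0") (auto simp: passes_at_def)
  qed
  assume "r \<noteq> r'"
  then consider "r < r'" | "r' < r" by linarith
  then show False using contra[of r r'] contra[of r' r] assms by cases auto
qed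

section \<open>Partial sums and measurability of path events\<close>

abbreviation psum :: "(nat \<Rightarrow> real) \<Rightarrow> nat \<Rightarrow> real" where
  "psum x n \<equiv> (\<Sum>i<n. x i)"

lemma psum_restrict: "j \<le> n \<Longrightarrow> psum (restrict x {..<n}) j = psum x j"
  by (intro sum.cong) auto

lemma psum_shift: "psum x (k + j) = psum x k + psum (\<lambda>i. x (k + i)) j"
  by (induction j) auto

lemma is_record_cong: "(\<And>j. j \<le> k \<Longrightarrow> s j = s' j) \<Longrightarrow> is_record s k = is_record s' k"
  by (auto simp: is_record_def)

lemma reaches_cong:
  assumes "\<And>j. j \<le> k \<Longrightarrow> s j = s' j" shows "reaches w s k = reaches w s' k"
proof -
  have "is_record s i = is_record s' i" if "i \<le> k" for i
    using that assms by (intro is_record_cong) auto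
  then show ?thesis using assms by (auto simp: reaches_def)
qed

lemma passes_at_psum: "passes_at (psum x) k r = passes_at (psum (\<lambda>i. x (k + i))) 0 r"
  by (simp add: passes_at_def psum_shift)

text \<open>Outside \<open>I\<close> the coordinate is constantly \<open>undefined\<close>, so
  partial sums of any length are measurable without index side conditions.\<close>

lemma borel_measurable_PiM_component:
  "(\<lambda>x. x i :: real) \<in> borel_measurable (PiM I (\<lambda>_. borel))"
proof (cases "i \<in> I")
  case False
  then show ?thesis
    by (subst measurable_cong[where g = "\<lambda>_. undefined"])
      (auto simp: space_PiM PiE_def extensional_def)
qed (rule measurable_component_singleton)

lemma measurable_record [measurable]:
  fixes s :: "nat \<Rightarrow> 'a \<Rightarrow> real"
  assumes [measurable]: "\<And>i. s i \<in> borel_measurable M"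
  shows "Measurable.pred M (\<lambda>\<omega>. is_record (\<lambda>i. s i \<omega>) k)"
    "Measurable.pred M (\<lambda>\<omega>. stalls w (\<lambda>i. s i \<omega>) k)"
    "Measurable.pred M (\<lambda>\<omega>. reaches w (\<lambda>i. s i \<omega>) k)"
    "Measurable.pred M (\<lambda>\<omega>. passes_at (\<lambda>i. s i \<omega>) k r)"
proof -
  show [measurable]: "Measurable.pred M (\<lambda>\<omega>. is_record (\<lambda>i. s i \<omega>) k)" for k
    unfolding is_record_def by measurable
  show "Measurable.pred M (\<lambda>\<omega>. stalls w (\<lambda>i. s i \<omega>) k)"
    unfolding stalls_def by measurable
  show "Measurable.pred M (\<lambda>\<omega>. reaches w (\<lambda>i. s i \<omega>) k)"
    unfolding reaches_def by measurable
  show "Measurable.pred M (\<lambda>\<omega>. passes_at (\<lambda>i. s i \<omega>) k r)"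
    unfolding passes_at_def by measurable
qed

lemma measurable_stall_time:
  fixes s :: "nat \<Rightarrow> 'a \<Rightarrow> real"
  assumes [measurable]: "\<And>i. s i \<in> borel_measurable M"
  shows "(\<lambda>\<omega>. stall_time w (\<lambda>i. s i \<omega>)) \<in> measurable M (count_space UNIV)"
  unfolding stall_time_def by measurable

subsection \<open>Random walks with symmetric steps\<close>

locale symmetric_walk = prob_space M for M :: "'a measure" +
  fixes X :: "nat \<Rightarrow> 'a \<Rightarrow> real"
  assumes indep: "indep_vars (\<lambda>_. borel) X UNIV"
    and ident: "\<And>n. distr M borel (X n) = distr M borel (X 0)"
    and symmetric: "distr M borel (\<lambda>\<omega>. - X 0 \<omega>) = distr M borel (X 0)"
begin

abbreviation walk :: "'a \<Rightarrow> nat \<Rightarrow> real" where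
  "walk \<omega> \<equiv> psum (\<lambda>i. X i \<omega>)"

lemma measurable_X [measurable]: "X n \<in> borel_measurable M"
  using indep by (simp add: indep_vars_def)

definition stay :: "nat \<Rightarrow> real" where
  "stay n = prob {\<omega> \<in> space M. \<forall>j\<in>{1..n}. walk \<omega> j \<le> 0}"

definition stay_below :: "nat \<Rightarrow> real" where
  "stay_below n = prob {\<omega> \<in> space M. \<forall>j\<in>{1..n}. walk \<omega> j < 0}"

definition reach :: "nat \<Rightarrow> nat \<Rightarrow> real" where
  "reach w k = prob {\<omega> \<in> space M. reaches w (walk \<omega>) k}"

text \<open>Independence and common marginals determine the law of the first \<open>n\<close> steps.
  The invariance of \<open>Q\<close> under \<open>restrict\<close> says that it reads only those
  coordinates, since points of the finite product are \<open>undefined\<close> elsewhere.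
  \<open>Y\<close> will be a shift of the steps or their negated reversal.\<close>

lemma same_law:
  assumes Y: "indep_vars (\<lambda>_. borel) Y {..<n}"
    and law: "\<And>i. i < n \<Longrightarrow> distr M borel (Y i) = distr M borel (X 0)"
    and [measurable]: "Measurable.pred (PiM {..<n} (\<lambda>_. borel)) Q"
    and Q: "\<And>x. Q (restrict x {..<n}) = Q x"
  shows "prob {\<omega> \<in> space M. Q (\<lambda>i. Y i \<omega>)} = prob {\<omega> \<in> space M. Q (\<lambda>i. X i \<omega>)}"
proof (cases "n = 0")
  case True
  \<comment> \<open>The product characterisation of independence used below asks for a nonempty
    index set; for \<open>n = 0\<close> the predicate is constant.\<close>
  then have "Q x = Q (\<lambda>_. undefined)" for x using Q[of x] by (simp add: restrict_def)
  then show ?thesis by metis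
next
  case False
  have rv[measurable]: "Y i \<in> borel_measurable M" if "i < n" for i
    using Y that by (simp add: indep_vars_def)
  have dY: "distr M (PiM {..<n} (\<lambda>_. borel)) (\<lambda>\<omega>. \<lambda>i\<in>{..<n}. Y i \<omega>) =
      PiM {..<n} (\<lambda>_. distr M borel (X 0))"
    using Y False rv law
    by (subst (asm) indep_vars_iff_distr_eq_PiM') (auto intro: trans[OF _ PiM_cong[OF refl law]])
  have "indep_vars (\<lambda>_. borel) X {..<n}" using indep by (rule indep_vars_subset) simp
  then have dX: "distr M (PiM {..<n} (\<lambda>_. borel)) (\<lambda>\<omega>. \<lambda>i\<in>{..<n}. X i \<omega>) =
      PiM {..<n} (\<lambda>_. distr M borel (X 0))"
    using False
    by (subst (asm) indep_vars_iff_distr_eq_PiM') (auto intro: trans[OF _ PiM_cong[OF refl ident]])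
  let ?B = "{x \<in> space (PiM {..<n} (\<lambda>_. borel)). Q x}"
  have eq: "prob {\<omega> \<in> space M. Q (\<lambda>i. Z i \<omega>)} =
      measure (distr M (PiM {..<n} (\<lambda>_. borel)) (\<lambda>\<omega>. \<lambda>i\<in>{..<n}. Z i \<omega>)) ?B"
    if [measurable]: "\<And>i. i < n \<Longrightarrow> Z i \<in> borel_measurable M" for Z :: "nat \<Rightarrow> 'a \<Rightarrow> real"
  proof (subst measure_distr)
    show "(\<lambda>\<omega>. \<lambda>i\<in>{..<n}. Z i \<omega>) \<in> measurable M (PiM {..<n} (\<lambda>_. borel))"
      by (rule measurable_restrict) simp
    show "prob {\<omega> \<in> space M. Q (\<lambda>i. Z i \<omega>)} =
      prob ((\<lambda>\<omega>. \<lambda>i\<in>{..<n}. Z i \<omega>) -` ?B \<inter> space M)"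
      using Q by (intro arg_cong[where f = prob]) (auto simp: space_PiM)
  qed simp
  show ?thesis using eq[of Y] eq[of X] rv dX dY by simp
qed

lemma indep_vars_inj:
  assumes "inj_on \<sigma> I"
  shows "indep_vars (\<lambda>_. borel) (\<lambda>i. X (\<sigma> i)) I"
proof -
  have "indep_vars (\<lambda>i. PiM {\<sigma> i} (\<lambda>_. borel)) (\<lambda>i \<omega>. restrict (\<lambda>i. X i \<omega>) {\<sigma> i}) I"
    using assms by (intro indep_vars_restrict[OF indep]) (auto simp: disjoint_family_on_def inj_on_def)
  then have "indep_vars (\<lambda>_. borel) (\<lambda>i \<omega>. (\<lambda>x. x (\<sigma> i)) (restrict (\<lambda>i. X i \<omega>) {\<sigma> i})) I"
    by (rule indep_vars_compose2) measurable
  then show ?thesis by simp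
qed

text \<open>Independence of the first \<open>k\<close> steps from the next \<open>r\<close>, with
  the later block renumbered from 0 so that its probability is again one of the walk itself.\<close>

lemma block_indep:
  assumes P[measurable]: "Measurable.pred (PiM {..<k} (\<lambda>_. borel)) P"
    and Q[measurable]: "Measurable.pred (PiM {..<r} (\<lambda>_. borel)) Q"
    and PQ: "\<And>x. P (restrict x {..<k}) = P x" "\<And>x. Q (restrict x {..<r}) = Q x"
  shows "prob {\<omega> \<in> space M. P (\<lambda>i. X i \<omega>) \<and> Q (\<lambda>i. X (k + i) \<omega>)} =
    prob {\<omega> \<in> space M. P (\<lambda>i. X i \<omega>)} * prob {\<omega> \<in> space M. Q (\<lambda>i. X i \<omega>)}"
proof -
  have "indep_var (PiM {..<k} (\<lambda>_. borel)) (\<lambda>\<omega>. restrict (\<lambda>i. X i \<omega>) {..<k})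
      (PiM {k..<k+r} (\<lambda>_. borel)) (\<lambda>\<omega>. restrict (\<lambda>i. X i \<omega>) {k..<k+r})"
    by (rule indep_var_restrict[OF indep]) auto
  then have "indep_var (PiM {..<k} (\<lambda>_. borel)) ((\<lambda>x. x) \<circ> (\<lambda>\<omega>. restrict (\<lambda>i. X i \<omega>) {..<k}))
      (PiM {..<r} (\<lambda>_. borel)) ((\<lambda>x. \<lambda>i\<in>{..<r}. x (k + i)) \<circ> (\<lambda>\<omega>. restrict (\<lambda>i. X i \<omega>) {k..<k+r}))"
    by (rule indep_var_compose) (auto intro!: measurable_restrict)
  note * = indep_varD[OF this, of "{x\<in>space (PiM {..<k} (\<lambda>_. borel)). P x}" "{x\<in>space (PiM {..<r} (\<lambda>_. borel)). Q x}"]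
  have r: "(\<lambda>i\<in>{..<r}. restrict (\<lambda>i. X i \<omega>) {k..<k+r} (k + i)) = restrict (\<lambda>i. X (k + i) \<omega>) {..<r}" for \<omega>
    by (auto simp: restrict_def)
  have sets: "{x\<in>space (PiM {..<k} (\<lambda>_. borel)). P x} \<in> sets (PiM {..<k} (\<lambda>_. borel))"
    "{x\<in>space (PiM {..<r} (\<lambda>_. borel)). Q x} \<in> sets (PiM {..<r} (\<lambda>_. borel))" by measurable
  have "prob {\<omega> \<in> space M. P (\<lambda>i. X i \<omega>) \<and> Q (\<lambda>i. X (k + i) \<omega>)} =
      prob {\<omega> \<in> space M. P (\<lambda>i. X i \<omega>)} * prob {\<omega> \<in> space M. Q (\<lambda>i. X (k + i) \<omega>)}"
    using *[OF sets] by (simp add: vimage_def Int_def space_PiM PQ r conj_commute del: restrict_apply cong: conj_cong)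
  also have "prob {\<omega> \<in> space M. Q (\<lambda>i. X (k + i) \<omega>)} = prob {\<omega> \<in> space M. Q (\<lambda>i. X i \<omega>)}"
    using ident by (intro same_law[where n = r] indep_vars_inj Q PQ) (auto intro: trans)
  finally show ?thesis .
qed

lemma reaches_psum_restrict: "reaches w (psum (restrict x {..<k})) k = reaches w (psum x) k"
  by (intro reaches_cong psum_restrict)

lemma stay_restrict:
  "(\<forall>j\<in>{1..n}. psum (restrict x {..<n}) j \<le> 0) = (\<forall>j\<in>{1..n}. psum x j \<le> 0)"
  "(\<forall>j\<in>{1..n}. psum (restrict x {..<n}) j < 0) = (\<forall>j\<in>{1..n}. psum x j < 0)"
  by (simp_all add: psum_restrict)

lemma passes_restrict: "r > 0 \<Longrightarrow> passes_at (psum (restrict x {..<r})) 0 r = passes_at (psum x) 0 r"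
  unfolding passes_at_def by (auto simp: psum_restrict)

lemma stay_0 [simp]: "stay 0 = 1"
  by (simp add: stay_def prob_space)

lemma stay_nonneg [simp]: "0 \<le> stay n"
  by (simp add: stay_def)

lemma reach_0 [simp]: "reach w 0 = 1"
  by (simp add: reach_def prob_space)

lemma reach_nonneg [simp]: "0 \<le> reach w k"
  by (simp add: reach_def)

lemma stay_antimono: "m \<le> n \<Longrightarrow> stay n \<le> stay m"
  unfolding stay_def by (intro finite_measure_mono) auto

lemma prob_passes:
  assumes "r > 0"
  shows "prob {\<omega> \<in> space M. passes_at (walk \<omega>) 0 r} = stay (r - 1) - stay r"
proof -
  have split: "(\<forall>j\<in>{1..r}. P j) \<longleftrightarrow> (\<forall>j\<in>{1..r-1}. P j) \<and> P r" for P
    using assms by (cases r) (auto simp: atLeastAtMostSuc_conv)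
  have "{\<omega> \<in> space M. passes_at (walk \<omega>) 0 r} =
     {\<omega> \<in> space M. \<forall>j\<in>{1..r-1}. walk \<omega> j \<le> 0} -
     {\<omega> \<in> space M. \<forall>j\<in>{1..r}. walk \<omega> j \<le> 0}"
    unfolding split using assms by (cases r) (auto simp: passes_at_def)
  also have "prob \<dots> = stay (r - 1) - stay r"
    unfolding stay_def by (rule finite_measure_Diff) auto
  finally show ?thesis .
qed

text \<open>A renewal recursion whose weights are the law of a ladder gap cut off at
  \<open>w\<close>. Their sum telescopes to \<open>1 - stay w\<close>, so the renewal process is
  defective exactly by the probability of stalling at a given record.\<close>

lemma reach_rec:
  assumes "k > 0"
  shows "reach w k = (\<Sum>r\<in>{1..min w k}. reach w (k - r) * (stay (r - 1) - stay r))"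
proof -
  note borel_measurable_PiM_component [measurable]
  let ?E = "\<lambda>r. {\<omega> \<in> space M. reaches w (walk \<omega>) (k - r) \<and>
      passes_at (psum (\<lambda>i. X (k - r + i) \<omega>)) 0 r}"
  have "{\<omega> \<in> space M. reaches w (walk \<omega>) k} = (\<Union>r\<in>{1..min w k}. ?E r)"
    using assms by (subst reaches_iff) (auto simp del: atLeastAtMost_iff simp add: passes_at_psum[of _ "k - r" for r])
  then have "reach w k = prob (\<Union>r\<in>{1..min w k}. ?E r)"
    by (simp add: reach_def)
  also have "\<dots> = (\<Sum>r\<in>{1..min w k}. prob (?E r))"
  proof (rule finite_measure_finite_Union)
    show "disjoint_family_on ?E {1..min w k}"
      unfolding disjoint_family_on_def
    proof safe
      fix r r' \<omega> assume "r \<in> {1..min w k}" "r' \<in> {1..min w k}" "r \<noteq> r'"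
        "reaches w (walk \<omega>) (k - r)" "passes_at (psum (\<lambda>i. X (k - r + i) \<omega>)) 0 r"
        "reaches w (walk \<omega>) (k - r')" "passes_at (psum (\<lambda>i. X (k - r' + i) \<omega>)) 0 r'"
      then show "\<omega> \<in> {}"
        using passes_at_unique[of "walk \<omega>" k r r']
          passes_at_psum[of "\<lambda>i. X i \<omega>" "k - r" r] passes_at_psum[of "\<lambda>i. X i \<omega>" "k - r'" r']
        by (simp add: reaches_def)
    qed
  qed auto
  also have "\<dots> = (\<Sum>r\<in>{1..min w k}. reach w (k - r) * (stay (r - 1) - stay r))"
  proof (rule sum.cong)
    fix r assume r: "r \<in> {1..min w k}"
    have "prob (?E r) = prob {\<omega> \<in> space M. reaches w (walk \<omega>) (k - r)} *
        prob {\<omega> \<in> space M. passes_at (walk \<omega>) 0 r}"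
      using r by (intro block_indep[where r = r] reaches_psum_restrict passes_restrict) auto
    then show "prob (?E r) = reach w (k - r) * (stay (r - 1) - stay r)"
      using r prob_passes[of r] by (simp add: reach_def)
  qed simp
  finally show ?thesis .
qed

lemma prob_first_stall:
  "prob {\<omega> \<in> space M. stalls w (walk \<omega>) k \<and> (\<forall>l<k. \<not> stalls w (walk \<omega>) l)} =
    reach w k * stay w"
proof -
  note borel_measurable_PiM_component [measurable]
  have "prob {\<omega> \<in> space M. reaches w (walk \<omega>) k \<and>
      (\<forall>j\<in>{1..w}. psum (\<lambda>i. X (k + i) \<omega>) j \<le> 0)} = reach w k * stay w"
    unfolding reach_def stay_def
    by (rule block_indep[where P = "\<lambda>x. reaches w (psum x) k" and r = w
          and Q = "\<lambda>x. \<forall>j\<in>{1..w}. psum x j \<le> 0"])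
      (measurable, simp_all only: reaches_psum_restrict stay_restrict)
  then show ?thesis by (simp add: first_stall_iff psum_shift)
qed

text \<open>Read the first \<open>n\<close> steps backwards: the differences between the last
  position and the earlier ones are the partial sums of the reversed steps. Reversal preserves the
  law of an i.i.d. block and symmetry absorbs the change of sign, so a strict record at
  \<open>n\<close> becomes a strictly negative path.\<close>

lemma prob_record: "prob {\<omega> \<in> space M. is_record (walk \<omega>) n} = stay_below n"
proof -
  note borel_measurable_PiM_component [measurable]
  let ?Q = "\<lambda>x. \<forall>j\<in>{1..n}. psum x j < 0"
  have [simp]: "is_record (psum x) n = ?Q (\<lambda>i. - x (n - 1 - i))" for x
  proof -
    have sums: "psum (\<lambda>i. x (n - 1 - i)) j = psum x n - psum x (n - j)" if "j \<le> n" for j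
      using that
    proof (induction j)
      case (Suc j)
      then have "psum x (n - j) = psum x (n - Suc j) + x (n - Suc j)"
        by (metis Suc_diff_Suc Suc_le_lessD sum.lessThan_Suc)
      with Suc show ?case by simp
    qed simp
    have "is_record (psum x) n \<longleftrightarrow> (\<forall>j\<in>{1..n}. psum x (n - j) < psum x n)"
    proof
      assume *: "\<forall>j\<in>{1..n}. psum x (n - j) < psum x n"
      show "is_record (psum x) n" unfolding is_record_def
      proof (intro allI impI)
        fix i assume "i < n"
        then show "psum x i < psum x n" using bspec[OF *, of "n - i"] by simp
      qed
    qed (auto simp: is_record_def)
    also have "\<dots> \<longleftrightarrow> ?Q (\<lambda>i. - x (n - 1 - i))"
      using sums by (auto simp: sum_negf)
    finally show ?thesis .
  qed
  have "indep_vars (\<lambda>_. borel) (\<lambda>i. X (n - 1 - i)) {..<n}"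
    by (rule indep_vars_inj) (auto simp: inj_on_def)
  then have "indep_vars (\<lambda>_. borel) (\<lambda>i \<omega>. - X (n - 1 - i) \<omega>) {..<n}"
    by (rule indep_vars_compose2) measurable
  moreover have "distr M borel (\<lambda>\<omega>. - X i \<omega>) = distr M borel (X 0)" for i
  proof -
    have "distr M borel (\<lambda>\<omega>. - X i \<omega>) = distr (distr M borel (X i)) borel uminus"
      by (subst distr_distr) (auto simp: comp_def)
    also have "\<dots> = distr (distr M borel (X 0)) borel uminus"
      by (simp only: ident[of i])
    also have "\<dots> = distr M borel (X 0)"
      using symmetric by (subst distr_distr) (auto simp: comp_def)
    finally show ?thesis .
  qed
  ultimately have "prob {\<omega> \<in> space M. ?Q (\<lambda>i. - X (n - 1 - i) \<omega>)} =
      prob {\<omega> \<in> space M. ?Q (\<lambda>i. X i \<omega>)}"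
    by (intro same_law[where n = n]) (auto simp: psum_restrict)
  then show ?thesis by (simp add: stay_below_def)
qed

text \<open>Decompose at the first position of the maximum of the first \<open>n\<close> partial sums.\<close>

lemma sum_stay_below_stay: "(\<Sum>k\<le>n. stay_below k * stay (n - k)) = 1"
proof -
  note borel_measurable_PiM_component [measurable]
  let ?E = "\<lambda>k. {\<omega> \<in> space M. is_record (walk \<omega>) k \<and>
      (\<forall>j\<in>{1..n - k}. psum (\<lambda>i. X (k + i) \<omega>) j \<le> 0)}"
  have iff: "(\<forall>j\<in>{1..n-k}. psum (\<lambda>i. x (k + i)) j \<le> 0) \<longleftrightarrow> (\<forall>j\<in>{k<..n}. psum x j \<le> psum x k)"
    if "k \<le> n" for x k
  proof safe
    fix j assume *: "\<forall>j\<in>{1..n-k}. psum (\<lambda>i. x (k + i)) j \<le> 0" "j \<in> {k<..n}"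
    then have "j - k \<in> {1..n-k}" by auto
    with * have "psum (\<lambda>i. x (k + i)) (j - k) \<le> 0" by blast
    then show "psum x j \<le> psum x k" using psum_shift[of x k "j - k"] * by simp
  next
    fix j assume *: "\<forall>j\<in>{k<..n}. psum x j \<le> psum x k" "j \<in> {1..n-k}"
    then have "psum x (k + j) \<le> psum x k" using that by auto
    then show "psum (\<lambda>i. x (k + i)) j \<le> 0" by (simp add: psum_shift)
  qed
  have E: "?E k = {\<omega> \<in> space M. is_record (walk \<omega>) k \<and>
      (\<forall>j\<in>{k<..n}. walk \<omega> j \<le> walk \<omega> k)}" if "k \<le> n" for k
    by (simp only: iff[OF that, of "\<lambda>i. X i \<omega>" for \<omega>])
  have "(\<Union>k\<in>{..n}. ?E k) = space M"
  proof safe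
    fix \<omega> assume \<omega>: "\<omega> \<in> space M"
    obtain k where k: "k \<in> {..n}" "is_record (walk \<omega>) k"
        "\<forall>j\<in>{k<..n}. walk \<omega> j \<le> walk \<omega> k"
      using ex_first_max[of n "walk \<omega>"] by auto
    with \<omega> have "\<omega> \<in> ?E k" by (simp only: E atMost_iff mem_Collect_eq)
    with k(1) show "\<omega> \<in> (\<Union>k\<in>{..n}. ?E k)" by blast
  qed
  then have "1 = prob (\<Union>k\<in>{..n}. ?E k)" by (simp add: prob_space)
  also have "\<dots> = (\<Sum>k\<in>{..n}. prob (?E k))"
  proof (rule finite_measure_finite_Union)
    have "\<not> (is_record s k \<and> (\<forall>j\<in>{k<..n}. s j \<le> s k) \<and> is_record s k' \<and> (\<forall>j\<in>{k'<..n}. s j \<le> s k'))"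
      if "k \<in> {..n}" "k' \<in> {..n}" "k \<noteq> k'" for s :: "nat \<Rightarrow> real" and k k'
    proof -
      have contra: False if "k < k'" "k' \<le> n" "is_record s k'" "\<forall>j\<in>{k<..n}. s j \<le> s k" for k k'
      proof -
        have "s k < s k'" using that by (simp add: is_record_def)
        moreover have "s k' \<le> s k" using that by simp
        ultimately show False by simp
      qed
      show ?thesis
        using that contra[of k k'] contra[of k' k] by (cases k k' rule: linorder_cases) auto
    qed
    note excl = this
    show "disjoint_family_on ?E {..n}"
      unfolding disjoint_family_on_def
    proof (intro ballI impI)
      fix k k' assume kk': "k \<in> {..n}" "k' \<in> {..n}" "k \<noteq> k'"
      then have le: "k \<le> n" "k' \<le> n" by auto
      show "?E k \<inter> ?E k' = {}"
        unfolding E[OF le(1)] E[OF le(2)] using excl[OF kk'] by blast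
    qed
  qed auto
  also have "\<dots> = (\<Sum>k\<in>{..n}. stay_below k * stay (n - k))"
  proof (rule sum.cong)
    fix k assume "k \<in> {..n}"
    have "prob (?E k) = prob {\<omega> \<in> space M. is_record (walk \<omega>) k} * stay (n - k)"
      unfolding stay_def
      by (rule block_indep[where r = "n - k"])
        (auto simp: psum_restrict intro!: is_record_cong)
    then show "prob (?E k) = stay_below k * stay (n - k)" by (simp add: prob_record)
  qed simp
  finally show ?thesis by simp
qed

end

subsection \<open>Renewal sequences with bounded gaps\<close>

text \<open>\<open>f\<close> is a defective gap law with bounded support. The defect forces
  geometric decay of \<open>a\<close>, the source of all integrability of the stall time.\<close>

locale renewal =
  fixes a f :: "nat \<Rightarrow> real" and w :: nat
  assumes a_0: "a 0 = 1" and a_nonneg: "\<And>k. 0 \<le> a k"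
    and f_nonneg: "\<And>r. r \<in> {1..w} \<Longrightarrow> 0 \<le> f r"
    and f_sum: "(\<Sum>r\<in>{1..w}. f r) < 1"
    and a_rec: "\<And>k. k > 0 \<Longrightarrow> a k = (\<Sum>r\<in>{1..min w k}. a (k - r) * f r)"
begin

text \<open>The polynomial \<open>\<Sum>r\<in>{1..w}. f r * y ^ r\<close> is below 1 at
  \<open>y = 1\<close>, hence still below 1 at some \<open>y > 1\<close>; the recursion then
  propagates the bound.\<close>

lemma exponential_decay: "\<exists>y>1. \<forall>k. a k * y ^ k \<le> 1"
proof -
  have "((\<lambda>y. \<Sum>r\<in>{1..w}. f r * y ^ r) \<longlongrightarrow> (\<Sum>r\<in>{1..w}. f r * 1 ^ r)) (at_right 1)"
    by (intro tendsto_intros)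
  then have "eventually (\<lambda>y. (\<Sum>r\<in>{1..w}. f r * y ^ r) < 1) (at_right 1)"
    using f_sum by (intro order_tendstoD(2)) auto
  then have "eventually (\<lambda>y. (\<Sum>r\<in>{1..w}. f r * y ^ r) < 1 \<and> y > 1) (at_right (1::real))"
    using eventually_at_right_less by (rule eventually_conj)
  then obtain y where y: "(\<Sum>r\<in>{1..w}. f r * y ^ r) < 1" "y > 1"
    using eventually_happens'[OF trivial_limit_at_right_real] by blast
  have "a k * y ^ k \<le> 1" for k
  proof (induction k rule: less_induct)
    case (less k)
    show ?case
    proof (cases "k = 0")
      case False
      have "a k * y ^ k = (\<Sum>r\<in>{1..min w k}. (a (k - r) * y ^ (k - r)) * (f r * y ^ r))"
        unfolding a_rec[OF False[unfolded neq0_conv]] sum_distrib_right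
        by (intro sum.cong) (auto simp: power_add[symmetric])
      also have "\<dots> \<le> (\<Sum>r\<in>{1..min w k}. 1 * (f r * y ^ r))"
        using y less False f_nonneg by (intro sum_mono mult_right_mono) auto
      also have "\<dots> \<le> (\<Sum>r\<in>{1..w}. f r * y ^ r)"
        using y f_nonneg by (simp, intro sum_mono2) auto
      finally show ?thesis using y by simp
    qed (simp add: a_0)
  qed
  with y show ?thesis by blast
qed

lemma summable_quadratic: "summable (\<lambda>k. a k * real (k + 1) ^ 2)"
proof -
  obtain y where y: "y > 1" "\<And>k. a k * y ^ k \<le> 1" using exponential_decay by blast
  have geom: "summable (\<lambda>k. (\<lambda>_. 1) k * x ^ k)" if "norm x < 1" for x :: real
    using summable_geometric[OF that] by simp
  \<comment> \<open>Differentiating the geometric series twice gives the coefficients (k + 1) (k +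
    2), which dominate (k + 1)^2.\<close>
  have "summable (\<lambda>k. diffs (diffs (\<lambda>_. 1)) k * (1/y) ^ k)"
    by (rule termdiff_converges[where K = 1], use y in simp)
       (rule termdiff_converges[where K = 1], assumption, rule geom)
  then show ?thesis
  proof (rule summable_comparison_test'[where N = 0])
    fix k
    have "a k \<le> (1 / y) ^ k" using y by (simp add: field_simps power_one_over)
    then have "a k * real (k + 1) ^ 2 \<le> (1 / y) ^ k * (real (k + 1) * real (k + 2))"
      using a_nonneg[of k] y by (intro mult_mono) (auto simp: power2_eq_square)
    then show "norm (a k * real (k + 1) ^ 2) \<le> diffs (diffs (\<lambda>_. 1)) k * (1 / y) ^ k"
      using a_nonneg[of k] by (simp add: diffs_def abs_mult mult_ac)
  qed
qed

lemma summable_growth: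
  fixes h :: "nat \<Rightarrow> 'b::banach"
  assumes "\<And>k. norm (h k) \<le> C * real (k + 1) ^ 2"
  shows "summable (\<lambda>k. norm (a k *\<^sub>R h k))" "summable (\<lambda>k. a k *\<^sub>R h k)"
proof -
  have "summable (\<lambda>k. C * (a k * real (k + 1) ^ 2))"
    by (intro summable_mult summable_quadratic)
  then show "summable (\<lambda>k. norm (a k *\<^sub>R h k))"
  proof (rule summable_comparison_test'[where N = 0])
    fix k show "norm (norm (a k *\<^sub>R h k)) \<le> C * (a k * real (k + 1) ^ 2)"
      using mult_left_mono[OF assms[of k] a_nonneg[of k]] a_nonneg[of k] by (simp add: mult_ac)
  qed
  then show "summable (\<lambda>k. a k *\<^sub>R h k)" by (rule summable_norm_cancel)
qed

text \<open>Insert the recursion for \<open>a k\<close> and exchange the sums. The growth allowed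
  for \<open>h\<close> covers \<open>x ^ k\<close> with \<open>norm x \<le> 1\<close>, giving the
  generating function, as well as \<open>1\<close>, \<open>k\<close> and \<open>k\<^sup>2\<close>,
  giving the total mass and two moments.\<close>

lemma renewal_equation:
  fixes h :: "nat \<Rightarrow> 'b::banach"
  assumes h: "\<And>k. norm (h k) \<le> C * real (k + 1) ^ 2"
  shows "(\<Sum>k. a k *\<^sub>R h k) = h 0 + (\<Sum>r\<in>{1..w}. f r *\<^sub>R (\<Sum>k. a k *\<^sub>R h (k + r)))"
proof -
  have C: "C \<ge> 0" using order_trans[OF norm_ge_zero h[of 0]] by simp
  \<comment> \<open>Padding with zeros below \<open>r\<close> turns each shifted series into a
    series over all \<open>k\<close>, so that the recursion applies termwise to a finite sum of
    series.\<close>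
  let ?g = "\<lambda>r k. if r \<le> k then a (k - r) *\<^sub>R h k else 0"
  have shift: "(?g r) sums (\<Sum>k. a k *\<^sub>R h (k + r))" for r
  proof -
    have "norm (h (k + r)) \<le> C * real (r + 1) ^ 2 * real (k + 1) ^ 2" for k
    proof -
      have "norm (h (k + r)) \<le> C * real (k + r + 1) ^ 2" using h[of "k + r"] by simp
      also have "\<dots> \<le> C * ((real (r + 1) * real (k + 1)) ^ 2)"
        using C by (intro mult_left_mono power_mono) (auto simp: field_simps)
      finally show ?thesis by (simp add: power_mult_distrib mult_ac)
    qed
    then have "(\<lambda>k. a k *\<^sub>R h (k + r)) sums (\<Sum>k. a k *\<^sub>R h (k + r))"
      by (intro summable_sums summable_growth(2))
    then have "(\<lambda>k. ?g r (k + r)) sums (\<Sum>k. a k *\<^sub>R h (k + r))" by simp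
    then show ?thesis by (subst (asm) sums_iff_shift) simp
  qed
  have "(\<lambda>k. (if k = 0 then h 0 else 0) + (\<Sum>r\<in>{1..w}. f r *\<^sub>R ?g r k)) sums
     (h 0 + (\<Sum>r\<in>{1..w}. f r *\<^sub>R (\<Sum>k. a k *\<^sub>R h (k + r))))"
    by (intro sums_add sums_sum sums_scaleR_right shift sums_single[of 0 "\<lambda>_. h 0"])
  moreover have "(if k = 0 then h 0 else 0) + (\<Sum>r\<in>{1..w}. f r *\<^sub>R ?g r k) = a k *\<^sub>R h k" for k
  proof (cases "k = 0")
    case False
    have "(\<Sum>r\<in>{1..w}. f r *\<^sub>R ?g r k) = (\<Sum>r\<in>{1..min w k}. (a (k - r) * f r) *\<^sub>R h k)"
      by (intro sum.mono_neutral_cong_right) (auto simp: mult_ac)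
    with False show ?thesis by (simp add: a_rec[of k] scaleR_sum_left)
  qed (simp add: a_0)
  ultimately show ?thesis by (simp add: sums_iff)
qed

end

text \<open>Replaces the gap law by its tail \<open>p\<close>: the asymptotics are known for the
  tail, and its differences are never estimated.\<close>

lemma sum_by_parts_differences:
  fixes g :: "nat \<Rightarrow> 'b::real_vector" and p :: "nat \<Rightarrow> real"
  shows "(\<Sum>r\<in>{1..w}. (p (r - 1) - p r) *\<^sub>R g r) =
    p 0 *\<^sub>R g 0 - p w *\<^sub>R g w + (\<Sum>r<w. p r *\<^sub>R (g (Suc r) - g r))"
  by (induction w) (auto simp: algebra_simps)

section \<open>Distribution, generating function and moments of the stall time\<close>

context symmetric_walk
begin

definition stall :: "nat \<Rightarrow> 'a \<Rightarrow> nat" where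
  "stall w \<omega> = stall_time w (walk \<omega>)"

lemma measurable_stall [measurable]: "stall w \<in> measurable M (count_space UNIV)"
  unfolding stall_def[abs_def] by (rule measurable_stall_time) measurable

context
  fixes w :: nat
  assumes stay_pos: "stay w > 0"
begin

interpretation renewal "reach w" "\<lambda>r. stay (r - 1) - stay r" w
proof
  show "(\<Sum>r\<in>{1..w}. stay (r - 1) - stay r) < 1"
    using stay_pos sum_by_parts_differences[of stay "\<lambda>_. 1::real" w] by simp
  show "0 \<le> stay (r - 1) - stay r" if "r \<in> {1..w}" for r
    using stay_antimono[of "r - 1" r] by simp
qed (rule reach_0 reach_nonneg reach_rec, assumption?)+

text \<open>The case \<open>h = 1\<close> of the renewal equation; it says that the first-stall
  probabilities \<open>reach w k * stay w\<close> sum to one, so that a stall occurs almost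
  surely.\<close>

lemma reach_sums: "reach w sums (1 / stay w)"
proof -
  have "norm (1::real) \<le> 1 * real (k + 1) ^ 2" for k by simp
  note h = this
  have s: "summable (reach w)"
    using summable_growth(2)[of "\<lambda>_. 1::real", OF h] by simp
  have "(\<Sum>k. reach w k) = 1 + (\<Sum>r\<in>{1..w}. (stay (r - 1) - stay r) * (\<Sum>k. reach w k))"
    using renewal_equation[of "\<lambda>_. 1::real", OF h] unfolding real_scaleR_def mult_1_right .
  also have "\<dots> = 1 + (1 - stay w) * (\<Sum>k. reach w k)"
    using sum_by_parts_differences[of stay "\<lambda>_. 1::real" w]
    by (simp add: sum_distrib_right[symmetric])
  finally have "stay w * (\<Sum>k. reach w k) = 1" by (simp only: algebra_simps)
  then have "(\<Sum>k. reach w k) = 1 / stay w" using stay_pos by (simp add: field_simps)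
  then show ?thesis using s by (simp add: sums_iff)
qed

lemma AE_stalls: "AE \<omega> in M. \<exists>k. stalls w (walk \<omega>) k"
proof -
  let ?E = "\<lambda>k. {\<omega> \<in> space M. stalls w (walk \<omega>) k \<and>
      (\<forall>l<k. \<not> stalls w (walk \<omega>) l)}"
  have "(\<lambda>k. prob (?E k)) sums prob (\<Union>k. ?E k)"
  proof (rule finite_measure_UNION)
    show "disjoint_family ?E"
      unfolding disjoint_family_on_def
    proof safe
      fix k k' :: nat and \<omega> assume "k \<noteq> k'" "stalls w (walk \<omega>) k"
        "stalls w (walk \<omega>) k'" "\<forall>l<k. \<not> stalls w (walk \<omega>) l"
        "\<forall>l<k'. \<not> stalls w (walk \<omega>) l"
      then show "\<omega> \<in> {}" by (metis linorder_neqE_nat)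
    qed
  qed auto
  moreover have "(\<lambda>k. prob (?E k)) sums (1 / stay w * stay w)"
    unfolding prob_first_stall by (rule sums_mult2[OF reach_sums])
  ultimately have "prob (\<Union>k. ?E k) = 1"
    using sums_unique2 stay_pos by fastforce
  then have "AE \<omega> in M. \<omega> \<in> (\<Union>k. ?E k)" by (rule prob_eq_1[THEN iffD1, rotated]) auto
  then show ?thesis by eventually_elim auto
qed

lemma prob_stall: "prob {\<omega> \<in> space M. stall w \<omega> = k} = reach w k * stay w"
proof -
  have "prob {\<omega> \<in> space M. stall w \<omega> = k} =
    prob {\<omega> \<in> space M. stalls w (walk \<omega>) k \<and> (\<forall>l<k. \<not> stalls w (walk \<omega>) l)}"
  proof (rule finite_measure_eq_AE)
    show "AE \<omega> in M. (\<omega> \<in> {\<omega> \<in> space M. stall w \<omega> = k}) = (\<omega> \<in>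
      {\<omega> \<in> space M. stalls w (walk \<omega>) k \<and> (\<forall>l<k. \<not> stalls w (walk \<omega>) l)})"
      using AE_stalls by eventually_elim (simp add: stall_def stall_time_eq_iff)
  qed measurable
  then show ?thesis by (simp add: prob_first_stall)
qed

text \<open>Banach-valued, so that complex powers and real moments share one formula.\<close>

lemma expectation_stall:
  fixes h :: "nat \<Rightarrow> 'b::{banach, second_countable_topology}"
  assumes h: "\<And>k. norm (h k) \<le> C * real (k + 1) ^ 2"
  shows "integrable M (\<lambda>\<omega>. h (stall w \<omega>))"
    "expectation (\<lambda>\<omega>. h (stall w \<omega>)) = stay w *\<^sub>R (\<Sum>k. reach w k *\<^sub>R h k)"
proof -
  let ?f = "\<lambda>k \<omega>. indicat_real {\<omega> \<in> space M. stall w \<omega> = k} \<omega> *\<^sub>R h k"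
  have f: "?f k \<omega> = (if k = stall w \<omega> then h (stall w \<omega>) else 0)" if "\<omega> \<in> space M" for k \<omega>
    using that by (auto simp: indicator_def)
  have eq: "h (stall w \<omega>) = (\<Sum>k. ?f k \<omega>)" if "\<omega> \<in> space M" for \<omega>
    using sums_single[of "stall w \<omega>" "\<lambda>_. h (stall w \<omega>)"] f[OF that] by (simp add: sums_iff)
  have ind: "integrable M (indicat_real {\<omega> \<in> space M. stall w \<omega> = k})" for k
    by (intro integrable_real_indicator) (auto simp: emeasure_eq_measure)
  then have int: "integrable M (?f k)" for k by (intro integrable_scaleR_left)
  have val: "expectation (?f k) = stay w *\<^sub>R (reach w k *\<^sub>R h k)" for k
    by (simp add: integral_scaleR_left[OF ind] prob_stall mult_ac Int_absorb1)
  have ae: "AE \<omega> in M. summable (\<lambda>k. norm (?f k \<omega>))"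
  proof (rule AE_I2)
    fix \<omega> assume "\<omega> \<in> space M"
    then show "summable (\<lambda>k. norm (?f k \<omega>))"
      by (intro summable_finite[of "{stall w \<omega>}"]) (auto simp: f)
  qed
  have "expectation (\<lambda>\<omega>. norm (?f k \<omega>)) = stay w * norm (reach w k *\<^sub>R h k)" for k
    using prob_stall[of k] by (simp add: mult_ac Int_absorb1)
  then have sum: "summable (\<lambda>k. expectation (\<lambda>\<omega>. norm (?f k \<omega>)))"
    using summable_mult[OF summable_growth(1)[OF h], of "stay w"] by presburger
  have "integrable M (\<lambda>\<omega>. \<Sum>k. ?f k \<omega>)" by (rule integrable_suminf[OF int ae sum])
  then show "integrable M (\<lambda>\<omega>. h (stall w \<omega>))"
    by (subst Bochner_Integration.integrable_cong[OF refl eq])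
  have "expectation (\<lambda>\<omega>. h (stall w \<omega>)) = expectation (\<lambda>\<omega>. \<Sum>k. ?f k \<omega>)"
    by (intro Bochner_Integration.integral_cong refl eq)
  also have "\<dots> = (\<Sum>k. expectation (?f k))" by (rule integral_suminf[OF int ae sum])
  also have "\<dots> = stay w *\<^sub>R (\<Sum>k. reach w k *\<^sub>R h k)"
    unfolding val by (rule suminf_scaleR_right[symmetric, OF summable_growth(2)[OF h]])
  finally show "expectation (\<lambda>\<omega>. h (stall w \<omega>)) = stay w *\<^sub>R (\<Sum>k. reach w k *\<^sub>R h k)" .
qed

text \<open>The product form shows at once that the bracket has norm at least \<open>stay w\<close>,
  the expectation being bounded by 1; this lower bound will survive the scaling limit.\<close>

lemma expectation_power_stall:
  fixes x :: complex
  assumes "norm x \<le> 1"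
  shows "expectation (\<lambda>\<omega>. x ^ stall w \<omega>) *
    (stay w * x ^ w + (1 - x) * (\<Sum>r<w. stay r * x ^ r)) = stay w"
proof -
  have h: "norm (x ^ k) \<le> 1 * real (k + 1) ^ 2" for k
    using power_le_one[OF norm_ge_zero assms, of k] by (simp add: norm_power order_trans)
  define G where "G = (\<Sum>k. reach w k *\<^sub>R x ^ k)"
  have E: "expectation (\<lambda>\<omega>. x ^ stall w \<omega>) = stay w * G"
    using expectation_stall(2)[of "\<lambda>k. x ^ k", OF h] by (simp add: G_def scaleR_conv_of_real)
  have "(\<Sum>k. reach w k *\<^sub>R x ^ (k + r)) = x ^ r * G" for r
    unfolding G_def using suminf_mult[OF summable_growth(2)[of "\<lambda>k. x ^ k", OF h], of "x ^ r"]
    by (simp add: power_add mult_ac)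
  note shift = this
  have "G = 1 + (\<Sum>r\<in>{1..w}. (stay (r - 1) - stay r) *\<^sub>R (x ^ r * G))"
    using renewal_equation[of "\<lambda>k. x ^ k", OF h] unfolding shift G_def[symmetric] power_0 .
  also have "\<dots> = 1 + (\<Sum>r\<in>{1..w}. (stay (r - 1) - stay r) *\<^sub>R x ^ r) * G"
    by (simp add: sum_distrib_right)
  also have "(\<Sum>r\<in>{1..w}. (stay (r - 1) - stay r) *\<^sub>R x ^ r) =
      1 - stay w * x ^ w - (1 - x) * (\<Sum>r<w. stay r * x ^ r)"
    unfolding sum_by_parts_differences
    by (simp add: scaleR_conv_of_real algebra_simps sum_distrib_left sum_subtractf sum_distrib_right)
  finally have "G * (stay w * x ^ w + (1 - x) * (\<Sum>r<w. stay r * x ^ r)) = 1"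
    by (simp only: algebra_simps) simp
  then show ?thesis unfolding E by (simp add: mult.assoc)
qed

lemma summable_reach:
  "summable (reach w)" "summable (\<lambda>k. reach w k * real k)" "summable (\<lambda>k. reach w k * real k ^ 2)"
proof -
  have "real k \<le> 1 * real (k + 1) ^ 2" for k by (simp add: power2_eq_square algebra_simps)
  then show "summable (\<lambda>k. reach w k * real k)"
    using summable_growth(2)[of "\<lambda>k. real k" 1] by simp
  have "real k ^ 2 \<le> 1 * real (k + 1) ^ 2" for k by (simp add: power2_eq_square algebra_simps)
  then show "summable (\<lambda>k. reach w k * real k ^ 2)"
    using summable_growth(2)[of "\<lambda>k. real k ^ 2" 1] by simp
qed (use reach_sums in \<open>simp add: sums_iff\<close>)

text \<open>The stall time is a geometric sum of i.i.d. gaps, stopped with probability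
  \<open>stay w\<close> at each record. \<open>stay w * m1\<close> and \<open>stay w * m2\<close>
  are the first two moments of the truncated gap law (\<open>F1\<close> and \<open>F2\<close>
  below), rewritten by parts in terms of \<open>stay\<close>; expanding \<open>k + r\<close> and its
  square in the renewal equation does the rest.\<close>

lemma moments_stall:
  defines "m1 \<equiv> (\<Sum>r<w. stay r) / stay w - real w"
    and "m2 \<equiv> (\<Sum>r<w. stay r * (2 * real r + 1)) / stay w - real w ^ 2"
  shows "integrable M (\<lambda>\<omega>. real (stall w \<omega>))" "integrable M (\<lambda>\<omega>. real (stall w \<omega>) ^ 2)"
    "expectation (\<lambda>\<omega>. real (stall w \<omega>)) = m1"
    "expectation (\<lambda>\<omega>. real (stall w \<omega>) ^ 2) = 2 * m1 ^ 2 + m2"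
proof -
  have h1: "norm (real k) \<le> 1 * real (k + 1) ^ 2" for k
    by (simp add: power2_eq_square algebra_simps)
  have h2: "norm (real k ^ 2) \<le> 1 * real (k + 1) ^ 2" for k
    by (simp add: power2_eq_square algebra_simps)
  show "integrable M (\<lambda>\<omega>. real (stall w \<omega>))" "integrable M (\<lambda>\<omega>. real (stall w \<omega>) ^ 2)"
    using expectation_stall(1)[of "\<lambda>k. real k", OF h1]
      expectation_stall(1)[of "\<lambda>k. real k ^ 2", OF h2] by simp_all
  let ?f = "\<lambda>r. stay (r - 1) - stay r"
  define A where "A = (\<Sum>k. reach w k * real k)"
  define B where "B = (\<Sum>k. reach w k * real k ^ 2)"
  have S: "(\<Sum>k. reach w k) = 1 / stay w" using reach_sums by (simp add: sums_iff)
  have F0: "(\<Sum>r\<in>{1..w}. ?f r) = 1 - stay w"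
    using sum_by_parts_differences[of stay "\<lambda>_. 1::real" w] by simp
  have F1: "(\<Sum>r\<in>{1..w}. ?f r * real r) = stay w * m1"
  proof -
    have "stay w * m1 = (\<Sum>r<w. stay r) - stay w * real w"
      using stay_pos by (simp add: m1_def right_diff_distrib)
    then show ?thesis using sum_by_parts_differences[of stay real w] by simp
  qed
  have F2: "(\<Sum>r\<in>{1..w}. ?f r * real r ^ 2) = stay w * m2"
  proof -
    have "stay w * m2 = (\<Sum>r<w. stay r * (2 * real r + 1)) - stay w * real w ^ 2"
      using stay_pos by (simp add: m2_def right_diff_distrib)
    moreover have "real (Suc r) ^ 2 - real r ^ 2 = 2 * real r + 1" for r
      by (simp add: power2_eq_square algebra_simps)
    ultimately show ?thesis
      using sum_by_parts_differences[of stay "\<lambda>r. real r ^ 2" w] by simp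
  qed
  have "(\<lambda>k. reach w k * real (k + r)) sums (A + real r * (1 / stay w))" for r
  proof -
    have "(\<lambda>k. reach w k * real k + real r * reach w k) sums (A + real r * (1 / stay w))"
      unfolding A_def by (intro sums_add sums_mult reach_sums summable_sums summable_reach)
    then show ?thesis by (simp add: algebra_simps)
  qed
  note shift1 = sums_unique[OF this, symmetric]
  have "A = (\<Sum>r\<in>{1..w}. ?f r * (A + real r * (1 / stay w)))"
    using renewal_equation[of "\<lambda>k. real k", OF h1]
    unfolding real_scaleR_def shift1 A_def[symmetric] of_nat_0 add_0 .
  also have "\<dots> = (\<Sum>r\<in>{1..w}. ?f r) * A + (\<Sum>r\<in>{1..w}. ?f r * real r) * (1 / stay w)"
    unfolding sum_distrib_right sum.distrib[symmetric] by (intro sum.cong) (auto simp: algebra_simps)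
  finally have "A = (1 - stay w) * A + stay w * m1 * (1 / stay w)" unfolding F0 F1 .
  then have A: "stay w * A = m1" using stay_pos by (simp only: algebra_simps) simp
  then show "expectation (\<lambda>\<omega>. real (stall w \<omega>)) = m1"
    using expectation_stall(2)[of "\<lambda>k. real k", OF h1] by (simp add: A_def)
  have "(\<lambda>k. reach w k * real (k + r) ^ 2) sums (B + 2 * real r * A + real r ^ 2 * (1 / stay w))" for r
  proof -
    have "(\<lambda>k. reach w k * real k ^ 2 + 2 * real r * (reach w k * real k) + real r ^ 2 * reach w k) sums
        (B + 2 * real r * A + real r ^ 2 * (1 / stay w))"
      unfolding A_def B_def by (intro sums_add sums_mult reach_sums summable_sums summable_reach)
    then show ?thesis by (simp add: power2_eq_square algebra_simps)
  qed
  note shift2 = sums_unique[OF this, symmetric]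
  have "B = (\<Sum>r\<in>{1..w}. ?f r * (B + 2 * real r * A + real r ^ 2 * (1 / stay w)))"
    using renewal_equation[of "\<lambda>k. real k ^ 2", OF h2]
    unfolding real_scaleR_def shift2 B_def[symmetric] of_nat_0 zero_power2 add_0 .
  also have "\<dots> = (\<Sum>r\<in>{1..w}. ?f r) * B + (\<Sum>r\<in>{1..w}. ?f r * real r) * (2 * A) +
      (\<Sum>r\<in>{1..w}. ?f r * real r ^ 2) * (1 / stay w)"
    unfolding sum_distrib_right sum.distrib[symmetric] by (intro sum.cong) (auto simp: algebra_simps)
  finally have "B = (1 - stay w) * B + stay w * m1 * (2 * A) + stay w * m2 * (1 / stay w)"
    unfolding F0 F1 F2 .
  then have "stay w * B = 2 * m1 * (stay w * A) + m2"
    using stay_pos by (simp only: algebra_simps) simp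
  then show "expectation (\<lambda>\<omega>. real (stall w \<omega>) ^ 2) = 2 * m1 ^ 2 + m2"
    using expectation_stall(2)[of "\<lambda>k. real k ^ 2", OF h2] unfolding A
    by (simp add: B_def power2_eq_square)
qed

end

end

subsection \<open>A power series for the error function\<close>

text \<open>The Taylor series of the integral of u^(-1/2) exp (- a u) over 0 \<le> u \<le> 1, where
  1 / (j + 1/2) is the integral of u^(j - 1/2). It is entire in \<open>a\<close>, so no branch of
  the square root enters before the final formula.\<close>

definition erf_series :: "complex \<Rightarrow> complex" where
  "erf_series a = (\<Sum>j. (- 1) ^ j / (fact j * (of_nat j + 1 / 2)) * a ^ j)"

lemma norm_erf_series_coeff_le:
  "norm ((- 1) ^ j / (fact j * (of_nat j + 1 / 2)) :: complex) \<le> 2 * inverse (fact j)"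
proof -
  have "norm (of_nat j + 1 / 2 :: complex) = real j + 1 / 2"
    using norm_of_real[of "real j + 1 / 2", where ?'a = complex] by simp
  then have eq: "norm ((- 1) ^ j / (fact j * (of_nat j + 1 / 2)) :: complex) = 1 / (fact j * (real j + 1 / 2))"
    by (simp only: norm_divide norm_mult norm_power norm_minus_cancel norm_one power_one norm_fact)
  have "1 / (fact j * (real j + 1 / 2)) \<le> 1 / (fact j * (1 / 2))"
    by (intro divide_left_mono mult_left_mono) auto
  also have "\<dots> = 2 * inverse (fact j)" by (simp add: field_simps)
  finally show ?thesis unfolding eq .
qed

lemma summable_erf_series:
  "summable (\<lambda>j. (- 1) ^ j / (fact j * (of_nat j + 1 / 2)) * a ^ j :: complex)"
proof (rule summable_comparison_test'[where N = 0])
  show "summable (\<lambda>j. 2 * (inverse (fact j) * norm a ^ j))"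
    using summable_exp[of "norm a"] by (intro summable_mult)
  show "norm ((- 1) ^ j / (fact j * (of_nat j + 1 / 2)) * a ^ j :: complex) \<le>
      2 * (inverse (fact j) * norm a ^ j)" for j
    using mult_right_mono[OF norm_erf_series_coeff_le[of j], of "norm a ^ j"]
    unfolding norm_mult[of _ "a ^ j"] norm_power[of a] by (simp only: mult.assoc) simp
qed

text \<open>Multiplying the n-th coefficient by n + 1/2 leaves that of exp (- u), whence the
  differential equation. It is exactly what makes \<open>s / 2 * erf_series (s\<^sup>2)\<close> a
  primitive of \<open>exp (- (s\<^sup>2))\<close>.\<close>

lemma erf_series_deriv:
  obtains H' where "\<And>u. (erf_series has_field_derivative H' u) (at u)"
    "\<And>u. erf_series u / 2 + u * H' u = exp (- u)"
proof
  let ?c = "\<lambda>j. (- 1) ^ j / (fact j * (of_nat j + 1 / 2)) :: complex"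
  let ?H' = "\<lambda>u. \<Sum>n. diffs ?c n * u ^ n"
  show "(erf_series has_field_derivative ?H' u) (at u)" for u
    using termdiffs_strong_converges_everywhere[of ?c u] summable_erf_series
    by (simp add: erf_series_def[abs_def])
  show "erf_series u / 2 + u * ?H' u = exp (- u)" for u
  proof -
    have "summable (\<lambda>n. diffs ?c n * u ^ n)"
      by (rule termdiff_converges_all[OF summable_erf_series])
    then have "(\<lambda>n. u * (diffs ?c n * u ^ n)) sums (u * ?H' u)"
      by (intro sums_mult summable_sums)
    then have "(\<lambda>n. of_nat (Suc n) * ?c (Suc n) * u ^ Suc n) sums (u * ?H' u)"
      by (simp add: diffs_def mult_ac)
    then have "(\<lambda>n. of_nat n * ?c n * u ^ n) sums (u * ?H' u)"
      using sums_Suc[of "\<lambda>n. of_nat n * ?c n * u ^ n"] by simp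
    moreover have "(\<lambda>n. ?c n * u ^ n / 2) sums (erf_series u / 2)"
      unfolding erf_series_def by (intro sums_divide summable_sums summable_erf_series)
    ultimately have "(\<lambda>n. ?c n * u ^ n / 2 + of_nat n * ?c n * u ^ n) sums
        (erf_series u / 2 + u * ?H' u)" by (intro sums_add)
    moreover have "?c n * u ^ n / 2 + of_nat n * ?c n * u ^ n = (- u) ^ n /\<^sub>R fact n" for n
    proof -
      have nz: "of_nat n + 1 / 2 \<noteq> (0::complex)"
      proof
        assume "of_nat n + 1 / 2 = (0::complex)"
        then have "Re (of_nat n + 1 / 2) = 0" by (simp only: zero_complex.sel)
        then show False by simp
      qed
      have "?c n * u ^ n / 2 + of_nat n * ?c n * u ^ n = (?c n * (of_nat n + 1 / 2)) * u ^ n"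
      proof -
        have *: "c * U / 2 + k * c * U = (c * (k + 1 / 2)) * U" for c U k :: complex
          by (simp add: distrib_left distrib_right)
        show ?thesis by (rule *)
      qed
      also have "?c n * (of_nat n + 1 / 2) = (- 1) ^ n / fact n"
        using nz by (simp add: divide_simps del: of_nat_Suc)
      finally show ?thesis
        unfolding power_minus[of u n] scaleR_conv_of_real by (simp add: field_simps)
    qed
    ultimately have "(\<lambda>n. (- u) ^ n /\<^sub>R fact n) sums (erf_series u / 2 + u * ?H' u)" by simp
    then show ?thesis using exp_converges[of "- u"] by (rule sums_unique2)
  qed
qed

lemma isCont_erf_series: "isCont erf_series u"
  by (rule erf_series_deriv) (blast intro: DERIV_isCont)

lemma erf_eq_erf_series: "erf s = s / of_real (sqrt pi) * erf_series (s\<^sup>2)"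
proof -
  obtain H' where H': "\<And>u. (erf_series has_field_derivative H' u) (at u)"
    "\<And>u. erf_series u / 2 + u * H' u = exp (- u)" by (rule erf_series_deriv) blast
  have "((\<lambda>s. s / 2 * erf_series (s\<^sup>2)) has_field_derivative exp (- (t\<^sup>2))) (at t)" for t
  proof -
    have "((\<lambda>s. s / 2 * erf_series (s\<^sup>2)) has_field_derivative
        (1 / 2 * erf_series (t\<^sup>2) + t / 2 * (H' (t\<^sup>2) * (2 * t)))) (at t)"
      by (rule derivative_eq_intros DERIV_chain2[OF H'(1)] refl | simp)+
    moreover have "1 / 2 * erf_series (t\<^sup>2) + t / 2 * (H' (t\<^sup>2) * (2 * t)) = exp (- (t\<^sup>2))"
      using H'(2)[of "t\<^sup>2"] by (simp add: power2_eq_square mult_ac)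
    ultimately show ?thesis by simp
  qed
  then have "((\<lambda>t. exp (- (t\<^sup>2))) has_contour_integral
      (s / 2 * erf_series (s\<^sup>2) - 0 / 2 * erf_series (0\<^sup>2))) (linepath 0 s)"
    using contour_integral_primitive[of UNIV "\<lambda>s. s / 2 * erf_series (s\<^sup>2)" _ "linepath 0 s"]
    by simp
  then show ?thesis unfolding erf_def by (simp add: contour_integral_unique)
qed

text \<open>The product \<open>csqrt (a * of_real pi) * erf (csqrt a)\<close> equals
  \<open>a * erf_series a\<close>; in this form the limiting denominator is visibly continuous
  everywhere, in particular at 0.\<close>

definition avalanche_denominator :: "complex \<Rightarrow> complex" where
  "avalanche_denominator a = exp (- a) + a * erf_series a"

definition avalanche_laplace :: "complex \<Rightarrow> complex" where
  "avalanche_laplace a = 1 / avalanche_denominator a"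

lemma avalanche_laplace_0 [simp]: "avalanche_laplace 0 = 1"
  by (simp add: avalanche_laplace_def avalanche_denominator_def)

lemma isCont_avalanche_laplace:
  "avalanche_denominator a \<noteq> 0 \<Longrightarrow> isCont avalanche_laplace a"
  unfolding avalanche_laplace_def[abs_def] avalanche_denominator_def
  by (intro continuous_intros isCont_erf_series) auto

lemma avalanche_laplace_eq_erf:
  assumes "\<epsilon> \<ge> 0"
  shows "avalanche_laplace (z * of_real \<epsilon>) =
    1 / (csqrt (z * of_real \<epsilon> * of_real pi) * erf (csqrt (z * of_real \<epsilon>)) + exp (- (z * of_real \<epsilon>)))"
proof -
  \<comment> \<open>Multiplication by a positive real keeps the root in the half plane that singles
    out the principal value.\<close>
  have "csqrt (a * of_real pi) = csqrt a * of_real (sqrt pi)" for a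
  proof (rule csqrt_unique)
    show "(csqrt a * of_real (sqrt pi))\<^sup>2 = a * of_real pi"
      by (simp add: power_mult_distrib of_real_power[symmetric])
    show "0 < Re (csqrt a * of_real (sqrt pi)) \<or>
      Re (csqrt a * of_real (sqrt pi)) = 0 \<and> 0 \<le> Im (csqrt a * of_real (sqrt pi))"
      using csqrt_principal[of a] by auto
  qed
  then have "csqrt (a * of_real pi) * erf (csqrt a) = a * erf_series a" for a
    using power2_csqrt[of a] unfolding erf_eq_erf_series by (simp add: power2_eq_square)
  then show ?thesis by (simp add: avalanche_laplace_def avalanche_denominator_def add.commute)
qed

subsection \<open>Sequences decaying like an inverse square root\<close>

text \<open>The error \<open>a n - l * b n\<close> has increments of at most e/2 times those of
  \<open>b\<close> from some \<open>N\<close> on; summing them bounds the error by e/2 times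
  \<open>b n\<close> up to a constant, which \<open>b\<close> outgrows.\<close>

lemma stolz_cesaro:
  fixes a b :: "nat \<Rightarrow> real"
  assumes b: "strict_mono b" "filterlim b at_top sequentially"
    and lim: "(\<lambda>n. (a (Suc n) - a n) / (b (Suc n) - b n)) \<longlonglongrightarrow> l"
  shows "(\<lambda>n. a n / b n) \<longlonglongrightarrow> l"
proof (rule tendstoI)
  fix e :: real assume "e > 0"
  then have "\<forall>\<^sub>F n in sequentially. dist ((a (Suc n) - a n) / (b (Suc n) - b n)) l < e / 2"
    by (intro tendstoD[OF lim]) simp
  then obtain N where N: "dist ((a (Suc n) - a n) / (b (Suc n) - b n)) l < e / 2" if "n \<ge> N" for n
    by (auto simp: eventually_at_top_linorder)
  define d where "d n = a n - l * b n" for n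
  have incr: "\<bar>d (Suc n) - d n\<bar> \<le> e / 2 * (b (Suc n) - b n)" if "n \<ge> N" for n
  proof -
    have pos: "b (Suc n) - b n > 0" using b(1) by (simp add: strict_mono_def)
    have "d (Suc n) - d n = ((a (Suc n) - a n) / (b (Suc n) - b n) - l) * (b (Suc n) - b n)"
      using pos by (simp add: d_def field_simps)
    then show ?thesis using N[OF that] pos by (simp add: abs_mult dist_real_def)
  qed
  have bound: "\<bar>d n - d N\<bar> \<le> e / 2 * (b n - b N)" if "n \<ge> N" for n
    using that
  proof (induction n rule: dec_induct)
    case (step n)
    then show ?case using incr[of n] by (simp add: right_diff_distrib)
  qed simp
  have "\<forall>\<^sub>F n in sequentially. b n > (\<bar>d N\<bar> + e / 2 * \<bar>b N\<bar>) / (e / 2)"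
    using b(2) by (auto simp: filterlim_at_top_dense)
  moreover have "\<forall>\<^sub>F n in sequentially. b n > 0" using b(2) by (auto simp: filterlim_at_top_dense)
  ultimately show "\<forall>\<^sub>F n in sequentially. dist (a n / b n) l < e"
    using eventually_ge_at_top[of N]
  proof eventually_elim
    case (elim n)
    then have "\<bar>d N\<bar> + e / 2 * \<bar>b N\<bar> < e / 2 * b n"
      using \<open>e > 0\<close> by (simp add: field_simps)
    moreover have "- (e / 2 * b N) \<le> e / 2 * \<bar>b N\<bar>"
      using mult_left_mono[of "- b N" "\<bar>b N\<bar>" "e / 2"] \<open>e > 0\<close> by simp
    ultimately have "\<bar>d n\<bar> < e * b n"
      using bound[of n] elim by (simp add: right_diff_distrib)
    moreover have "a n / b n - l = d n / b n" using elim by (simp add: d_def field_simps)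
    ultimately show ?case using elim by (simp add: dist_real_def abs_divide divide_less_eq)
  qed
qed

locale inverse_sqrt_decay =
  fixes p :: "nat \<Rightarrow> real" and c :: real
  assumes decay: "(\<lambda>n. sqrt (real n) * p n) \<longlonglongrightarrow> c" and c_pos: "c > 0"
    and p_nonneg: "\<And>n. p n \<ge> 0"
begin

lemma eventually_p_pos: "\<forall>\<^sub>F n in sequentially. p n > 0"
proof -
  have "\<forall>\<^sub>F n in sequentially. sqrt (real n) * p n > 0"
    by (rule order_tendstoD(1)[OF decay c_pos])
  then show ?thesis by eventually_elim (auto simp: zero_less_mult_iff)
qed

text \<open>The terms behave like c r^(j - 1/2), so their sums grow like c w^(j + 1/2) / (j + 1/2),
  whereas \<open>real w ^ Suc j * p w\<close> behaves like c w^(j + 1/2). The constant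
  \<open>c\<close> cancels. Stolz-Cesaro against w^(j + 1/2) makes this precise.\<close>

lemma moment_limit:
  "(\<lambda>w. (\<Sum>r<w. p r * real r ^ j) / (real w ^ Suc j * p w)) \<longlonglongrightarrow> inverse (real j + 1 / 2)"
proof -
  have "(\<lambda>w. (sqrt (real w) * p w) * (real w powr (real j - 1 / 2) /
      ((real w + 1) powr (real j + 1 / 2) - real w powr (real j + 1 / 2)))) \<longlonglongrightarrow>
      c * inverse (real j + 1 / 2)"
    by (intro tendsto_mult decay) real_asymp
  moreover have "\<forall>\<^sub>F w in sequentially. (sqrt (real w) * p w) * (real w powr (real j - 1 / 2) /
      ((real w + 1) powr (real j + 1 / 2) - real w powr (real j + 1 / 2))) =
      ((\<Sum>r<Suc w. p r * real r ^ j) - (\<Sum>r<w. p r * real r ^ j)) /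
        (real (Suc w) powr (real j + 1 / 2) - real w powr (real j + 1 / 2))"
    using eventually_gt_at_top[of 0]
  proof eventually_elim
    case (elim w)
    have "sqrt (real w) * real w powr (real j - 1 / 2) = real w ^ j"
      using elim by (simp add: powr_half_sqrt[symmetric] powr_add[symmetric] powr_realpow)
    then show ?case by (simp add: add.commute mult_ac)
  qed
  ultimately have lim: "(\<lambda>w. ((\<Sum>r<Suc w. p r * real r ^ j) - (\<Sum>r<w. p r * real r ^ j)) /
        (real (Suc w) powr (real j + 1 / 2) - real w powr (real j + 1 / 2)))
        \<longlonglongrightarrow> c * inverse (real j + 1 / 2)"
    by (rule Lim_transform_eventually)
  have "(\<lambda>w. (\<Sum>r<w. p r * real r ^ j) / real w powr (real j + 1 / 2)) \<longlonglongrightarrow> c * inverse (real j + 1 / 2)"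
  proof (rule stolz_cesaro[OF _ _ lim])
    show "strict_mono (\<lambda>w. real w powr (real j + 1 / 2))"
      by (auto intro!: strict_monoI powr_less_mono2)
    show "filterlim (\<lambda>w. real w powr (real j + 1 / 2)) at_top sequentially"
      by real_asymp
  qed
  then have "(\<lambda>w. (\<Sum>r<w. p r * real r ^ j) / real w powr (real j + 1 / 2) / (sqrt (real w) * p w))
      \<longlonglongrightarrow> c * inverse (real j + 1 / 2) / c"
    using c_pos by (intro tendsto_divide decay) auto
  moreover have "\<forall>\<^sub>F w in sequentially.
      (\<Sum>r<w. p r * real r ^ j) / real w powr (real j + 1 / 2) / (sqrt (real w) * p w) =
      (\<Sum>r<w. p r * real r ^ j) / (real w ^ Suc j * p w)"
    using eventually_gt_at_top[of 0]
  proof eventually_elim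
    case (elim w)
    have "real w powr (real j + 1 / 2) * sqrt (real w) = real w powr (real (Suc j))"
      using elim by (simp add: powr_half_sqrt[symmetric] powr_add[symmetric] add_ac)
    also have "\<dots> = real w ^ Suc j" using elim by (simp only: powr_realpow of_nat_0_less_iff)
    finally show ?case by (simp add: mult.assoc[symmetric])
  qed
  ultimately show ?thesis using c_pos by (simp add: Lim_transform_eventually)
qed

text \<open>Expanding x^r = exp (- z r / n) in powers of z turns the weighted sum into a series
  whose j-th term involves only the j-th power moment of \<open>p\<close>.
  \<open>moment_limit\<close> gives the limit of each term, and the limiting series is
  \<open>erf_series\<close>.\<close>

lemma laplace_denominator_limit:
  fixes w :: "nat \<Rightarrow> nat" and z :: complex and x :: "nat \<Rightarrow> complex"
  assumes w: "filterlim w at_top sequentially" "(\<lambda>n. real (w n) / real n) \<longlonglongrightarrow> \<epsilon>"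
  defines "x \<equiv> (\<lambda>n. exp (- (z / of_nat n)))"
  shows "(\<lambda>n. x n ^ w n + (1 - x n) * (\<Sum>r<w n. p r * x n ^ r) / p (w n)) \<longlonglongrightarrow>
    exp (- (z * of_real \<epsilon>)) + z * of_real \<epsilon> * erf_series (z * of_real \<epsilon>)"
proof -
  \<comment> \<open>Normalised so that \<open>T j k\<close> tends to 1 / (j + 1/2) and, as r < k in
    the sum, never exceeds \<open>T 0 k\<close>; the second fact gives a bound uniform in
    \<open>j\<close>.\<close>
  define T where "T j k = (\<Sum>r<k. p r * real r ^ j) / (real k ^ Suc j * p k)" for j k
  have T: "(\<lambda>n. T j (w n)) \<longlonglongrightarrow> inverse (real j + 1 / 2)" for j
    unfolding T_def by (rule filterlim_compose[OF moment_limit w(1)])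
  have ratio: "(\<lambda>n. - (z * of_real (real (w n) / real n))) \<longlonglongrightarrow> - (z * of_real \<epsilon>)"
    by (intro tendsto_intros w)
  have pow: "x n ^ r = exp (- (z * of_real (real r / real n)))" for n r
    by (simp add: x_def exp_of_nat_mult[symmetric] mult.commute)
  have first: "(\<lambda>n. x n ^ w n) \<longlonglongrightarrow> exp (- (z * of_real \<epsilon>))"
    unfolding pow by (intro tendsto_intros ratio)
  have second: "(\<lambda>n. of_nat (w n) * (1 - x n)) \<longlonglongrightarrow> z * of_real \<epsilon>"
  proof (cases "z = 0")
    case False
    have 0: "(\<lambda>n. - (z / of_nat n)) \<longlonglongrightarrow> 0"
      by (auto intro!: tendsto_eq_intros tendsto_divide_0[OF tendsto_const] tendsto_of_nat)
    moreover have "\<forall>\<^sub>F n in sequentially. - (z / of_nat n) \<noteq> 0"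
      using eventually_gt_at_top[of 0] by eventually_elim (use False in auto)
    ultimately have "filterlim (\<lambda>n. - (z / of_nat n)) (at 0) sequentially"
      by (simp add: filterlim_at)
    then have "(\<lambda>n. (exp (- (z / of_nat n)) - 1) / (- (z / of_nat n))) \<longlonglongrightarrow> 1"
      by (rule filterlim_compose[OF lim_exp_minus_1])
    then have "(\<lambda>n. (exp (- (z / of_nat n)) - 1) / (- (z / of_nat n)) * (z * of_real (real (w n) / real n)))
        \<longlonglongrightarrow> 1 * (z * of_real \<epsilon>)"
      by (intro tendsto_intros w)
    moreover have "\<forall>\<^sub>F n in sequentially. (exp (- (z / of_nat n)) - 1) / (- (z / of_nat n)) *
        (z * of_real (real (w n) / real n)) = of_nat (w n) * (1 - x n)"
      using eventually_gt_at_top[of 0] by eventually_elim (use False in \<open>simp add: x_def field_simps\<close>)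
    ultimately show ?thesis by (simp add: Lim_transform_eventually)
  qed (simp add: x_def)
  obtain K where K: "K > 0" "\<And>n. \<bar>real (w n) / real n\<bar> \<le> K"
    using convergent_imp_Bseq[OF convergentI[OF w(2)]] by (auto elim!: BseqE)
  obtain B where B: "B > 0" "\<And>n. \<bar>T 0 (w n)\<bar> \<le> B"
    using convergent_imp_Bseq[OF convergentI[OF T[of 0]]] by (auto elim!: BseqE)
  let ?a = "\<lambda>j n. (- (z * of_real (real (w n) / real n))) ^ j /\<^sub>R fact j * of_real (T j (w n))"
  \<comment> \<open>Tannery's theorem: the j-th term is dominated by B (|z| K)^j / j!, where
    \<open>K\<close> bounds \<open>w n / n\<close> and \<open>B\<close> bounds
    \<open>T 0 (w n)\<close>.\<close>
  have third: "(\<lambda>n. \<Sum>j. ?a j n) \<longlonglongrightarrow>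
      (\<Sum>j. (- (z * of_real \<epsilon>)) ^ j /\<^sub>R fact j * of_real (inverse (real j + 1 / 2)))"
  proof (rule tannerys_theorem[THEN conjunct2, THEN conjunct2])
    show "(\<lambda>n. ?a j n) \<longlonglongrightarrow> (- (z * of_real \<epsilon>)) ^ j /\<^sub>R fact j * of_real (inverse (real j + 1 / 2))" for j
      by (intro tendsto_intros ratio T)
    show "summable (\<lambda>j. B * ((norm z * K) ^ j /\<^sub>R fact j))"
      by (intro summable_mult summable_exp_generic)
    have "norm (?a j n) \<le> B * ((norm z * K) ^ j /\<^sub>R fact j)" for j n
    proof -
      have "\<bar>T j (w n)\<bar> \<le> \<bar>T 0 (w n)\<bar>"
      proof (cases "w n = 0")
        case False
        have "(\<Sum>r<w n. p r * real r ^ j) \<le> (\<Sum>r<w n. p r * real (w n) ^ j)"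
          by (intro sum_mono mult_left_mono power_mono p_nonneg) auto
        then have "T j (w n) \<le> (\<Sum>r<w n. p r * real (w n) ^ j) / (real (w n) ^ Suc j * p (w n))"
          unfolding T_def using p_nonneg by (intro divide_right_mono) auto
        also have "\<dots> = T 0 (w n)" using False by (simp add: T_def sum_distrib_right[symmetric])
        finally have "T j (w n) \<le> T 0 (w n)" .
        moreover have "T j (w n) \<ge> 0"
          unfolding T_def using p_nonneg by (intro divide_nonneg_nonneg sum_nonneg mult_nonneg_nonneg) auto
        ultimately show ?thesis by simp
      qed (simp add: T_def)
      then have "\<bar>T j (w n)\<bar> \<le> B" using B(2)[of n] by simp
      moreover have "(norm z * \<bar>real (w n) / real n\<bar>) ^ j \<le> (norm z * K) ^ j"
        using K by (intro power_mono mult_left_mono) auto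
      ultimately have "(norm z * \<bar>real (w n) / real n\<bar>) ^ j / fact j * \<bar>T j (w n)\<bar> \<le> (norm z * K) ^ j / fact j * B"
        using B K by (intro mult_mono divide_right_mono) auto
      then show ?thesis
        by (simp add: norm_mult norm_power norm_divide field_simps)
    qed
    then show "\<forall>\<^sub>F (j, n) in at_top \<times>\<^sub>F sequentially. norm (?a j n) \<le> B * ((norm z * K) ^ j /\<^sub>R fact j)"
      by (intro always_eventually allI) (simp add: case_prod_beta)
  qed simp
  have "(\<Sum>j. (- (z * of_real \<epsilon>)) ^ j /\<^sub>R fact j * of_real (inverse (real j + 1 / 2))) =
      erf_series (z * of_real \<epsilon>)"
    unfolding erf_series_def
  proof (intro suminf_cong)
    fix j
    have aux: "of_real (inverse f) * (m * U) * inverse g = m / (of_real f * g) * U"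
      for m U g :: complex and f :: real
      by (simp add: field_simps)
    show "(- (z * of_real \<epsilon>)) ^ j /\<^sub>R fact j * of_real (inverse (real j + 1 / 2)) =
        (- 1) ^ j / (fact j * (of_nat j + 1 / 2)) * (z * of_real \<epsilon>) ^ j"
      using aux[of "fact j" "(- 1) ^ j" "(z * of_real \<epsilon>) ^ j" "of_nat j + 1 / 2"]
      unfolding power_minus[of "z * of_real \<epsilon>"] scaleR_conv_of_real by simp
  qed
  note third = third[unfolded this]
  have "\<forall>\<^sub>F n in sequentially. x n ^ w n + of_nat (w n) * (1 - x n) * (\<Sum>j. ?a j n) =
      x n ^ w n + (1 - x n) * (\<Sum>r<w n. p r * x n ^ r) / p (w n)"
    using filterlim_at_top[THEN iffD1, rule_format, OF w(1), of 1]
      eventually_compose_filterlim[OF eventually_p_pos w(1)]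
  proof eventually_elim
    case (elim n)
    have exp_sums: "(\<lambda>j. p r * ((- (z * of_real (real r / real n))) ^ j /\<^sub>R fact j)) sums (p r * x n ^ r)" for r
      unfolding pow by (intro sums_mult exp_converges)
    have "(\<lambda>j. (\<Sum>r<w n. p r * ((- (z * of_real (real r / real n))) ^ j /\<^sub>R fact j)) *
        of_real (1 / (real (w n) * p (w n)))) sums
        ((\<Sum>r<w n. p r * x n ^ r) * of_real (1 / (real (w n) * p (w n))))"
      by (intro sums_mult2 sums_sum exp_sums)
    moreover have "(\<Sum>r<w n. p r * ((- (z * of_real (real r / real n))) ^ j /\<^sub>R fact j)) *
        of_real (1 / (real (w n) * p (w n))) = ?a j n" for j
    proof -
      have "(\<Sum>r<w n. p r * ((- (z * of_real (real r / real n))) ^ j /\<^sub>R fact j)) =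
        (\<Sum>r<w n. of_real (p r * real r ^ j)) * ((- (z * of_real (1 / real n))) ^ j /\<^sub>R fact j)"
        unfolding sum_distrib_right
      proof (intro sum.cong refl)
        fix r
        have "- (z * of_real (real r / real n)) = of_real (real r) * (- (z * of_real (1 / real n)))"
          by simp
        then have "(- (z * of_real (real r / real n))) ^ j =
            of_real (real r ^ j) * (- (z * of_real (1 / real n))) ^ j"
          by (simp only: power_mult_distrib of_real_power)
        then show "p r * ((- (z * of_real (real r / real n))) ^ j /\<^sub>R fact j) =
            of_real (p r * real r ^ j) * ((- (z * of_real (1 / real n))) ^ j /\<^sub>R fact j)"
          by (simp only: scaleR_conv_of_real of_real_mult mult_ac)
      qed
      also have "(- (z * of_real (1 / real n))) ^ j =
          (- (z * of_real (real (w n) / real n))) ^ j * of_real (1 / real (w n) ^ j)"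
      proof -
        have "- (z * of_real (1 / real n)) =
            - (z * of_real (real (w n) / real n)) * of_real (1 / real (w n))"
          using elim by simp
        then show ?thesis by (simp only: power_mult_distrib of_real_power[symmetric] power_one_over)
      qed
      finally have "(\<Sum>r<w n. p r * ((- (z * of_real (real r / real n))) ^ j /\<^sub>R fact j)) =
          of_real (\<Sum>r<w n. p r * real r ^ j) *
          (((- (z * of_real (real (w n) / real n))) ^ j * of_real (1 / real (w n) ^ j)) /\<^sub>R fact j)"
        by (simp only: of_real_sum)
      moreover have "of_real s * ((A * of_real (1 / d)) /\<^sub>R f) * of_real (1 / (k * q)) =
          A /\<^sub>R f * of_real (s / (k * d * q))" for A :: complex and s d f k q :: real
        by (simp add: scaleR_conv_of_real divide_inverse mult_ac)
      ultimately show ?thesis by (simp only: T_def power_Suc)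
    qed
    ultimately have "(\<Sum>j. ?a j n) = (\<Sum>r<w n. p r * x n ^ r) * of_real (1 / (real (w n) * p (w n)))"
      by (simp add: sums_iff)
    then show ?case using elim by simp
  qed
  moreover have "(\<lambda>n. x n ^ w n + of_nat (w n) * (1 - x n) * (\<Sum>j. ?a j n)) \<longlonglongrightarrow>
      exp (- (z * of_real \<epsilon>)) + z * of_real \<epsilon> * erf_series (z * of_real \<epsilon>)"
    by (intro tendsto_add tendsto_mult first second third)
  ultimately show ?thesis by (rule Lim_transform_eventually[rotated])
qed

text \<open>From \<open>E n * D n = 1\<close> and \<open>norm (E n) \<le> 1\<close> it follows that
  \<open>norm (D n) \<ge> 1\<close>, and the bound passes to the limit. The absence of zeros of
  \<open>avalanche_denominator\<close> is thus obtained from probability, not from properties of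
  \<open>erf\<close>.\<close>

lemma laplace_limit:
  fixes w :: "nat \<Rightarrow> nat" and z :: complex and E x :: "nat \<Rightarrow> complex"
  assumes w: "filterlim w at_top sequentially" "(\<lambda>n. real (w n) / real n) \<longlonglongrightarrow> \<epsilon>"
  defines "x \<equiv> (\<lambda>n. exp (- (z / of_nat n)))"
  assumes E: "\<And>n. norm (E n) \<le> 1"
    "\<forall>\<^sub>F n in sequentially. E n * (p (w n) * x n ^ w n + (1 - x n) * (\<Sum>r<w n. p r * x n ^ r)) = p (w n)"
  shows "E \<longlonglongrightarrow> avalanche_laplace (z * of_real \<epsilon>)"
    and "avalanche_denominator (z * of_real \<epsilon>) \<noteq> 0"
proof -
  define D where "D n = x n ^ w n + (1 - x n) * (\<Sum>r<w n. p r * x n ^ r) / p (w n)" for n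
  let ?D = "exp (- (z * of_real \<epsilon>)) + z * of_real \<epsilon> * erf_series (z * of_real \<epsilon>)"
  have D: "D \<longlonglongrightarrow> ?D"
    unfolding D_def x_def by (rule laplace_denominator_limit[OF w])
  have ED: "\<forall>\<^sub>F n in sequentially. E n * D n = 1"
    using E(2) eventually_compose_filterlim[OF eventually_p_pos w(1)]
  proof eventually_elim
    case (elim n)
    then have "D n = (p (w n) * x n ^ w n + (1 - x n) * (\<Sum>r<w n. p r * x n ^ r)) / p (w n)"
      by (simp add: D_def add_divide_distrib)
    then show ?case using elim by simp
  qed
  have "norm ?D \<ge> 1"
  proof (rule tendsto_lowerbound[OF tendsto_norm[OF D]])
    show "\<forall>\<^sub>F n in sequentially. 1 \<le> norm (D n)"
      using ED
    proof eventually_elim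
      case (elim n)
      have "1 = norm (E n) * norm (D n)" using elim by (simp add: norm_mult[symmetric])
      also have "\<dots> \<le> 1 * norm (D n)" using E(1) by (intro mult_right_mono) auto
      finally show ?case by simp
    qed
  qed simp
  then have nz: "?D \<noteq> 0" by auto
  then show "avalanche_denominator (z * of_real \<epsilon>) \<noteq> 0" by (simp add: avalanche_denominator_def)
  have "(\<lambda>n. 1 / D n) \<longlonglongrightarrow> 1 / ?D" by (intro tendsto_divide tendsto_const D nz)
  moreover have "\<forall>\<^sub>F n in sequentially. 1 / D n = E n"
    using ED
  proof eventually_elim
    case (elim n)
    then have "D n \<noteq> 0" by auto
    with elim show ?case by (simp add: divide_eq_eq)
  qed
  ultimately show "E \<longlonglongrightarrow> avalanche_laplace (z * of_real \<epsilon>)"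
    unfolding avalanche_laplace_def avalanche_denominator_def by (rule Lim_transform_eventually)
qed

end

subsection \<open>The probability of staying below the starting point\<close>

text \<open>The Taylor coefficients of (1 - x)^(-1/2), that is (2n choose n) / 4^n.\<close>

definition central_ratio :: "nat \<Rightarrow> real" where
  "central_ratio n = (- 1) ^ n * ((- 1 / 2) gchoose n)"

lemma central_ratio_0 [simp]: "central_ratio 0 = 1"
  by (simp add: central_ratio_def)

text \<open>The square of (1 - x)^(-1/2) is 1 / (1 - x); in coefficients, Vandermonde with both
  upper indices equal to -1/2.\<close>

lemma sum_central_ratio: "(\<Sum>k\<le>n. central_ratio k * central_ratio (n - k)) = 1"
proof -
  have "(\<Sum>k\<le>n. central_ratio k * central_ratio (n - k)) =
      (\<Sum>k\<le>n. (- 1) ^ n * (((- 1 / 2) gchoose k) * ((- 1 / 2) gchoose (n - k))))"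
  proof (intro sum.cong refl)
    fix k assume "k \<in> {..n}"
    then have "(- 1 :: real) ^ n = (- 1) ^ k * (- 1) ^ (n - k)"
      by (simp add: power_add[symmetric])
    then show "central_ratio k * central_ratio (n - k) =
        (- 1) ^ n * (((- 1 / 2) gchoose k) * ((- 1 / 2) gchoose (n - k)))"
      by (simp add: central_ratio_def mult_ac)
  qed
  also have "\<dots> = (- 1) ^ n * ((- 1 / 2 + - 1 / 2) gchoose n)"
    by (simp add: sum_distrib_left[symmetric] gbinomial_Vandermonde atMost_atLeast0)
  also have "(- 1 / 2 + - 1 / 2 :: real) = - 1" by simp
  also have "(- 1 :: real) ^ n * ((- 1) gchoose n) = 1"
    by (simp add: gbinomial_minus binomial_gbinomial[symmetric] power_add[symmetric])
  finally show ?thesis .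
qed

lemma central_ratio_asymptotic:
  "(\<lambda>n. sqrt (real n) * central_ratio n) \<longlonglongrightarrow> inverse (Gamma (1 / 2))"
proof -
  have "(\<lambda>n. ((- 1 / 2 :: real) gchoose n) / ((- 1) ^ n / exp ((- 1 / 2 + 1) * of_real (ln (real n)))))
      \<longlonglongrightarrow> inverse (Gamma (- (- 1 / 2)))"
    by (rule gbinomial_asymptotic)
  moreover have "\<forall>\<^sub>F n in sequentially.
      ((- 1 / 2 :: real) gchoose n) / ((- 1) ^ n / exp ((- 1 / 2 + 1) * of_real (ln (real n)))) =
      sqrt (real n) * central_ratio n"
    using eventually_gt_at_top[of 0]
  proof eventually_elim
    case (elim n)
    have "sqrt (real n) = exp (ln (real n) / 2)"
      using elim by (simp add: powr_half_sqrt[symmetric] powr_def)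
    then show ?case
      by (cases "even n") (simp_all add: central_ratio_def)
  qed
  ultimately show ?thesis by (simp add: Lim_transform_eventually)
qed

lemma fps_square_unique:
  fixes P Q :: "'a::{idom, ring_char_0} fps"
  assumes "P\<^sup>2 = Q\<^sup>2" "fps_nth P 0 = 1" "fps_nth Q 0 = 1"
  shows "P = Q"
proof -
  have "P = Q \<or> P = - Q" using assms(1) by (simp add: power2_eq_iff)
  moreover have "P \<noteq> - Q"
  proof
    assume "P = - Q"
    then have "fps_nth P 0 = fps_nth (- Q) 0" by simp
    then show False using assms by simp
  qed
  ultimately show ?thesis by blast
qed

lemma fps_convolution_square:
  "(\<And>n. (\<Sum>k\<le>n. a k * b (n - k)) = c n) \<Longrightarrow> Abs_fps a * Abs_fps b = Abs_fps c"
  by (intro fps_ext) (simp add: fps_mult_nth atLeast0AtMost)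

context symmetric_walk
begin

lemma inverse_sqrt_decay_stay:
  assumes "(\<lambda>n. sqrt (real n) * stay n) \<longlonglongrightarrow> c" "c > 0"
  shows "inverse_sqrt_decay stay c"
  by standard (use assms in auto)

text \<open>Without returns to 0, weak and strict staying agree almost surely, so
  \<open>sum_stay_below_stay\<close> says that the generating function of \<open>stay\<close>
  squares to 1 / (1 - x). This is Sparre Andersen's universality: the step law has dropped
  out.\<close>

lemma stay_continuous_walk:
  assumes no_return: "\<And>n. n > 0 \<Longrightarrow> AE \<omega> in M. walk \<omega> n \<noteq> 0"
  shows "stay n = central_ratio n"
proof -
  have below: "stay_below n = stay n" for n
    unfolding stay_def stay_below_def
  proof (rule finite_measure_eq_AE)
    have "AE \<omega> in M. \<forall>j\<in>{1..n}. walk \<omega> j \<noteq> 0"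
      using no_return by (intro AE_finite_allI) auto
    then show "AE \<omega> in M. (\<omega> \<in> {\<omega> \<in> space M. \<forall>j\<in>{1..n}. walk \<omega> j < 0}) =
        (\<omega> \<in> {\<omega> \<in> space M. \<forall>j\<in>{1..n}. walk \<omega> j \<le> 0})"
      by eventually_elim (auto simp: less_le)
  qed measurable
  have "Abs_fps stay = Abs_fps central_ratio"
  proof (rule fps_square_unique)
    show "(Abs_fps stay)\<^sup>2 = (Abs_fps central_ratio)\<^sup>2"
      unfolding power2_eq_square
      using fps_convolution_square[OF sum_stay_below_stay] fps_convolution_square[OF sum_central_ratio]
      by (simp add: below)
  qed auto
  then show ?thesis by (metis fps_nth_Abs_fps)
qed

text \<open>Ties occur here, but the lattice links the two generating functions: to stay strictly
  below 0 the walk must first step to -1 and then never exceed -1. With B = 1 + x P / 2 and B P = 1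
  / (1 - x), completing the square gives (1 + x P)^2 = (1 + x) / (1 - x) = (1 + x)^2 / (1 -
  x^2).\<close>

lemma stay_pm1_walk:
  assumes steps: "AE \<omega> in M. \<forall>i. X i \<omega> \<in> {-1, 1}" and half: "prob {\<omega> \<in> space M. X 0 \<omega> = - 1} = 1 / 2"
  shows "stay n = central_ratio ((n + 1) div 2)"
proof -
  have below: "stay_below (Suc k) = stay k / 2" for k
  proof -
    have "stay_below (Suc k) = prob {\<omega> \<in> space M. X 0 \<omega> = - 1 \<and>
        (\<forall>j\<in>{1..k}. psum (\<lambda>i. X (1 + i) \<omega>) j \<le> 0)}"
      unfolding stay_below_def
    proof (rule finite_measure_eq_AE)
      show "AE \<omega> in M. (\<omega> \<in> {\<omega> \<in> space M. \<forall>j\<in>{1..Suc k}. walk \<omega> j < 0}) =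
        (\<omega> \<in> {\<omega> \<in> space M. X 0 \<omega> = - 1 \<and> (\<forall>j\<in>{1..k}. psum (\<lambda>i. X (1 + i) \<omega>) j \<le> 0)})"
        using steps
      proof eventually_elim
        case (elim \<omega>)
        have int: "psum (\<lambda>i. X (1 + i) \<omega>) j \<in> \<int>" for j
        proof (intro Ints_sum)
          fix i show "X (1 + i) \<omega> \<in> \<int>" using spec[OF elim, of "1 + i"] by auto
        qed
        have shift: "walk \<omega> (Suc j) = X 0 \<omega> + psum (\<lambda>i. X (1 + i) \<omega>) j" for j
          using psum_shift[of "\<lambda>i. X i \<omega>" 1 j] by simp
        \<comment> \<open>Integrality: a partial sum below 1 is at most 0.\<close>
        have iff: "walk \<omega> (Suc j) < 0 \<longleftrightarrow> psum (\<lambda>i. X (1 + i) \<omega>) j \<le> 0" if "X 0 \<omega> = - 1" for j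
        proof -
          obtain m where "psum (\<lambda>i. X (1 + i) \<omega>) j = of_int m" using int[of j] by (auto elim: Ints_cases)
          then show ?thesis unfolding shift that by simp linarith
        qed
        have img: "{1..Suc k} = insert (Suc 0) (Suc ` {1..k})"
          by (auto simp: image_Suc_atLeastAtMost)
        have "(\<forall>j\<in>{1..Suc k}. walk \<omega> j < 0) \<longleftrightarrow>
            X 0 \<omega> < 0 \<and> (\<forall>j\<in>{1..k}. walk \<omega> (Suc j) < 0)"
        proof -
          have all: "(\<forall>j\<in>insert (Suc 0) (Suc ` A). Q j) \<longleftrightarrow> Q (Suc 0) \<and> (\<forall>j\<in>A. Q (Suc j))" for Q A
            by blast
          show ?thesis unfolding img all by simp
        qed
        also have "\<dots> \<longleftrightarrow> X 0 \<omega> = - 1 \<and> (\<forall>j\<in>{1..k}. psum (\<lambda>i. X (1 + i) \<omega>) j \<le> 0)"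
          using spec[OF elim, of 0] iff by auto
        finally show ?case by blast
      qed
    qed measurable
    also have "\<dots> = prob {\<omega> \<in> space M. X 0 \<omega> = - 1} * stay k"
      unfolding stay_def
    proof (rule block_indep[where P = "\<lambda>x. x 0 = - 1" and r = k and
          Q = "\<lambda>x. \<forall>j\<in>{1..k}. psum x j \<le> 0"])
      note borel_measurable_PiM_component [measurable]
      show "Measurable.pred (PiM {..<1} (\<lambda>_. borel)) (\<lambda>x. x 0 = (- 1 :: real))"
        "Measurable.pred (PiM {..<k} (\<lambda>_. borel)) (\<lambda>x. \<forall>j\<in>{1..k}. psum x j \<le> 0)"
        by measurable
      show "(\<forall>j\<in>{1..k}. psum (restrict x {..<k}) j \<le> 0) = (\<forall>j\<in>{1..k}. psum x j \<le> 0)" for x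
        by (rule stay_restrict)
    qed simp
    finally show ?thesis by (simp add: half)
  qed
  have below_0: "stay_below 0 = 1" by (simp add: stay_below_def prob_space)
  \<comment> \<open>Coefficients of (1 - x^2)^(-1/2). In the final
    \<open>stay n = v (Suc n) + v n\<close> one summand vanishes by parity, leaving the index
    \<open>(n + 1) div 2\<close>.\<close>
  define v where "v n = (if even n then central_ratio (n div 2) else 0)" for n
  let ?P = "Abs_fps stay" and ?V = "Abs_fps v"
  let ?G = "Abs_fps (\<lambda>_. 1 :: real)" and ?E = "Abs_fps (\<lambda>n. if even n then 1 else 0 :: real)"
  have G: "?G = 1 + fps_X * ?G" by (intro fps_ext) simp
  have E: "(1 + fps_X) * ?E = ?G" by (intro fps_ext) (auto simp: distrib_right)
  have B: "Abs_fps stay_below = 1 + fps_const (1/2) * (fps_X * ?P)"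
  proof (intro fps_ext)
    fix n show "fps_nth (Abs_fps stay_below) n = fps_nth (1 + fps_const (1/2) * (fps_X * ?P)) n"
      using below_0 by (cases n) (simp_all add: below)
  qed
  have BP: "Abs_fps stay_below * ?P = ?G"
    by (rule fps_convolution_square[OF sum_stay_below_stay])
  have "(\<Sum>k\<le>n. v k * v (n - k)) = (if even n then 1 else 0)" for n
  proof (cases "even n")
    case True
    then obtain m where m: "n = 2 * m" by auto
    have "(\<Sum>k\<le>n. v k * v (n - k)) = (\<Sum>k\<in>(*) 2 ` {..m}. v k * v (n - k))"
      by (intro sum.mono_neutral_right) (auto simp: v_def m elim!: evenE)
    also have "\<dots> = (\<Sum>i\<le>m. v (2 * i) * v (n - 2 * i))"
      by (subst sum.reindex) (auto simp: inj_on_def)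
    also have "\<dots> = (\<Sum>i\<le>m. central_ratio i * central_ratio (m - i))"
      by (intro sum.cong) (auto simp: v_def m diff_mult_distrib2[symmetric])
    finally show ?thesis using True by (simp add: sum_central_ratio)
  next
    case False
    then show ?thesis by (auto simp: v_def intro!: sum.neutral)
  qed
  note VV = fps_convolution_square[OF this]
  have "1 + fps_X * ?P = (1 + fps_X) * ?V"
  proof (rule fps_square_unique)

    have "(1 + fps_X * ?P)\<^sup>2 = 1 + fps_const 2 * fps_X * (Abs_fps stay_below * ?P)"
      unfolding B by (simp add: power2_eq_square algebra_simps numeral_fps_const)
    also have "\<dots> = 1 + fps_const 2 * fps_X * ?G" unfolding BP ..
    also have "\<dots> = (1 + fps_X) * ?G"
    proof -
      have "(1 + fps_X) * ?G = ?G + fps_X * ?G" by (simp add: algebra_simps)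
      also have "\<dots> = 1 + fps_X * ?G + fps_X * ?G" using G by simp
      finally show ?thesis by (simp add: numeral_fps_const[symmetric])
    qed
    also have "\<dots> = ((1 + fps_X) * ?V)\<^sup>2"
      unfolding E[symmetric] VV[symmetric] by (simp add: power2_eq_square mult_ac)
    finally show "(1 + fps_X * ?P)\<^sup>2 = ((1 + fps_X) * ?V)\<^sup>2" .
  qed (simp_all add: v_def)
  then have "fps_nth (1 + fps_X * ?P) (Suc n) = fps_nth ((1 + fps_X) * ?V) (Suc n)" by simp
  then have "stay n = v (Suc n) + v n" by (simp add: distrib_right)
  then show ?thesis by (simp add: v_def)
qed

text \<open>The factor \<open>sqrt 2\<close> stems from the index \<open>(n + 1) div 2\<close>,
  which is about n / 2.\<close>

lemma decay_pm1_walk: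
  assumes "AE \<omega> in M. \<forall>i. X i \<omega> \<in> {-1, 1}" "prob {\<omega> \<in> space M. X 0 \<omega> = - 1} = 1 / 2"
  shows "inverse_sqrt_decay stay (sqrt 2 * inverse (Gamma (1 / 2)))"
proof (rule inverse_sqrt_decay_stay)
  have "filterlim (\<lambda>n::nat. (n + 1) div 2) at_top sequentially"
    unfolding filterlim_at_top
  proof
    fix Z :: nat
    show "\<forall>\<^sub>F n in sequentially. Z \<le> (n + 1) div 2"
      using eventually_ge_at_top[of "2 * Z"] by eventually_elim auto
  qed
  then have "(\<lambda>n. sqrt (real ((n + 1) div 2)) * central_ratio ((n + 1) div 2)) \<longlonglongrightarrow> inverse (Gamma (1 / 2))"
    by (rule filterlim_compose[OF central_ratio_asymptotic])
  moreover have "(\<lambda>n. real n / real ((n + 1) div 2)) \<longlonglongrightarrow> 2"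
  proof (rule tendsto_sandwich)
    show "(\<lambda>n. real n / ((real n + 1) / 2)) \<longlonglongrightarrow> 2" by real_asymp
    show "(\<lambda>n. 2 :: real) \<longlonglongrightarrow> 2" by simp
    have b: "real n \<le> 2 * real ((n + 1) div 2)" "2 * real ((n + 1) div 2) \<le> real n + 1" for n
    proof -
      have "n \<le> 2 * ((n + 1) div 2)" "2 * ((n + 1) div 2) \<le> n + 1" by linarith+
      then have "real n \<le> real (2 * ((n + 1) div 2))" "real (2 * ((n + 1) div 2)) \<le> real (n + 1)"
        by (simp_all only: of_nat_le_iff)
      then show "real n \<le> 2 * real ((n + 1) div 2)" "2 * real ((n + 1) div 2) \<le> real n + 1"
        by (simp_all only: of_nat_mult of_nat_add of_nat_numeral of_nat_1)
    qed
    show "\<forall>\<^sub>F n in sequentially. real n / ((real n + 1) / 2) \<le> real n / real ((n + 1) div 2)"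
      using eventually_gt_at_top[of 0]
    proof eventually_elim
      case (elim n)
      then show ?case using b[of n] by (intro divide_left_mono mult_pos_pos) auto
    qed
    show "\<forall>\<^sub>F n in sequentially. real n / real ((n + 1) div 2) \<le> 2"
      using eventually_gt_at_top[of 0]
    proof eventually_elim
      case (elim n)
      then have "real ((n + 1) div 2) > 0" by auto
      then show ?case using b(1)[of n] by (simp add: divide_le_eq)
    qed
  qed
  ultimately have "(\<lambda>n. sqrt (real n / real ((n + 1) div 2)) *
      (sqrt (real ((n + 1) div 2)) * central_ratio ((n + 1) div 2))) \<longlonglongrightarrow>
      sqrt 2 * inverse (Gamma (1 / 2))"
    by (intro tendsto_mult tendsto_real_sqrt)
  moreover have "sqrt (real n / real ((n + 1) div 2)) *
      (sqrt (real ((n + 1) div 2)) * central_ratio ((n + 1) div 2)) = sqrt (real n) * stay n" for n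
    by (cases "n = 0") (auto simp: stay_pm1_walk[OF assms] real_sqrt_divide div_eq_0_iff)
  ultimately show "(\<lambda>n. sqrt (real n) * stay n) \<longlonglongrightarrow> sqrt 2 * inverse (Gamma (1 / 2))" by simp
  show "0 < sqrt 2 * inverse (Gamma (1 / 2))" by (simp add: Gamma_real_pos)
qed

end

subsection \<open>Scaling limits of the stall time\<close>

lemma (in symmetric_walk) integrable_exp_stall:
  fixes z :: complex
  assumes "Re z \<ge> 0"
  shows "integrable M (\<lambda>\<omega>. exp (- (z / of_nat n) * of_real (real (stall w \<omega>))))"
    "norm (expectation (\<lambda>\<omega>. exp (- (z / of_nat n) * of_real (real (stall w \<omega>))))) \<le> 1"
proof -
  have m: "(\<lambda>\<omega>. exp (- (z / of_nat n) * of_real (real (stall w \<omega>)))) \<in> borel_measurable M"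
    by (rule measurable_compose[OF measurable_stall]) simp
  have b: "norm (exp (- (z / of_nat n) * of_real (real (stall w \<omega>)))) \<le> 1" for \<omega>
    using assms by (simp add: norm_exp_eq_Re)
  show int: "integrable M (\<lambda>\<omega>. exp (- (z / of_nat n) * of_real (real (stall w \<omega>))))"
    by (rule integrable_const_bound[where B = 1]) (use b m in auto)
  have "norm (expectation (\<lambda>\<omega>. exp (- (z / of_nat n) * of_real (real (stall w \<omega>))))) \<le>
      expectation (\<lambda>\<omega>. norm (exp (- (z / of_nat n) * of_real (real (stall w \<omega>)))))"
    by (rule integral_norm_bound)
  also have "\<dots> \<le> expectation (\<lambda>_. 1)"
    by (intro integral_mono integrable_norm int b) auto
  finally show "norm (expectation (\<lambda>\<omega>. exp (- (z / of_nat n) * of_real (real (stall w \<omega>))))) \<le> 1"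
    by (simp add: prob_space)
qed

text \<open>The walk may change with \<open>n\<close> while \<open>p\<close> stays fixed: the simple
  walk uses a constant sequence, Brownian motion the grids of mesh 1 / n. Both go through the same
  limit.\<close>

lemma stall_laplace_limit:
  fixes z :: complex and X :: "nat \<Rightarrow> nat \<Rightarrow> 'a \<Rightarrow> real"
  assumes walk: "\<And>n. n > 0 \<Longrightarrow> symmetric_walk M (X n)"
    and stay: "\<And>n k. n > 0 \<Longrightarrow> symmetric_walk.stay M (X n) k = p k"
    and decay: "inverse_sqrt_decay p c"
    and w: "filterlim w at_top sequentially" "(\<lambda>n. real (w n) / real n) \<longlonglongrightarrow> \<epsilon>"
    and z: "Re z \<ge> 0"
  shows "(\<lambda>n. prob_space.expectation M (\<lambda>\<omega>. exp (- (z / of_nat n) *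
      of_real (real (symmetric_walk.stall (X n) (w n) \<omega>))))) \<longlonglongrightarrow> avalanche_laplace (z * of_real \<epsilon>)"
    and "avalanche_denominator (z * of_real \<epsilon>) \<noteq> 0"
proof -
  interpret inverse_sqrt_decay p c by fact
  let ?E = "\<lambda>n. prob_space.expectation M (\<lambda>\<omega>. exp (- (z / of_nat n) *
      of_real (real (symmetric_walk.stall (X n) (w n) \<omega>))))"
  let ?x = "\<lambda>n. exp (- (z / of_nat n)) :: complex"
  \<comment> \<open>For \<open>n = 0\<close> nothing is known about \<open>X n\<close>, whereas
    \<open>laplace_limit\<close> wants the bound for all \<open>n\<close>; the value is overwritten
    by 0.\<close>
  have le1: "norm (if n = 0 then 0 else ?E n) \<le> 1" for n
  proof (cases "n = 0")
    case False
    then interpret symmetric_walk M "X n" by (intro walk) simp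
    show ?thesis using False integrable_exp_stall(2)[OF z, of n "w n"] by simp
  qed simp
  have eq: "\<forall>\<^sub>F n in sequentially. (if n = 0 then 0 else ?E n) *
      (p (w n) * ?x n ^ w n + (1 - ?x n) * (\<Sum>r<w n. p r * ?x n ^ r)) = p (w n)"
    using eventually_gt_at_top[of 0] eventually_compose_filterlim[OF eventually_p_pos w(1)]
  proof eventually_elim
    case (elim n)
    interpret symmetric_walk M "X n" using elim by (intro walk) simp
    have s: "stay k = p k" for k using elim by (intro stay) simp
    have "norm (?x n) \<le> 1" using z by (simp add: norm_exp_eq_Re)
    then have "expectation (\<lambda>\<omega>. ?x n ^ stall (w n) \<omega>) *
        (p (w n) * ?x n ^ w n + (1 - ?x n) * (\<Sum>r<w n. p r * ?x n ^ r)) = p (w n)"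
      using expectation_power_stall[of "w n" "?x n"] elim unfolding s by simp
    moreover have "?x n ^ stall (w n) \<omega> = exp (- (z / of_nat n) * of_real (real (stall (w n) \<omega>)))" for \<omega>
      by (simp add: exp_of_nat_mult[symmetric] mult.commute)
    ultimately show ?case using elim by simp
  qed
  note lim = laplace_limit[OF w le1 eq]
  show "avalanche_denominator (z * of_real \<epsilon>) \<noteq> 0" by (rule lim(2))
  note lim(1)
  moreover have "\<forall>\<^sub>F n in sequentially. (if n = 0 then 0 else ?E n) = ?E n"
    using eventually_gt_at_top[of 0] by eventually_elim simp
  ultimately show "?E \<longlonglongrightarrow> avalanche_laplace (z * of_real \<epsilon>)"
    by (rule Lim_transform_eventually)
qed

text \<open>The limits in \<open>moment_limit\<close> for j = 0 and j = 1 are 2 and 2/3. Hence m1 is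
  about 2 w - w = w and m2 about 2 (2/3) w^2 - w^2 = w^2 / 3, the remaining sum in m2 being of lower
  order. The variance is m1^2 + m2, which gives the factor 4/3.\<close>

lemma (in symmetric_walk) stall_moment_limits:
  assumes decay: "inverse_sqrt_decay stay c"
    and w: "filterlim w at_top sequentially" "(\<lambda>n. real (w n) / real n) \<longlonglongrightarrow> \<epsilon>"
  shows "(\<lambda>n. expectation (\<lambda>\<omega>. real (stall (w n) \<omega>) / real n)) \<longlonglongrightarrow> \<epsilon>"
    "(\<lambda>n. variance (\<lambda>\<omega>. real (stall (w n) \<omega>) / real n)) \<longlonglongrightarrow> 4 / 3 * \<epsilon>\<^sup>2"
proof -
  interpret inverse_sqrt_decay stay c by fact
  define m1 where "m1 v = (\<Sum>r<v. stay r) / stay v - real v" for v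
  define m2 where "m2 v = (\<Sum>r<v. stay r * (2 * real r + 1)) / stay v - real v ^ 2" for v
  have ev: "\<forall>\<^sub>F n in sequentially. n > 0 \<and> w n > 0 \<and> stay (w n) > 0"
    using eventually_gt_at_top[of 0] eventually_compose_filterlim[OF eventually_p_pos w(1)]
      eventually_compose_filterlim[OF eventually_gt_at_top[of 0] w(1)]
    by eventually_elim simp
  have T: "(\<lambda>n. (\<Sum>r<w n. stay r * real r ^ j) / (real (w n) ^ Suc j * stay (w n)))
      \<longlonglongrightarrow> inverse (real j + 1 / 2)" for j
    by (rule filterlim_compose[OF moment_limit w(1)])
  have T0: "(\<lambda>n. (\<Sum>r<w n. stay r) / (real (w n) * stay (w n))) \<longlonglongrightarrow> 2"
    using T[of 0] by simp
  have T1: "(\<lambda>n. (\<Sum>r<w n. stay r * real r) / (real (w n) ^ 2 * stay (w n))) \<longlonglongrightarrow> 2 / 3"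
    using T[of 1] by (simp add: power2_eq_square)
  have inv: "(\<lambda>n. 1 / real (w n)) \<longlonglongrightarrow> 0"
    by (rule filterlim_compose[OF lim_1_over_n w(1)])
  have "(\<lambda>n. real (w n) / real n * ((\<Sum>r<w n. stay r) / (real (w n) * stay (w n)) - 1)) \<longlonglongrightarrow> \<epsilon> * (2 - 1)"
    by (intro tendsto_intros w T0)
  moreover have "\<forall>\<^sub>F n in sequentially.
      real (w n) / real n * ((\<Sum>r<w n. stay r) / (real (w n) * stay (w n)) - 1) = m1 (w n) / real n"
    using ev by eventually_elim (simp add: m1_def field_simps)
  ultimately have m1: "(\<lambda>n. m1 (w n) / real n) \<longlonglongrightarrow> \<epsilon>"
    by (simp add: Lim_transform_eventually)
  have "(\<lambda>n. (real (w n) / real n) ^ 2 * (2 * ((\<Sum>r<w n. stay r * real r) / (real (w n) ^ 2 * stay (w n))) +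
      (\<Sum>r<w n. stay r) / (real (w n) * stay (w n)) * (1 / real (w n)) - 1)) \<longlonglongrightarrow>
      \<epsilon> ^ 2 * (2 * (2 / 3) + 2 * 0 - 1)"
    by (intro tendsto_intros w T0 T1 inv)
  moreover have "\<forall>\<^sub>F n in sequentially.
      (real (w n) / real n) ^ 2 * (2 * ((\<Sum>r<w n. stay r * real r) / (real (w n) ^ 2 * stay (w n))) +
      (\<Sum>r<w n. stay r) / (real (w n) * stay (w n)) * (1 / real (w n)) - 1) = m2 (w n) / real n ^ 2"
    using ev
  proof eventually_elim
    case (elim n)
    have "(\<Sum>r<w n. stay r * (2 * real r + 1)) = 2 * (\<Sum>r<w n. stay r * real r) + (\<Sum>r<w n. stay r)"
      by (simp add: distrib_left sum.distrib sum_distrib_left mult_ac)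
    with elim show ?case by (simp add: m2_def field_simps power2_eq_square)
  qed
  ultimately have m2: "(\<lambda>n. m2 (w n) / real n ^ 2) \<longlonglongrightarrow> \<epsilon> ^ 2 * (2 * (2 / 3) + 2 * 0 - 1)"
    by (rule Lim_transform_eventually)
  show "(\<lambda>n. expectation (\<lambda>\<omega>. real (stall (w n) \<omega>) / real n)) \<longlonglongrightarrow> \<epsilon>"
  proof (rule Lim_transform_eventually[OF m1])
    show "\<forall>\<^sub>F n in sequentially. m1 (w n) / real n = expectation (\<lambda>\<omega>. real (stall (w n) \<omega>) / real n)"
      using ev by eventually_elim (simp add: moments_stall m1_def)
  qed
  have "(\<lambda>n. (m1 (w n) / real n) ^ 2 + m2 (w n) / real n ^ 2) \<longlonglongrightarrow> \<epsilon> ^ 2 + \<epsilon> ^ 2 * (2 * (2 / 3) + 2 * 0 - 1)"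
    by (intro tendsto_intros m1 m2)
  also have "\<epsilon> ^ 2 + \<epsilon> ^ 2 * (2 * (2 / 3) + 2 * 0 - 1) = 4 / 3 * \<epsilon>\<^sup>2" by simp
  finally show "(\<lambda>n. variance (\<lambda>\<omega>. real (stall (w n) \<omega>) / real n)) \<longlonglongrightarrow> 4 / 3 * \<epsilon>\<^sup>2"
  proof (rule Lim_transform_eventually)
    show "\<forall>\<^sub>F n in sequentially. (m1 (w n) / real n) ^ 2 + m2 (w n) / real n ^ 2 =
        variance (\<lambda>\<omega>. real (stall (w n) \<omega>) / real n)"
      using ev
    proof eventually_elim
      case (elim n)
      have "variance (\<lambda>\<omega>. real (stall (w n) \<omega>) / real n) =
          expectation (\<lambda>\<omega>. (real (stall (w n) \<omega>) / real n) ^ 2) -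
          (expectation (\<lambda>\<omega>. real (stall (w n) \<omega>) / real n)) ^ 2"
        using elim by (intro variance_eq) (auto simp: power_divide moments_stall)
      also have "\<dots> = (2 * m1 (w n) ^ 2 + m2 (w n)) / real n ^ 2 - (m1 (w n) / real n) ^ 2"
        using elim by (simp add: power_divide moments_stall m1_def[symmetric] m2_def[symmetric])
      finally show ?case by (simp add: power_divide add_divide_distrib)
    qed
  qed
qed

lemma floor_window:
  assumes "\<epsilon> > 0"
  shows "filterlim (\<lambda>n. nat \<lfloor>real n * \<epsilon>\<rfloor>) at_top sequentially"
    "(\<lambda>n. real (nat \<lfloor>real n * \<epsilon>\<rfloor>) / real n) \<longlonglongrightarrow> \<epsilon>"
  using assms by real_asymp+

section \<open>The simple random walk as a symmetric walk with real steps\<close>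

context simple_symmetric_random_walk
begin

definition step :: "nat \<Rightarrow> 'a \<Rightarrow> real" where
  "step n \<omega> = real_of_int (S (Suc n) \<omega> - S n \<omega>)"

lemma psum_step: "\<omega> \<in> space M \<Longrightarrow> psum (\<lambda>i. step i \<omega>) n = real_of_int (S n \<omega>)"
  by (induction n) (auto simp: step_def start)

lemma measurable_increment: "(\<lambda>\<omega>. S (Suc n) \<omega> - S n \<omega>) \<in> measurable M (count_space UNIV)"
  using indep_steps by (simp add: indep_vars_def)

lemma distr_step: "distr M borel (step n) = distr (measure_pmf (pmf_of_set {-1, 1})) borel real_of_int"
proof -
  have "distr M borel (step n) = distr (distr M (count_space UNIV) (\<lambda>\<omega>. S (Suc n) \<omega> - S n \<omega>)) borel real_of_int"
    by (subst distr_distr) (auto simp: step_def[abs_def] comp_def measurable_increment)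
  then show ?thesis by (simp only: distr_steps)
qed

sublocale symmetric_walk M step
proof
  show "indep_vars (\<lambda>_. borel) step UNIV"
    unfolding step_def[abs_def] by (rule indep_vars_compose2[OF indep_steps]) simp
  show "distr M borel (step n) = distr M borel (step 0)" for n
    by (simp only: distr_step)
  have [measurable]: "step 0 \<in> borel_measurable M"
    unfolding step_def[abs_def] by (rule measurable_compose[OF measurable_increment]) simp
  have "distr M borel (\<lambda>\<omega>. - step 0 \<omega>) = distr (distr M borel (step 0)) borel uminus"
    by (subst distr_distr) (auto simp: comp_def)
  also have "\<dots> = distr (measure_pmf (pmf_of_set {-1, 1 :: int})) borel (\<lambda>x. real_of_int (- x))"
    unfolding distr_step by (subst distr_distr) (auto simp: comp_def)
  also have "\<dots> = distr (map_pmf uminus (pmf_of_set {-1, 1})) borel real_of_int"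
    unfolding map_pmf_rep_eq by (subst distr_distr) (auto simp: comp_def)
  also have "map_pmf uminus (pmf_of_set {-1, 1 :: int}) = pmf_of_set {-1, 1}"
    by (subst map_pmf_of_set_inj) (auto simp: insert_commute)
  finally show "distr M borel (\<lambda>\<omega>. - step 0 \<omega>) = distr M borel (step 0)"
    by (simp only: distr_step)
qed

lemma stall_eq_avalanche_length:
  assumes "\<omega> \<in> space M"
  shows "stall w \<omega> = avalanche_length w (\<lambda>k. S k \<omega>)"
proof -
  have "strict_mono real_of_int" by (simp add: strict_mono_def)
  then show ?thesis
    using assms stall_time_strict_mono[of real_of_int w "\<lambda>k. S k \<omega>"]
    by (simp add: stall_def psum_step avalanche_length_eq_stall_time)
qed

lemma inverse_sqrt_decay_stay_step: "inverse_sqrt_decay stay (sqrt 2 * inverse (Gamma (1 / 2)))"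
proof (rule decay_pm1_walk)
  have "AE \<omega> in M. step n \<omega> \<in> {-1, 1}" for n
  proof -
    have "AE x in distr M (count_space UNIV) (\<lambda>\<omega>. S (Suc n) \<omega> - S n \<omega>). x \<in> {-1, 1}"
      unfolding distr_steps by (simp add: AE_measure_pmf_iff)
    then have "AE \<omega> in M. S (Suc n) \<omega> - S n \<omega> \<in> {-1, 1}"
      by (subst (asm) AE_distr_iff) (auto simp: measurable_increment)
    then show ?thesis by eventually_elim (auto simp: step_def)
  qed
  then show "AE \<omega> in M. \<forall>i. step i \<omega> \<in> {-1, 1}" by (simp add: AE_all_countable)
  have "prob {\<omega> \<in> space M. step 0 \<omega> = - 1} =
      measure (distr M (count_space UNIV) (\<lambda>\<omega>. S (Suc 0) \<omega> - S 0 \<omega>)) {-1}"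
    by (subst measure_distr[OF measurable_increment])
       (auto simp: step_def intro!: arg_cong[where f = prob])
  also have "\<dots> = 1 / 2"
    unfolding distr_steps by (simp add: measure_pmf_single)
  finally show "prob {\<omega> \<in> space M. step 0 \<omega> = - 1} = 1 / 2" .
qed

end

subsection \<open>Running maxima of continuous paths\<close>

definition stop_set :: "real \<Rightarrow> (real \<Rightarrow> real) \<Rightarrow> real set" where
  "stop_set \<epsilon> f = {t. t \<ge> 0 \<and> running_max f (t + \<epsilon>) = running_max f t}"

lemma path_avalanche_length_eq: "path_avalanche_length \<epsilon> f = Inf (stop_set \<epsilon> f)"
  by (simp add: path_avalanche_length_def stop_set_def)

lemma stop_set_bdd_below [simp]: "bdd_below (stop_set \<epsilon> f)"
  by (rule bdd_belowI[of _ 0]) (simp add: stop_set_def)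

text \<open>Maxima over finitely many times serve twice: they are measurable, and they are functions
  of finitely many increments.\<close>

definition grid_max :: "(real \<Rightarrow> real) \<Rightarrow> real \<Rightarrow> real \<Rightarrow> nat \<Rightarrow> real" where
  "grid_max f a b n = Max ((\<lambda>i. f (a + (b - a) * (real i / real n))) ` {..n})"

lemma grid_max_tendsto_Sup:
  fixes f :: "real \<Rightarrow> real"
  assumes "continuous_on {a..b} f" "a \<le> b"
  shows "grid_max f a b \<longlonglongrightarrow> (SUP s\<in>{a..b}. f s)"
proof -
  obtain u where u: "u \<in> {a..b}" "\<And>s. s \<in> {a..b} \<Longrightarrow> f s \<le> f u"
    using continuous_attains_sup[of "{a..b}" f] assms by auto
  have sup: "(SUP s\<in>{a..b}. f s) = f u"
    using u by (intro cSup_eq_maximum) auto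
  \<comment> \<open>The grid point just to the left of a maximiser \<open>u\<close>; if
    \<open>a = b\<close> the quotient is 0 by convention and \<open>v\<close> is constant.\<close>
  define v where "v n = a + (b - a) * (real (nat \<lfloor>(u - a) / (b - a) * real n\<rfloor>) / real n)" for n
  have idx: "nat \<lfloor>(u - a) / (b - a) * real n\<rfloor> \<le> n" for n
  proof -
    have "(u - a) / (b - a) \<le> 1" using u(1) by (auto simp: divide_le_eq_1)
    then have "(u - a) / (b - a) * real n \<le> 1 * real n" by (rule mult_right_mono) simp
    then show ?thesis by linarith
  qed
  have grid: "a + (b - a) * (real i / real n) \<in> {a..b}" if "i \<le> n" for i n
  proof -
    have "real i / real n \<le> 1" using that by (cases "n = 0") auto
    then show ?thesis using assms mult_left_mono[of "real i / real n" 1 "b - a"] by simp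
  qed
  have "v \<longlonglongrightarrow> u"
  proof (cases "a = b")
    case False
    have "(\<lambda>n. real (nat \<lfloor>(u - a) / (b - a) * real n\<rfloor>) / real n) \<longlonglongrightarrow> (u - a) / (b - a)"
    proof (cases "u = a")
      case False
      then have "(u - a) / (b - a) > 0" using u(1) \<open>a \<noteq> b\<close> assms by simp
      then show ?thesis by real_asymp
    qed simp
    then have "v \<longlonglongrightarrow> a + (b - a) * ((u - a) / (b - a))"
      unfolding v_def by (intro tendsto_add tendsto_mult tendsto_const)
    with False show ?thesis by simp
  qed (use u in \<open>simp add: v_def[abs_def]\<close>)
  moreover have "v n \<in> {a..b}" for n unfolding v_def by (rule grid[OF idx])
  ultimately have "(\<lambda>n. f (v n)) \<longlonglongrightarrow> f u"
    by (intro continuous_on_tendsto_compose[OF assms(1) _ u(1)] always_eventually allI)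
  then show ?thesis unfolding sup
  proof (rule tendsto_sandwich[rotated 2, OF _ tendsto_const])
    show "\<forall>\<^sub>F n in sequentially. f (v n) \<le> grid_max f a b n"
      using idx unfolding grid_max_def by (intro always_eventually allI Max_ge) (auto simp: v_def)
    show "\<forall>\<^sub>F n in sequentially. grid_max f a b n \<le> f u"
      using u grid unfolding grid_max_def by (intro always_eventually allI Max.boundedI) auto
  qed
qed

locale continuous_path =
  fixes f :: "real \<Rightarrow> real"
  assumes cont: "continuous_on {0..} f"
begin

lemma cont_interval: "0 \<le> a \<Longrightarrow> continuous_on {a..b} f"
  by (rule continuous_on_subset[OF cont]) auto

lemma running_max_attained:
  assumes "t \<ge> 0"
  obtains u where "u \<in> {0..t}" "running_max f t = f u" "\<And>s. s \<in> {0..t} \<Longrightarrow> f s \<le> running_max f t"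
proof -
  obtain u where u: "u \<in> {0..t}" "\<And>s. s \<in> {0..t} \<Longrightarrow> f s \<le> f u"
    using continuous_attains_sup[of "{0..t}" f] assms cont_interval[of 0 t] by auto
  then have "running_max f t = f u"
    unfolding running_max_def by (intro cSup_eq_maximum) auto
  with u that show ?thesis by auto
qed

lemma running_max_ge: "0 \<le> s \<Longrightarrow> s \<le> t \<Longrightarrow> f s \<le> running_max f t"
  by (rule running_max_attained[of t]) auto

lemma running_max_le: "0 \<le> t \<Longrightarrow> (\<And>s. 0 \<le> s \<Longrightarrow> s \<le> t \<Longrightarrow> f s \<le> c) \<Longrightarrow> running_max f t \<le> c"
  by (rule running_max_attained[of t]) auto

lemma running_max_mono: "0 \<le> s \<Longrightarrow> s \<le> t \<Longrightarrow> running_max f s \<le> running_max f t"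
  by (rule running_max_le) (auto intro: running_max_ge)

lemma continuous_on_running_max: "continuous_on {0..} (running_max f)"
proof -
  have "\<exists>d>0. \<forall>y\<in>{0..}. dist y x < d \<longrightarrow> dist (running_max f y) (running_max f x) \<le> e"
    if "x \<in> {0..}" "e > 0" for x e
  proof -
    have "uniformly_continuous_on {0..x+1} f"
      by (intro compact_uniformly_continuous cont_interval) auto
    then obtain d where d: "d > 0"
      "\<And>u v. u \<in> {0..x+1} \<Longrightarrow> v \<in> {0..x+1} \<Longrightarrow> dist v u < d \<Longrightarrow> dist (f v) (f u) < e"
      using \<open>e > 0\<close> unfolding uniformly_continuous_on_def by metis
    have incr: "running_max f b \<le> running_max f a + e" if "0 \<le> a" "a \<le> b" "b \<le> x + 1" "b - a < d" for a b
    proof (rule running_max_le)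
      fix s assume s: "0 \<le> s" "s \<le> b"
      show "f s \<le> running_max f a + e"
      proof (cases "s \<le> a")
        case True
        then show ?thesis using running_max_ge[of s a] s \<open>e > 0\<close> by simp
      next
        case False
        then have "dist (f s) (f a) < e" using that s by (intro d) (auto simp: dist_real_def)
        then show ?thesis using running_max_ge[of a a] that by (simp add: dist_real_def)
      qed
    qed (use that in simp)
    show ?thesis
    proof (intro exI[of _ "min d 1"] conjI ballI impI)
      fix y assume y: "y \<in> {0..}" "dist y x < min d 1"
      show "dist (running_max f y) (running_max f x) \<le> e"
      proof (cases "x \<le> y")
        case True
        then show ?thesis using incr[of x y] running_max_mono[of x y] y that by (auto simp: dist_real_def)
      next
        case False
        then show ?thesis using incr[of y x] running_max_mono[of y x] y that by (auto simp: dist_real_def)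
      qed
    qed (use d in simp)
  qed
  note * = this
  show ?thesis
    unfolding continuous_on_iff
  proof (intro ballI allI impI)
    fix x e :: real assume "x \<in> {0..}" "0 < e"
    with *[of x "e / 2"] obtain d where "d > 0"
      "\<forall>y\<in>{0..}. dist y x < d \<longrightarrow> dist (running_max f y) (running_max f x) \<le> e / 2" by auto
    with \<open>0 < e\<close> show "\<exists>d>0. \<forall>y\<in>{0..}. dist y x < d \<longrightarrow> dist (running_max f y) (running_max f x) < e"
      by (intro exI[of _ d]) fastforce
  qed
qed

lemma continuous_on_max_increment:
  assumes "\<epsilon> > 0"
  shows "continuous_on {0..} (\<lambda>t. running_max f (t + \<epsilon>) - running_max f t)"
  using assms
  by (intro continuous_intros continuous_on_compose2[OF continuous_on_running_max]) auto

lemma closed_stop_set: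
  assumes "\<epsilon> > 0"
  shows "closed (stop_set \<epsilon> f)"
proof -
  have "stop_set \<epsilon> f = {0..} \<inter> (\<lambda>t. running_max f (t + \<epsilon>) - running_max f t) -` {0}"
    by (auto simp: stop_set_def)
  then show ?thesis
    using continuous_closed_preimage[OF continuous_on_max_increment[OF assms]] by auto
qed

lemma path_avalanche_length_in_stop_set:
  assumes "\<epsilon> > 0" "stop_set \<epsilon> f \<noteq> {}"
  shows "path_avalanche_length \<epsilon> f \<in> stop_set \<epsilon> f"
  unfolding path_avalanche_length_eq using assms by (intro closed_contains_Inf closed_stop_set) auto

lemma path_avalanche_length_le:
  "t \<in> stop_set \<epsilon> f \<Longrightarrow> path_avalanche_length \<epsilon> f \<le> t"
  unfolding path_avalanche_length_eq by (intro cInf_lower) auto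

text \<open>Turns an uncountable quantifier into countable ones, for measurability. The increment of
  the running maximum is continuous and nonnegative on a compact interval, so it vanishes somewhere
  iff it takes arbitrarily small values on a dense set. Rational multiples \<open>r * t\<close> are
  dense in {0..t} for every real \<open>t\<close>.\<close>

lemma stop_before_iff:
  assumes "\<epsilon> > 0" "t \<ge> 0"
  shows "(\<exists>s\<in>stop_set \<epsilon> f. s \<le> t) \<longleftrightarrow>
    (\<forall>n::nat. \<exists>r\<in>\<rat> \<inter> {0..1}. running_max f (r * t + \<epsilon>) - running_max f (r * t) < 1 / real (Suc n))"
proof -
  let ?D = "\<lambda>s. running_max f (s + \<epsilon>) - running_max f s"
  have cD: "continuous_on {0..1} (\<lambda>r. ?D (r * t))"
    using assms
    by (intro continuous_on_compose2[OF continuous_on_max_increment[OF assms(1)], of _ "\<lambda>r. r * t"])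
       (auto intro!: continuous_intros)
  have Dnn: "?D s \<ge> 0" if "s \<ge> 0" for s using running_max_mono[of s "s + \<epsilon>"] that assms by simp
  show ?thesis
  proof
    assume "\<exists>s\<in>stop_set \<epsilon> f. s \<le> t"
    then obtain s where s: "s \<ge> 0" "s \<le> t" "?D s = 0" by (auto simp: stop_set_def)
    obtain x where x: "x \<in> {0..1}" "?D (x * t) = 0"
    proof (cases "t = 0")
      case True
      then show ?thesis using s that[of 0] by simp
    next
      case False
      then show ?thesis using s assms that[of "s / t"] by (simp add: divide_le_eq)
    qed
    show "\<forall>n::nat. \<exists>r\<in>\<rat> \<inter> {0..1}. ?D (r * t) < 1 / real (Suc n)"
    proof
      fix n :: nat
      obtain d where d: "d > 0"
        "\<And>y. y \<in> {0..1} \<Longrightarrow> dist y x < d \<Longrightarrow> dist (?D (y * t)) (?D (x * t)) < 1 / real (Suc n)"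
        using cD[unfolded continuous_on_iff, rule_format, OF x(1), of "1 / real (Suc n)"] by auto
      have "max 0 (x - d) < min 1 (x + d)" using x d by auto
      then obtain r where r: "r \<in> \<rat>" "max 0 (x - d) < r" "r < min 1 (x + d)"
        using Rats_dense_in_real by blast
      then have "dist (?D (r * t)) (?D (x * t)) < 1 / real (Suc n)"
        by (intro d) (auto simp: dist_real_def)
      then show "\<exists>r\<in>\<rat> \<inter> {0..1}. ?D (r * t) < 1 / real (Suc n)"
        using r x by (intro bexI[of _ r]) (auto simp: dist_real_def)
    qed
  next
    assume *: "\<forall>n::nat. \<exists>r\<in>\<rat> \<inter> {0..1}. ?D (r * t) < 1 / real (Suc n)"
    obtain x where x: "x \<in> {0..1}" "\<And>y. y \<in> {0..1} \<Longrightarrow> ?D (x * t) \<le> ?D (y * t)"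
      using continuous_attains_inf[OF _ _ cD] by auto
    have "?D (x * t) \<le> 0"
    proof (rule ccontr)
      assume "\<not> ?D (x * t) \<le> 0"
      then obtain n where n: "inverse (real (Suc n)) < ?D (x * t)"
        using reals_Archimedean[of "?D (x * t)"] by auto
      obtain r where "r \<in> \<rat> \<inter> {0..1}" "?D (r * t) < 1 / real (Suc n)" using * by blast
      then show False using x(2)[of r] n by (auto simp: inverse_eq_divide)
    qed
    then have "x * t \<in> stop_set \<epsilon> f"
      using Dnn[of "x * t"] x assms by (auto simp: stop_set_def)
    moreover have "x * t \<le> t" using x(1) assms by (simp add: mult_left_le_one_le)
    ultimately show "\<exists>s\<in>stop_set \<epsilon> f. s \<le> t" by blast
  qed
qed

text \<open>On {0..t} the increment of the running maximum has a positive minimum \<delta>. A grid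
  stall at a time up to \<open>t\<close> would bound the increment there by the oscillation of
  \<open>f\<close> over one mesh, which is below \<delta> for fine grids.\<close>

lemma eventually_stalls_late:
  assumes "\<epsilon> > 0" "t \<ge> 0" and no: "\<And>s. s \<in> stop_set \<epsilon> f \<Longrightarrow> s > t"
  shows "\<forall>\<^sub>F m in sequentially. \<forall>k. stalls (nat \<lfloor>real m * \<epsilon>\<rfloor>) (\<lambda>k. f (real k / real m)) k \<longrightarrow> real k / real m > t"
proof -
  let ?D = "\<lambda>s. running_max f (s + \<epsilon>) - running_max f s"
  have cD: "continuous_on {0..t} ?D"
    by (rule continuous_on_subset[OF continuous_on_max_increment[OF assms(1)]]) auto
  then obtain x where x: "x \<in> {0..t}" "\<And>y. y \<in> {0..t} \<Longrightarrow> ?D x \<le> ?D y"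
    using continuous_attains_inf[OF _ _ cD] assms by auto
  define \<delta> where "\<delta> = ?D x"
  have "?D x \<noteq> 0" using no[of x] x(1) by (auto simp: stop_set_def)
  then have \<delta>: "\<delta> > 0"
    using running_max_mono[of x "x + \<epsilon>"] x(1) assms by (auto simp: \<delta>_def)
  have "uniformly_continuous_on {0..t+\<epsilon>} f"
    by (intro compact_uniformly_continuous cont_interval) auto
  then obtain d where d: "d > 0"
    "\<And>u v. u \<in> {0..t+\<epsilon>} \<Longrightarrow> v \<in> {0..t+\<epsilon>} \<Longrightarrow> dist v u < d \<Longrightarrow> dist (f v) (f u) < \<delta>"
    using \<delta> unfolding uniformly_continuous_on_def by metis
  obtain m0 :: nat where m0: "1 / d < real m0" using reals_Archimedean2 by blast
  have "real k / real m > t"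
    if m: "m \<ge> max 1 m0" and k: "stalls (nat \<lfloor>real m * \<epsilon>\<rfloor>) (\<lambda>k. f (real k / real m)) k" for m k
  proof (rule ccontr)
    let ?w = "nat \<lfloor>real m * \<epsilon>\<rfloor>"
    assume "\<not> real k / real m > t"
    then have s: "real k / real m \<le> t" "0 \<le> real k / real m" by auto
    have mpos: "real m > 0" using m by simp
    have md: "1 / real m < d"
    proof -
      have "1 / d < real m" using m m0 by simp
      then show ?thesis using d mpos by (simp add: field_simps)
    qed
    obtain u where u: "u \<in> {0..real k / real m + \<epsilon>}" "running_max f (real k / real m + \<epsilon>) = f u"
      using running_max_attained[OF add_nonneg_nonneg[OF s(2) less_imp_le[OF assms(1)]]] by metis
    \<comment> \<open>The grid time just left of the maximiser \<open>u\<close>, capped at the end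
      of the discrete window. Rounding \<open>real m * \<epsilon>\<close> down costs less than one
      step, so \<open>j / m\<close> is within one mesh of \<open>u\<close> in either case.\<close>
    define j where "j = min (nat \<lfloor>real m * u\<rfloor>) (k + ?w)"
    have fl: "real (nat \<lfloor>real m * u\<rfloor>) \<le> real m * u" "real m * u - 1 < real (nat \<lfloor>real m * u\<rfloor>)"
      using u mpos by auto
    have "real ?w > real m * \<epsilon> - 1" by linarith
    moreover have "real m * u \<le> real k + real m * \<epsilon>"
      using u(1) mpos by (simp add: field_simps)
    ultimately have "real j > real m * u - 1" using fl by (auto simp: j_def min_def)
    then have j1: "u - 1 / real m < real j / real m"
      using mpos by (simp add: less_divide_eq left_diff_distrib right_diff_distrib mult.commute)
    have "real j \<le> real m * u" using fl by (auto simp: j_def min_def)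
    then have j2: "real j / real m \<le> u" using mpos by (simp add: field_simps)
    have "f (real j / real m) \<le> f (real k / real m)"
    proof (cases j k rule: linorder_cases)
      case less
      then show ?thesis using k by (auto simp: stalls_def is_record_def intro: less_imp_le)
    next
      case greater
      then show ?thesis using k by (auto simp: stalls_def j_def)
    qed simp
    also have "\<dots> \<le> running_max f (real k / real m)"
      using s by (intro running_max_ge) auto
    finally have "f (real j / real m) \<le> running_max f (real k / real m)" .
    moreover have "dist (f u) (f (real j / real m)) < \<delta>"
      using u s j1 j2 md by (intro d) (auto simp: dist_real_def)
    ultimately have "?D (real k / real m) < \<delta>" using u(2) by (simp add: dist_real_def)
    moreover have "\<delta> \<le> ?D (real k / real m)" using x(2)[of "real k / real m"] s by (simp add: \<delta>_def)
    ultimately show False by simp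
  qed
  then show ?thesis unfolding eventually_at_top_linorder by blast
qed

text \<open>The first time \<open>t\<close> of the stopping set is in general no grid time, and the
  grid record near it may come slightly after \<open>t\<close>; the smaller window then still fits
  into the interval of length \<epsilon> after \<open>t\<close>. Without ties \<open>f\<close> stays
  strictly below \<open>f t\<close> on the later part of that interval, so the grid maximum cannot
  be found there.\<close>

lemma eventually_stalls_early:
  assumes \<epsilon>: "0 < \<epsilon>'" "\<epsilon>' < \<epsilon>" and ne: "stop_set \<epsilon> f \<noteq> {}" and \<eta>: "\<eta> > 0"
    and ties: "\<And>q q' r. \<lbrakk>q \<in> \<rat>; q' \<in> \<rat>; r \<in> \<rat>; 0 < q; q < q'; q' < r\<rbrakk> \<Longrightarrow>
        running_max f q \<noteq> (SUP s\<in>{q'..r}. f s)"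
  shows "\<forall>\<^sub>F m in sequentially. \<exists>k. stalls (nat \<lfloor>real m * \<epsilon>'\<rfloor>) (\<lambda>k. f (real k / real m)) k \<and>
    real k / real m \<le> path_avalanche_length \<epsilon> f + \<eta>"
proof -
  define t where "t = path_avalanche_length \<epsilon> f"
  \<comment> \<open>\<kappa> bounds the delay of the grid record. The slack
    \<open>\<epsilon> - \<epsilon>'\<close> is halved: one half allows the delay, the other keeps
    \<open>b\<close> below \<open>t + \<epsilon>\<close>, leaving room for a rational
    \<open>r\<close> in between.\<close>
  define \<kappa> where "\<kappa> = min \<eta> ((\<epsilon> - \<epsilon>') / 2)"
  define b where "b = t + \<epsilon> - (\<epsilon> - \<epsilon>') / 2"
  have \<kappa>: "\<kappa> > 0" "\<kappa> \<le> \<eta>" "t + \<kappa> + \<epsilon>' \<le> b" using \<epsilon> \<eta> by (auto simp: \<kappa>_def b_def min_def field_simps)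
  have tZ: "t \<in> stop_set \<epsilon> f"
    unfolding t_def using \<epsilon> ne by (intro path_avalanche_length_in_stop_set) auto
  then have t0: "t \<ge> 0" and tM: "running_max f (t + \<epsilon>) = running_max f t" by (auto simp: stop_set_def)
  \<comment> \<open>A time at which the maximum up to \<open>t\<close> is attained belongs to the
    stopping set itself, hence is not before \<open>t\<close>; so the maximum is attained at
    \<open>t\<close>.\<close>
  obtain s where s: "s \<in> {0..t}" "running_max f t = f s" using running_max_attained[OF t0] by metis
  have "running_max f s = f s"
    using s running_max_mono[of s t] running_max_ge[of s s] by auto
  then have "running_max f (s + \<epsilon>) = running_max f s"
    using running_max_mono[of s "s + \<epsilon>"] running_max_mono[of "s + \<epsilon>" "t + \<epsilon>"] s tM \<epsilon> by auto
  then have "s \<in> stop_set \<epsilon> f" using s by (simp add: stop_set_def)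
  then have "t \<le> s" unfolding t_def by (rule path_avalanche_length_le)
  then have ft: "running_max f t = f t" using s by auto
  have le: "f v \<le> f t" if "0 \<le> v" "v \<le> t + \<epsilon>" for v
    using running_max_ge[of v "t + \<epsilon>"] that tM ft by simp
  have b: "t + \<kappa> \<le> b" "b < t + \<epsilon>" using \<epsilon> \<kappa> by (auto simp: b_def)
  obtain v where v: "v \<in> {t+\<kappa>..b}" "\<And>y. y \<in> {t+\<kappa>..b} \<Longrightarrow> f y \<le> f v"
    using continuous_attains_sup[of "{t+\<kappa>..b}" f] cont_interval[of "t + \<kappa>" b] b t0 \<kappa> by auto
  have "f v \<noteq> f t"
  proof
    assume eq: "f v = f t"
    \<comment> \<open>A return to the level \<open>f t\<close> at \<open>v\<close> would make the
      maxima over {0..q} and {q'..r} both equal to \<open>f t\<close>, which \<open>ties\<close>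
      forbids for rational times.\<close>
    obtain q where q: "q \<in> \<rat>" "t < q" "q < t + \<kappa>" using Rats_dense_in_real[of t "t + \<kappa>"] \<kappa> by auto
    obtain q' where q': "q' \<in> \<rat>" "q < q'" "q' < t + \<kappa>" using Rats_dense_in_real[of q "t + \<kappa>"] q by auto
    obtain r where r: "r \<in> \<rat>" "b < r" "r < t + \<epsilon>" using Rats_dense_in_real[of b "t + \<epsilon>"] b by auto
    have "running_max f q = f t"
      using q t0 b running_max_ge[of t q] by (intro antisym running_max_le le) auto
    moreover have "(SUP s\<in>{q'..r}. f s) = f t"
      using v q q' r t0 le unfolding eq[symmetric] by (intro cSup_eq_maximum) (auto intro!: imageI)
    ultimately show False using ties[of q q' r] q q' r v t0 by auto
  qed
  then have fv: "f v < f t" using le[of v] v b \<kappa> t0 by auto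
  have "continuous (at t within {0..}) f" using cont t0 by (simp add: continuous_on_eq_continuous_within)
  then obtain d where d: "d > 0" "\<And>y. y \<ge> 0 \<Longrightarrow> dist y t < d \<Longrightarrow> dist (f y) (f t) < f t - f v"
    using fv unfolding continuous_within_eps_delta by (metis atLeast_iff diff_gt_0_iff_gt)
  obtain m0 :: nat where m0: "1 / min d \<kappa> < real m0" using reals_Archimedean2 by blast
  have "\<exists>k. stalls (nat \<lfloor>real m * \<epsilon>'\<rfloor>) (\<lambda>k. f (real k / real m)) k \<and> real k / real m \<le> t + \<eta>"
    if m: "m \<ge> max 1 m0" for m
  proof -
    let ?g = "\<lambda>k. f (real k / real m)"
    have mpos: "real m > 0" using m by simp
    have md: "1 / real m < min d \<kappa>"
    proof -
      have "1 / x < y \<Longrightarrow> 1 / y < x" if "x > 0" "y > 0" for x y :: real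
        using that by (simp add: field_simps)
      moreover have "1 / min d \<kappa> < real m" using m m0 by simp
      ultimately show ?thesis using d \<kappa> mpos by (metis min_less_iff_conj)
    qed
    \<comment> \<open>The first grid time at or after \<open>t\<close>. By continuity its value
      exceeds \<open>f v\<close>, the maximum over {t+\<kappa>..b}, so the grid maximum up to
      \<open>b\<close> is attained before \<open>t + \<kappa>\<close>.\<close>
    define k0 where "k0 = nat \<lceil>real m * t\<rceil>"
    have k0: "real m * t \<le> real k0" "real k0 < real m * t + 1"
      unfolding k0_def using t0 mpos by (auto simp: of_nat_ceiling) linarith
    then have k0': "t \<le> real k0 / real m" "real k0 / real m < t + 1 / real m"
      using mpos by (simp_all add: field_simps)
    define K where "K = nat \<lfloor>real m * b\<rfloor>"
    have inK: "i \<le> K \<longleftrightarrow> real i / real m \<le> b" for i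
      unfolding K_def using mpos b \<kappa> t0 by (simp add: le_nat_floor le_floor_iff nat_le_iff field_simps le_nat_iff)
    have k0K: "k0 \<le> K" unfolding inK using k0' md b by simp
    obtain k where k: "k \<le> K" "is_record ?g k" and gle: "\<And>j. j \<le> K \<Longrightarrow> ?g j \<le> ?g k"
      using ex_first_max[of K ?g] by blast
    have "dist (f (real k0 / real m)) (f t) < f t - f v"
      using k0' md t0 by (intro d) (auto simp: dist_real_def)
    then have "f v < ?g k0" by (simp add: dist_real_def)
    then have "f v < ?g k" using gle[OF k0K] by simp
    then have kt: "real k / real m < t + \<kappa>"
      using v(2)[of "real k / real m"] k(1)[unfolded inK] by force
    have "j \<le> K" if "j \<le> k + nat \<lfloor>real m * \<epsilon>'\<rfloor>" for j
    proof -
      have "real (nat \<lfloor>real m * \<epsilon>'\<rfloor>) \<le> real m * \<epsilon>'" using \<epsilon> mpos by simp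
      then have "real j \<le> real k + real m * \<epsilon>'" using that by linarith
      then have "real j / real m \<le> real k / real m + \<epsilon>'" using mpos by (simp add: field_simps)
      then show ?thesis unfolding inK using kt \<kappa> by simp
    qed
    then have "stalls (nat \<lfloor>real m * \<epsilon>'\<rfloor>) ?g k"
      using gle k(2) by (auto simp: stalls_def)
    then show ?thesis using kt \<kappa> by (intro exI[of _ k]) auto
  qed
  then show ?thesis unfolding t_def[symmetric] eventually_at_top_linorder by blast
qed

end

subsection \<open>Weak convergence from Laplace transforms at integers\<close>

text \<open>Polynomials in \<open>exp (- x)\<close> are dense in the continuous functions of \<open>exp (- x) \<in> {0..1}\<close>.\<close>

lemma weak_conv_m_laplace:
  fixes X :: "nat \<Rightarrow> 'a \<Rightarrow> real" and Y :: "'b \<Rightarrow> real"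
  assumes M: "prob_space M" and N: "prob_space N"
    and X[measurable]: "\<And>n. X n \<in> borel_measurable M" and Y[measurable]: "Y \<in> borel_measurable N"
    and X_nonneg: "\<And>n. AE \<omega> in M. X n \<omega> \<ge> 0" and Y_nonneg: "AE \<omega> in N. Y \<omega> \<ge> 0"
    and lim: "\<And>k::nat. k > 0 \<Longrightarrow>
      (\<lambda>n. \<integral>\<omega>. exp (- (real k * X n \<omega>)) \<partial>M) \<longlonglongrightarrow> (\<integral>\<omega>. exp (- (real k * Y \<omega>)) \<partial>N)"
  shows "weak_conv_m (\<lambda>n. distr M borel (X n)) (distr N borel Y)"
proof -
  interpret M: prob_space M by fact
  interpret N: prob_space N by fact
  let ?E = "\<lambda>n. distr M borel (\<lambda>\<omega>. exp (- X n \<omega>))" and ?F = "distr N borel (\<lambda>\<omega>. exp (- Y \<omega>))"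
  have real_distr: "real_distribution (?E n)" "real_distribution ?F"
    "real_distribution (distr M borel (X n))" "real_distribution (distr N borel Y)" for n
    by (auto intro!: M.real_distribution_distr N.real_distribution_distr)
  have weak: "weak_conv_m ?E ?F"
  proof (rule integral_bdd_continuous_conv_imp_weak_conv[OF real_distr(1,2)])
    fix g :: "real \<Rightarrow> real" assume g: "\<And>x. isCont g x" "\<And>x. \<bar>g x\<bar> \<le> 1"
    have cg: "continuous_on UNIV g" using g(1) by (simp add: continuous_at_imp_continuous_on)
    then have [measurable]: "g \<in> borel_measurable borel" by (rule borel_measurable_continuous_onI)
    have "(\<lambda>n. \<integral>\<omega>. g (exp (- X n \<omega>)) \<partial>M) \<longlonglongrightarrow> (\<integral>\<omega>. g (exp (- Y \<omega>)) \<partial>N)"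
    proof (rule tendstoI)
      fix e :: real assume e: "e > 0"
      obtain h where h: "real_polynomial_function h" "\<And>x. x \<in> {0..1::real} \<Longrightarrow> \<bar>g x - h x\<bar> < e / 3"
        using Stone_Weierstrass_real_polynomial_function[of "{0..1}" g "e / 3"] e
          continuous_on_subset[OF cg] by auto
      obtain a d where a: "h = (\<lambda>x. \<Sum>i\<le>d. a i * x ^ i)"
        using h(1) unfolding real_polynomial_function_iff_sum by blast
      have poly: "integrable P (\<lambda>\<omega>. exp (- (real i * Z \<omega>)))" "integrable P (\<lambda>\<omega>. h (exp (- Z \<omega>)))"
        "(\<integral>\<omega>. h (exp (- Z \<omega>)) \<partial>P) = (\<Sum>i\<le>d. a i * (\<integral>\<omega>. exp (- (real i * Z \<omega>)) \<partial>P))"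
        "\<bar>(\<integral>\<omega>. g (exp (- Z \<omega>)) \<partial>P) - (\<integral>\<omega>. h (exp (- Z \<omega>)) \<partial>P)\<bar> \<le> e / 3"
        if P: "prob_space P" and [measurable]: "Z \<in> borel_measurable P" and Z: "AE \<omega> in P. Z \<omega> \<ge> 0"
        for P :: "'c measure" and Z i
      proof -
        interpret P: prob_space P by fact
        have int: "integrable P (\<lambda>\<omega>. exp (- (real i * Z \<omega>)))" for i
        proof (rule P.integrable_const_bound[where B = 1])
          show "AE \<omega> in P. norm (exp (- (real i * Z \<omega>))) \<le> 1" using Z by eventually_elim simp
        qed measurable
        show "integrable P (\<lambda>\<omega>. exp (- (real i * Z \<omega>)))" by (rule int)
        have eq: "h (exp (- Z \<omega>)) = (\<Sum>i\<le>d. a i * exp (- (real i * Z \<omega>)))" for \<omega>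
          unfolding a by (simp add: exp_of_nat_mult[symmetric])
        show ih: "integrable P (\<lambda>\<omega>. h (exp (- Z \<omega>)))"
          unfolding eq by (intro Bochner_Integration.integrable_sum integrable_mult_right int)
        show "(\<integral>\<omega>. h (exp (- Z \<omega>)) \<partial>P) = (\<Sum>i\<le>d. a i * (\<integral>\<omega>. exp (- (real i * Z \<omega>)) \<partial>P))"
          unfolding eq by (subst Bochner_Integration.integral_sum) (auto intro: int)
        have ig: "integrable P (\<lambda>\<omega>. g (exp (- Z \<omega>)))"
          by (rule P.integrable_const_bound[where B = 1]) (use g in auto)
        have "\<bar>(\<integral>\<omega>. g (exp (- Z \<omega>)) \<partial>P) - (\<integral>\<omega>. h (exp (- Z \<omega>)) \<partial>P)\<bar> =
            \<bar>\<integral>\<omega>. g (exp (- Z \<omega>)) - h (exp (- Z \<omega>)) \<partial>P\<bar>"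
          by (simp add: Bochner_Integration.integral_diff[OF ig ih])
        also have "\<dots> \<le> (\<integral>\<omega>. \<bar>g (exp (- Z \<omega>)) - h (exp (- Z \<omega>))\<bar> \<partial>P)"
          by (rule integral_abs_bound)
        also have "\<dots> \<le> (\<integral>\<omega>. e / 3 \<partial>P)"
        proof (rule integral_mono_AE)
          show "AE \<omega> in P. \<bar>g (exp (- Z \<omega>)) - h (exp (- Z \<omega>))\<bar> \<le> e / 3"
            using Z
          proof eventually_elim
            case (elim \<omega>)
            then show ?case using h(2)[of "exp (- Z \<omega>)"] by simp
          qed
        qed (use ig ih in auto)
        finally show "\<bar>(\<integral>\<omega>. g (exp (- Z \<omega>)) \<partial>P) - (\<integral>\<omega>. h (exp (- Z \<omega>)) \<partial>P)\<bar> \<le> e / 3"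
          by (simp add: P.prob_space)
      qed
      have "(\<lambda>n. \<Sum>i\<le>d. a i * (\<integral>\<omega>. exp (- (real i * X n \<omega>)) \<partial>M)) \<longlonglongrightarrow>
          (\<Sum>i\<le>d. a i * (\<integral>\<omega>. exp (- (real i * Y \<omega>)) \<partial>N))"
      proof (intro tendsto_sum tendsto_mult tendsto_const)
        fix i show "(\<lambda>n. \<integral>\<omega>. exp (- (real i * X n \<omega>)) \<partial>M) \<longlonglongrightarrow> (\<integral>\<omega>. exp (- (real i * Y \<omega>)) \<partial>N)"
          by (cases "i = 0") (use lim[of i] in \<open>auto simp: M.prob_space N.prob_space\<close>)
      qed
      then have "(\<lambda>n. \<integral>\<omega>. h (exp (- X n \<omega>)) \<partial>M) \<longlonglongrightarrow> (\<integral>\<omega>. h (exp (- Y \<omega>)) \<partial>N)"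
        by (simp add: poly(3)[OF M X X_nonneg] poly(3)[OF N Y Y_nonneg])
      then have "\<forall>\<^sub>F n in sequentially. dist (\<integral>\<omega>. h (exp (- X n \<omega>)) \<partial>M) (\<integral>\<omega>. h (exp (- Y \<omega>)) \<partial>N) < e / 3"
        using e by (intro tendstoD) auto
      then show "\<forall>\<^sub>F n in sequentially. dist (\<integral>\<omega>. g (exp (- X n \<omega>)) \<partial>M) (\<integral>\<omega>. g (exp (- Y \<omega>)) \<partial>N) < e"
      proof eventually_elim
        case (elim n)
        then show ?case
          using poly(4)[OF M X X_nonneg, of n] poly(4)[OF N Y Y_nonneg] e
          unfolding dist_real_def by linarith
      qed
    qed
    then show "(\<lambda>n. integral\<^sup>L (?E n) g) \<longlonglongrightarrow> integral\<^sup>L ?F g"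
      by (simp add: integral_distr)
  qed
  show ?thesis
  proof (rule integral_bdd_continuous_conv_imp_weak_conv[OF real_distr(3,4)])
    fix g :: "real \<Rightarrow> real" assume g: "\<And>x. isCont g x" "\<And>x. \<bar>g x\<bar> \<le> 1"
    have "continuous_on UNIV g" using g(1) by (simp add: continuous_at_imp_continuous_on)
    then have [measurable]: "g \<in> borel_measurable borel" by (rule borel_measurable_continuous_onI)
    \<comment> \<open>Undo the substitution: \<open>- ln x\<close> is continuous for positive
      \<open>x\<close>, and \<open>exp (- Y)\<close> gives no mass to \<open>{..0}\<close>, where
      \<open>?g\<close> may be discontinuous.\<close>
    let ?g = "\<lambda>x. g (- ln x)"
    have cont: "isCont ?g x" if "x > 0" for x
      using that by (intro isCont_o2[OF _ g(1)] continuous_intros) auto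
    have "emeasure ?F {x. \<not> isCont ?g x} \<le> emeasure ?F {..0}"
      using cont by (intro emeasure_mono) (auto simp: not_less[symmetric])
    also have "\<dots> = emeasure N ((\<lambda>\<omega>. exp (- Y \<omega>)) -` {..0} \<inter> space N)"
      by (intro emeasure_distr) auto
    also have "(\<lambda>\<omega>. exp (- Y \<omega>)) -` {..0} \<inter> space N = {}" by (auto simp: not_le)
    finally have null: "emeasure ?F {x. \<not> isCont ?g x} = 0" by simp
    have "(\<lambda>n. integral\<^sup>L (?E n) ?g) \<longlonglongrightarrow> integral\<^sup>L ?F ?g"
      by (rule weak_conv_imp_bdd_ae_continuous_conv[OF real_distr(1,2) weak null, of 1]) (use g in auto)
    then show "(\<lambda>n. integral\<^sup>L (distr M borel (X n)) g) \<longlonglongrightarrow> integral\<^sup>L (distr N borel Y) g"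
      by (simp add: integral_distr)
  qed
qed

subsection \<open>Adding an independent normal variable\<close>

text \<open>For each value of \<open>U\<close> the variable \<open>G\<close> must lie in an interval
  of length 2 \<delta>, and its density is at most 1 / (sqrt (2 pi) \<sigma>). The bound does not
  depend on the law of \<open>U\<close>.\<close>

lemma (in prob_space) prob_normal_plus_indep_le:
  assumes indep: "indep_var borel G borel U"
    and G: "distributed M lborel G (normal_density 0 \<sigma>)" and "\<sigma> > 0" "\<delta> > 0"
  shows "prob {\<omega> \<in> space M. \<bar>G \<omega> + U \<omega>\<bar> \<le> \<delta>} \<le> 2 * \<delta> / (sqrt (2 * pi) * \<sigma>)"
proof -
  have [measurable]: "G \<in> borel_measurable M" "U \<in> borel_measurable M"
    using indep by (auto dest: indep_var_rv1 indep_var_rv2)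
  interpret P: prob_space "distr M borel G" by (rule prob_space_distr) simp
  interpret Q: prob_space "distr M borel U" by (rule prob_space_distr) simp
  interpret PQ: pair_prob_space "distr M borel G" "distr M borel U" ..
  let ?C = "1 / (sqrt (2 * pi) * \<sigma>)"
  let ?A = "{x :: real \<times> real. \<bar>fst x + snd x\<bar> \<le> \<delta>}"
  have A: "?A \<in> sets (borel \<Otimes>\<^sub>M borel)"
  proof -
    have "{x \<in> space (borel \<Otimes>\<^sub>M borel). \<bar>fst x + snd x\<bar> \<le> \<delta>} \<in> sets (borel \<Otimes>\<^sub>M borel :: (real \<times> real) measure)"
      by measurable
    then show ?thesis by (simp add: space_pair_measure)
  qed
  have dens: "normal_density 0 \<sigma> x \<le> ?C" for x
  proof -
    have "1 / sqrt (2 * pi * \<sigma>\<^sup>2) * exp (- (x\<^sup>2 / (2 * \<sigma>\<^sup>2))) \<le> 1 / sqrt (2 * pi * \<sigma>\<^sup>2) * 1"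
      by (intro mult_left_mono) auto
    then show ?thesis using \<open>\<sigma> > 0\<close> by (simp add: normal_density_def real_sqrt_mult)
  qed
  have slice: "emeasure (distr M borel G) ((\<lambda>g. (g, u)) -` ?A) \<le> ennreal (2 * \<delta> * ?C)" for u
  proof -
    have S: "(\<lambda>g. (g, u)) -` ?A = {- u - \<delta>..- u + \<delta>}" by (auto simp: abs_le_iff)
    have "emeasure (distr M borel G) ((\<lambda>g. (g, u)) -` ?A) = emeasure M (G -` {- u - \<delta>..- u + \<delta>} \<inter> space M)"
      unfolding S by (subst emeasure_distr) auto
    also have "\<dots> = (\<integral>\<^sup>+x. ennreal (normal_density 0 \<sigma> x) * indicator {- u - \<delta>..- u + \<delta>} x \<partial>lborel)"
      by (rule distributed_emeasure[OF G]) auto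
    also have "\<dots> \<le> (\<integral>\<^sup>+x. ennreal ?C * indicator {- u - \<delta>..- u + \<delta>} x \<partial>lborel)"
      using dens by (intro nn_integral_mono mult_right_mono ennreal_leI) auto
    also have "\<dots> = ennreal ?C * ennreal (2 * \<delta>)"
      using \<open>\<delta> > 0\<close> by (subst nn_integral_cmult_indicator) (auto simp: emeasure_lborel_Icc)
    also have "\<dots> = ennreal (2 * \<delta> * ?C)"
      using \<open>\<sigma> > 0\<close> \<open>\<delta> > 0\<close> by (subst ennreal_mult[symmetric]) (auto simp: mult_ac)
    finally show ?thesis .
  qed
  have "emeasure M {\<omega> \<in> space M. \<bar>G \<omega> + U \<omega>\<bar> \<le> \<delta>} =
      emeasure (distr M (borel \<Otimes>\<^sub>M borel) (\<lambda>\<omega>. (G \<omega>, U \<omega>))) ?A"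
    using A by (subst emeasure_distr) (auto intro!: arg_cong[where f = "emeasure M"])
  also have "\<dots> = emeasure (distr M borel G \<Otimes>\<^sub>M distr M borel U) ?A"
    using indep unfolding indep_var_distribution_eq by simp
  also have "\<dots> = (\<integral>\<^sup>+u. emeasure (distr M borel G) ((\<lambda>g. (g, u)) -` ?A) \<partial>distr M borel U)"
  proof (rule PQ.emeasure_pair_measure_alt2)
    have "sets (distr M borel G \<Otimes>\<^sub>M distr M borel U) = sets (borel \<Otimes>\<^sub>M borel)"
      by (intro sets_pair_measure_cong) auto
    then show "?A \<in> sets (distr M borel G \<Otimes>\<^sub>M distr M borel U)" using A by simp
  qed
  also have "\<dots> \<le> (\<integral>\<^sup>+u. ennreal (2 * \<delta> * ?C) \<partial>distr M borel U)"
    by (intro nn_integral_mono slice)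
  also have "\<dots> = ennreal (2 * \<delta> * ?C)" using Q.emeasure_space_1 by simp
  finally show ?thesis using \<open>\<sigma> > 0\<close> \<open>\<delta> > 0\<close>
    by (simp add: emeasure_eq_measure)
qed

lemma (in prob_space) indep_vars_nat:
  assumes "\<And>k::nat. indep_vars M' X {..<k}"
  shows "indep_vars M' X UNIV"
  unfolding indep_vars_def2
proof (intro conjI ballI)
  fix i show "random_variable (M' i) (X i)"
    using assms[of "Suc i"] by (simp add: indep_vars_def2)
next
  show "indep_sets (\<lambda>i. {X i -` A \<inter> space M |A. A \<in> sets (M' i)}) UNIV"
    unfolding indep_sets_finite_index_sets[of _ UNIV]
  proof (intro allI impI)
    fix J :: "nat set" assume "finite J"
    then obtain k where "J \<subseteq> {..<k}" by (metis finite_nat_iff_bounded)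
    moreover have "indep_sets (\<lambda>i. {X i -` A \<inter> space M |A. A \<in> sets (M' i)}) {..<k}"
      using assms[of k] by (simp add: indep_vars_def2)
    ultimately show "indep_sets (\<lambda>i. {X i -` A \<inter> space M |A. A \<in> sets (M' i)}) J"
      by (rule indep_sets_mono_index)
  qed
qed

subsection \<open>Brownian motion on a grid\<close>

context standard_brownian_motion
begin

abbreviation path :: "'a \<Rightarrow> real \<Rightarrow> real" where
  "path \<omega> \<equiv> \<lambda>t. W t \<omega>"

lemma measurable_W [measurable]: "t \<ge> 0 \<Longrightarrow> W t \<in> borel_measurable M"
  by (rule random_variable)

lemma continuous_path: "\<omega> \<in> space M \<Longrightarrow> continuous_path (path \<omega>)"
  by unfold_locales (rule continuous_paths)

definition grid_step :: "nat \<Rightarrow> nat \<Rightarrow> 'a \<Rightarrow> real" where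
  "grid_step m i \<omega> = W (real (Suc i) / real m) \<omega> - W (real i / real m) \<omega>"

lemma psum_grid_step:
  "\<omega> \<in> space M \<Longrightarrow> psum (\<lambda>i. grid_step m i \<omega>) n = W (real n / real m) \<omega>"
  by (induction n) (auto simp: grid_step_def start)

lemma distr_increment:
  assumes "0 \<le> r" "r < t"
  shows "distr M borel (\<lambda>\<omega>. W t \<omega> - W r \<omega>) = density lborel (normal_density 0 (sqrt (t - r)))"
proof -
  have "distr M borel (\<lambda>\<omega>. W t \<omega> - W r \<omega>) = distr M lborel (\<lambda>\<omega>. W t \<omega> - W r \<omega>)"
    by (intro distr_cong) auto
  also have "\<dots> = density lborel (normal_density 0 (sqrt (t - r)))"
    using normal_increments[OF assms] by (simp add: distributed_def)
  finally show ?thesis .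
qed

lemma increment_neq_0:
  assumes "0 \<le> r" "r < t"
  shows "AE \<omega> in M. W t \<omega> - W r \<omega> \<noteq> 0"
proof -
  have "AE x in density lborel (normal_density 0 (sqrt (t - r))). x \<noteq> 0"
    by (subst AE_density) (use AE_lborel_singleton[of "0::real"] in \<open>auto elim: eventually_mono\<close>)
  then have "AE x in distr M borel (\<lambda>\<omega>. W t \<omega> - W r \<omega>). x \<noteq> 0"
    by (simp only: distr_increment[OF assms])
  then show ?thesis using assms by (subst (asm) AE_distr_iff) auto
qed

lemma grid_walk:
  assumes "m > 0"
  shows "symmetric_walk M (grid_step m)"
proof unfold_locales
  have lt: "real i / real m < real (Suc i) / real m" for i
    using assms by (simp add: divide_strict_right_mono)
  have len: "real (Suc i) / real m - real i / real m = 1 / real m" for i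
    by (simp add: diff_divide_distrib[symmetric])
  have d: "distr M borel (grid_step m n) = density lborel (normal_density 0 (sqrt (1 / real m)))" for n
    using distr_increment[OF _ lt, of n] unfolding len by (simp add: grid_step_def[abs_def])
  show "indep_vars (\<lambda>_. borel) (grid_step m) UNIV"
  proof (rule indep_vars_nat)
    fix k show "indep_vars (\<lambda>_. borel) (grid_step m) {..<k}"
      using indep_increments[of "\<lambda>i. real i / real m" k] lt by (simp add: grid_step_def[abs_def])
  qed
  show "distr M borel (grid_step m n) = distr M borel (grid_step m 0)" for n
    by (simp only: d)
  have "distributed M lborel (grid_step m 0) (normal_density 0 (sqrt (1 / real m)))"
    using normal_increments[OF _ lt, of 0] unfolding len by (simp add: grid_step_def[abs_def])
  then have "distributed M lborel (\<lambda>\<omega>. 0 + (- 1) * grid_step m 0 \<omega>)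
      (normal_density (0 + (- 1) * 0) (\<bar>- 1\<bar> * sqrt (1 / real m)))"
    by (rule normal_density_affine) (use assms in auto)
  then have "distr M lborel (\<lambda>\<omega>. - grid_step m 0 \<omega>) = density lborel (normal_density 0 (sqrt (1 / real m)))"
    by (simp add: distributed_def)
  moreover have "distr M borel (\<lambda>\<omega>. - grid_step m 0 \<omega>) = distr M lborel (\<lambda>\<omega>. - grid_step m 0 \<omega>)"
    by (intro distr_cong) auto
  ultimately show "distr M borel (\<lambda>\<omega>. - grid_step m 0 \<omega>) = distr M borel (grid_step m 0)"
    by (simp only: d)
qed

lemma stay_grid:
  assumes "m > 0"
  shows "symmetric_walk.stay M (grid_step m) n = central_ratio n"
proof -
  interpret G: symmetric_walk M "grid_step m" by (rule grid_walk[OF assms])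
  show ?thesis
  proof (rule G.stay_continuous_walk)
    fix n :: nat assume "n > 0"
    then have "AE \<omega> in M. W (real n / real m) \<omega> - W 0 \<omega> \<noteq> 0"
      using assms by (intro increment_neq_0) auto
    then show "AE \<omega> in M. psum (\<lambda>i. grid_step m i \<omega>) n \<noteq> 0"
      using AE_space by eventually_elim (simp add: psum_grid_step start)
  qed
qed

text \<open>Nonnegativity of \<open>central_ratio\<close> is read off from its being a probability
  for a grid walk.\<close>

lemma decay_central_ratio: "inverse_sqrt_decay central_ratio (inverse (Gamma (1 / 2)))"
proof -
  interpret G: symmetric_walk M "grid_step 1" by (rule grid_walk) simp
  have "G.stay = central_ratio" using stay_grid[of 1] by (simp add: fun_eq_iff)
  moreover have "inverse_sqrt_decay G.stay (inverse (Gamma (1 / 2)))"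
    using central_ratio_asymptotic stay_grid[of 1] by (intro G.inverse_sqrt_decay_stay) (auto simp: Gamma_real_pos)
  ultimately show ?thesis by simp
qed

section \<open>Grid lengths and their Laplace transforms\<close>

definition grid_length :: "real \<Rightarrow> nat \<Rightarrow> 'a \<Rightarrow> real" where
  "grid_length \<epsilon> m \<omega> = real (stall_time (nat \<lfloor>real m * \<epsilon>\<rfloor>) (\<lambda>k. W (real k / real m) \<omega>)) / real m"

lemma measurable_grid_length [measurable]: "grid_length \<epsilon> m \<in> borel_measurable M"
proof -
  have "(\<lambda>\<omega>. stall_time (nat \<lfloor>real m * \<epsilon>\<rfloor>) (\<lambda>k. W (real k / real m) \<omega>)) \<in> measurable M (count_space UNIV)"
    by (rule measurable_stall_time) simp
  then show ?thesis
    unfolding grid_length_def[abs_def] by (rule measurable_compose) simp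
qed

lemma grid_length_nonneg: "grid_length \<epsilon> m \<omega> \<ge> 0"
  by (simp add: grid_length_def)

definition laplace :: "real \<Rightarrow> real" where
  "laplace r = Re (avalanche_laplace (of_real r))"

lemma grid_laplace_limit_complex:
  assumes "\<epsilon> > 0" "\<theta> \<ge> 0"
  shows "(\<lambda>m. expectation (\<lambda>\<omega>. exp (- (of_real \<theta> / of_nat m) *
      of_real (real (symmetric_walk.stall (grid_step m) (nat \<lfloor>real m * \<epsilon>\<rfloor>) \<omega>)) :: complex)))
      \<longlonglongrightarrow> avalanche_laplace (of_real \<theta> * of_real \<epsilon>)"
    "avalanche_denominator (of_real \<theta> * of_real \<epsilon>) \<noteq> 0"
  using stall_laplace_limit[of M grid_step central_ratio, OF grid_walk stay_grid decay_central_ratio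
      floor_window[OF assms(1)], of "of_real \<theta>"] assms(2) by auto

lemma grid_laplace_limit:
  assumes "\<epsilon> > 0" "\<theta> \<ge> 0"
  shows "(\<lambda>m. expectation (\<lambda>\<omega>. exp (- (\<theta> * grid_length \<epsilon> m \<omega>)))) \<longlonglongrightarrow> laplace (\<theta> * \<epsilon>)"
proof -
  have "(\<lambda>m. Re (expectation (\<lambda>\<omega>. exp (- (of_real \<theta> / of_nat m) *
      of_real (real (symmetric_walk.stall (grid_step m) (nat \<lfloor>real m * \<epsilon>\<rfloor>) \<omega>)) :: complex))))
      \<longlonglongrightarrow> Re (avalanche_laplace (of_real \<theta> * of_real \<epsilon>))"
    by (rule tendsto_Re[OF grid_laplace_limit_complex(1)[OF assms]])
  moreover have "\<forall>\<^sub>F m in sequentially. Re (expectation (\<lambda>\<omega>. exp (- (of_real \<theta> / of_nat m) *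
      of_real (real (symmetric_walk.stall (grid_step m) (nat \<lfloor>real m * \<epsilon>\<rfloor>) \<omega>)) :: complex))) =
      expectation (\<lambda>\<omega>. exp (- (\<theta> * grid_length \<epsilon> m \<omega>)))"
    using eventually_gt_at_top[of 0]
  proof eventually_elim
    case (elim m)
    interpret G: symmetric_walk M "grid_step m" by (rule grid_walk[OF elim])
    have "expectation (\<lambda>\<omega>. exp (- (of_real \<theta> / of_nat m) * of_real (real (G.stall (nat \<lfloor>real m * \<epsilon>\<rfloor>) \<omega>)) :: complex)) =
        expectation (\<lambda>\<omega>. complex_of_real (exp (- (\<theta> * grid_length \<epsilon> m \<omega>))))"
    proof (rule Bochner_Integration.integral_cong[OF refl])
      fix \<omega> assume "\<omega> \<in> space M"
      then have "psum (\<lambda>i. grid_step m i \<omega>) = (\<lambda>k. W (real k / real m) \<omega>)"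
        by (simp add: fun_eq_iff psum_grid_step)
      then show "exp (- (of_real \<theta> / of_nat m) * of_real (real (G.stall (nat \<lfloor>real m * \<epsilon>\<rfloor>) \<omega>))) =
          complex_of_real (exp (- (\<theta> * grid_length \<epsilon> m \<omega>)))"
        by (simp add: G.stall_def grid_length_def exp_of_real[symmetric])
    qed
    then show ?case by simp
  qed
  ultimately show ?thesis unfolding laplace_def by (simp add: Lim_transform_eventually)
qed

lemma isCont_laplace:
  assumes "r \<ge> 0" shows "isCont laplace r"
proof -
  have "avalanche_denominator (of_real r) \<noteq> 0"
    using grid_laplace_limit_complex(2)[of 1 r] assms by simp
  then have "isCont (\<lambda>x. avalanche_laplace (of_real x)) r"
    by (intro isCont_o2[OF _ isCont_avalanche_laplace]) (auto intro: continuous_intros)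
  then show ?thesis unfolding laplace_def[abs_def] by (rule isCont_Re)
qed

text \<open>A grid path without a stall would get the default length 0, and the lower bound on grid
  lengths would fail for it. Positivity of \<open>central_ratio\<close> is taken from its
  asymptotics, hence the restriction to eventually all \<open>m\<close>.\<close>

lemma AE_grid_stalls:
  "AE \<omega> in M. \<forall>\<^sub>F m in sequentially. \<exists>k. stalls (nat \<lfloor>real m * \<epsilon>\<rfloor>) (\<lambda>k. W (real k / real m) \<omega>) k"
  if "\<epsilon> > 0"
proof -
  interpret inverse_sqrt_decay central_ratio "inverse (Gamma (1 / 2))" by (rule decay_central_ratio)
  have "AE \<omega> in M. m > 0 \<and> central_ratio (nat \<lfloor>real m * \<epsilon>\<rfloor>) > 0 \<longrightarrow>
      (\<exists>k. stalls (nat \<lfloor>real m * \<epsilon>\<rfloor>) (\<lambda>k. W (real k / real m) \<omega>) k)" for m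
  proof (cases "m > 0 \<and> central_ratio (nat \<lfloor>real m * \<epsilon>\<rfloor>) > 0")
    case True
    then have "m > 0" by simp
    interpret G: symmetric_walk M "grid_step m" by (rule grid_walk[OF \<open>m > 0\<close>])
    have "AE \<omega> in M. \<exists>k. stalls (nat \<lfloor>real m * \<epsilon>\<rfloor>) (psum (\<lambda>i. grid_step m i \<omega>)) k"
      using True by (intro G.AE_stalls) (simp add: stay_grid)
    then show ?thesis using AE_space
    proof eventually_elim
      case (elim \<omega>)
      then have "psum (\<lambda>i. grid_step m i \<omega>) = (\<lambda>k. W (real k / real m) \<omega>)"
        by (simp add: fun_eq_iff psum_grid_step)
      with elim show ?case by simp
    qed
  qed auto
  then have "AE \<omega> in M. \<forall>m. m > 0 \<and> central_ratio (nat \<lfloor>real m * \<epsilon>\<rfloor>) > 0 \<longrightarrow>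
      (\<exists>k. stalls (nat \<lfloor>real m * \<epsilon>\<rfloor>) (\<lambda>k. W (real k / real m) \<omega>) k)"
    by (simp add: AE_all_countable)
  then show ?thesis
  proof eventually_elim
    case (elim \<omega>)
    show ?case
      using eventually_gt_at_top[of 0] eventually_compose_filterlim[OF eventually_p_pos floor_window(1)[OF that]]
      by eventually_elim (use elim in auto)
  qed
qed

subsection \<open>Measurability of the Brownian avalanche length\<close>

lemma measurable_grid_max:
  "0 \<le> a \<Longrightarrow> a \<le> b \<Longrightarrow> (\<lambda>\<omega>. grid_max (path \<omega>) a b n) \<in> borel_measurable M"
  unfolding grid_max_def by (intro borel_measurable_Max) auto

lemma measurable_Sup_path:
  assumes "0 \<le> a" "a \<le> b"
  shows "(\<lambda>\<omega>. SUP s\<in>{a..b}. W s \<omega>) \<in> borel_measurable M"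
proof (rule borel_measurable_LIMSEQ_real)
  fix \<omega> assume "\<omega> \<in> space M"
  then interpret continuous_path "path \<omega>" by (rule continuous_path)
  show "grid_max (path \<omega>) a b \<longlonglongrightarrow> (SUP s\<in>{a..b}. W s \<omega>)"
    by (rule grid_max_tendsto_Sup[OF cont_interval]) (use assms in auto)
next
  fix n show "(\<lambda>\<omega>. grid_max (path \<omega>) a b n) \<in> borel_measurable M"
    by (rule measurable_grid_max[OF assms])
qed

lemma measurable_running_max [measurable]:
  "t \<ge> 0 \<Longrightarrow> (\<lambda>\<omega>. running_max (path \<omega>) t) \<in> borel_measurable M"
  unfolding running_max_def by (rule measurable_Sup_path) auto

lemma sets_stop_before:
  assumes "\<epsilon> > 0" "t \<ge> 0"
  shows "{\<omega> \<in> space M. \<exists>s\<in>stop_set \<epsilon> (path \<omega>). s \<le> t} \<in> sets M"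
proof -
  have eq: "{\<omega> \<in> space M. \<exists>s\<in>stop_set \<epsilon> (path \<omega>). s \<le> t} =
    {\<omega> \<in> space M. \<forall>n::nat. \<exists>r\<in>\<rat> \<inter> {0..1}.
      running_max (path \<omega>) (r * t + \<epsilon>) - running_max (path \<omega>) (r * t) < 1 / real (Suc n)}"
    using continuous_path.stop_before_iff[OF continuous_path assms] by blast
  have "countable (\<rat> \<inter> {0..1 :: real})" by (intro countable_Int1 countable_rat)
  moreover have "{\<omega> \<in> space M. running_max (path \<omega>) (r * t + \<epsilon>) - running_max (path \<omega>) (r * t) < 1 / real (Suc n)} \<in> sets M"
    if "r \<in> \<rat> \<inter> {0..1}" for r n
  proof -
    have "0 \<le> r * t" using that assms by auto
    then have "0 \<le> r * t" "0 \<le> r * t + \<epsilon>" using assms by auto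
    from this[THEN measurable_running_max] show ?thesis by measurable
  qed
  ultimately show ?thesis unfolding eq
    by (intro sets.sets_Collect_countable_All sets.sets_Collect_countable_Ex')
qed

lemma sets_stop_nonempty:
  assumes "\<epsilon> > 0"
  shows "{\<omega> \<in> space M. stop_set \<epsilon> (path \<omega>) \<noteq> {}} \<in> sets M"
proof -
  have "{\<omega> \<in> space M. stop_set \<epsilon> (path \<omega>) \<noteq> {}} =
    (\<Union>n::nat. {\<omega> \<in> space M. \<exists>s\<in>stop_set \<epsilon> (path \<omega>). s \<le> real n})"
    using real_arch_simple by (fastforce simp: ex_in_conv[symmetric])
  also have "\<dots> \<in> sets M" using assms by (intro sets.countable_UN) (auto intro: sets_stop_before)
  finally show ?thesis .
qed

lemma measurable_path_avalanche_length:
  assumes "\<epsilon> > 0"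
  shows "(\<lambda>\<omega>. path_avalanche_length \<epsilon> (path \<omega>)) \<in> borel_measurable M"
proof (rule borel_measurableI_le)
  fix a :: real
  have L: "path_avalanche_length \<epsilon> (path \<omega>) \<le> a \<longleftrightarrow> (a \<ge> 0 \<and> (\<exists>s\<in>stop_set \<epsilon> (path \<omega>). s \<le> a))"
    if "\<omega> \<in> space M" "stop_set \<epsilon> (path \<omega>) \<noteq> {}" for \<omega>
  proof -
    interpret continuous_path "path \<omega>" by (rule continuous_path) fact
    have "path_avalanche_length \<epsilon> (path \<omega>) \<in> stop_set \<epsilon> (path \<omega>)"
      by (rule path_avalanche_length_in_stop_set) (use assms that in auto)
    then show ?thesis
      using path_avalanche_length_le by (fastforce simp: stop_set_def)
  qed
  define E where "E = {\<omega> \<in> space M. stop_set \<epsilon> (path \<omega>) \<noteq> {}}"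
  define A where "A = (if a \<ge> 0 then {\<omega> \<in> space M. \<exists>s\<in>stop_set \<epsilon> (path \<omega>). s \<le> a} else {})"
  \<comment> \<open>Off \<open>E\<close> the length is the constant \<open>Inf {}\<close>, so that
    part of the sublevel set is either all of the complement of \<open>E\<close> or empty.\<close>
  have "{\<omega> \<in> space M. path_avalanche_length \<epsilon> (path \<omega>) \<le> a} =
      (A \<inter> E) \<union> (if Inf {} \<le> a then space M - E else {})"
  proof (intro set_eqI)
    fix \<omega>
    show "\<omega> \<in> {\<omega> \<in> space M. path_avalanche_length \<epsilon> (path \<omega>) \<le> a} \<longleftrightarrow>
        \<omega> \<in> (A \<inter> E) \<union> (if Inf {} \<le> a then space M - E else {})"
    proof (cases "\<omega> \<in> E")
      case True
      then show ?thesis using L[of \<omega>] by (auto simp: E_def A_def)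
    next
      case False
      then show ?thesis by (auto simp: E_def path_avalanche_length_eq)
    qed
  qed
  also have "\<dots> \<in> sets M"
    using sets_stop_nonempty[OF assms] sets_stop_before[OF assms, of a] by (auto simp: A_def E_def)
  finally show "{\<omega> \<in> space M. path_avalanche_length \<epsilon> (path \<omega>) \<le> a} \<in> sets M" .
qed

end

context standard_brownian_motion
begin

subsection \<open>Maxima over disjoint intervals differ\<close>

text \<open>The two grid maxima differ by \<open>W q' - W q\<close> plus a function of the
  increments up to \<open>q\<close> and after \<open>q'\<close>. The middle increment is normal and
  independent of the rest, and the resulting bound is uniform in \<open>n\<close>.\<close>

lemma prob_grid_maxima_close:
  assumes q: "0 < q" "q < q'" "q' < r" and "n > 0" "\<delta> > 0"
  shows "prob {\<omega> \<in> space M. \<bar>grid_max (path \<omega>) q' r n -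
      grid_max (path \<omega>) 0 q n\<bar> \<le> \<delta>}
    \<le> 2 * \<delta> / (sqrt (2 * pi) * sqrt (q' - q))"
proof -
  \<comment> \<open>One increasing enumeration of both grids: indices up to \<open>n\<close> cover
    {0..q}, the next \<open>n + 1\<close> cover {q'..r}, and increment number \<open>n\<close> is
    the jump from \<open>q\<close> to \<open>q'\<close>.\<close>
  define T where "T i = (if i \<le> n then q * (real i / real n) else q' + (r - q') * (real (i - Suc n) / real n))" for i
  have Tn: "T n = q" "T (Suc n) = q'" using \<open>n > 0\<close> by (auto simp: T_def)
  have T_lo: "T i = 0 + (q - 0) * (real i / real n)" if "i \<le> n" for i using that by (simp add: T_def)
  have T_hi: "T (Suc n + i) = q' + (r - q') * (real i / real n)" for i by (simp add: T_def)
  have T_less: "T i < T (Suc i)" for i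
  proof (cases i n rule: linorder_cases)
    case less
    then show ?thesis using q \<open>n > 0\<close> by (auto simp: T_def divide_strict_right_mono)
  next
    case equal
    then show ?thesis using q Tn by simp
  next
    case greater
    then show ?thesis using q \<open>n > 0\<close> by (auto simp: T_def divide_strict_right_mono)
  qed
  let ?I = "\<lambda>i \<omega>. W (T (Suc i)) \<omega> - W (T i) \<omega>"
  let ?J = "{..<Suc (2 * n)} - {n}"
  \<comment> \<open>The maximum over the right grid relative to \<open>W q'\<close> minus the one
    over the left grid relative to \<open>W q\<close>; both involve only increments in
    \<open>?J\<close>.\<close>
  let ?Y = "\<lambda>x. Max ((\<lambda>i. \<Sum>l<i. x (Suc n + l)) ` {..n}) - Max ((\<lambda>i. - (\<Sum>l\<in>{i..<n}. x l)) ` {..n}) :: real"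
  have "indep_vars (\<lambda>_. borel) ?I {..<Suc (2 * n)}"
    by (rule indep_increments) (auto simp: T_less T_def[of 0])
  then have "indep_var (PiM {n} (\<lambda>_. borel)) (\<lambda>\<omega>. restrict (\<lambda>i. ?I i \<omega>) {n})
      (PiM ?J (\<lambda>_. borel)) (\<lambda>\<omega>. restrict (\<lambda>i. ?I i \<omega>) ?J)"
    by (rule indep_var_restrict) auto
  then have "indep_var borel ((\<lambda>x. x n) \<circ> (\<lambda>\<omega>. restrict (\<lambda>i. ?I i \<omega>) {n}))
      borel (?Y \<circ> (\<lambda>\<omega>. restrict (\<lambda>i. ?I i \<omega>) ?J))"
  proof (rule indep_var_compose)
    show "(\<lambda>x. x n) \<in> borel_measurable (PiM {n} (\<lambda>_. borel :: real measure))"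
      by (rule borel_measurable_PiM_component)
    show "?Y \<in> borel_measurable (PiM ?J (\<lambda>_. borel))"
      by (intro borel_measurable_diff borel_measurable_Max borel_measurable_uminus borel_measurable_sum
          borel_measurable_PiM_component) auto
  qed
  then have indep: "indep_var borel (\<lambda>\<omega>. W q' \<omega> - W q \<omega>) borel (\<lambda>\<omega>. ?Y (restrict (\<lambda>i. ?I i \<omega>) ?J))"
    by (simp add: comp_def Tn)
  have Y: "W q' \<omega> - W q \<omega> + ?Y (restrict (\<lambda>i. ?I i \<omega>) ?J) =
      grid_max (path \<omega>) q' r n -
      grid_max (path \<omega>) 0 q n" for \<omega>
  proof -
    have hi: "(\<Sum>l<i. restrict (\<lambda>i. ?I i \<omega>) ?J (Suc n + l)) =
        W (q' + (r - q') * (real i / real n)) \<omega> + - W q' \<omega>" if "i \<le> n" for i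
    proof -
      have "(\<Sum>l<i. restrict (\<lambda>i. ?I i \<omega>) ?J (Suc n + l)) =
          (\<Sum>l<i. W (T (Suc n + Suc l)) \<omega> - W (T (Suc n + l)) \<omega>)"
        using that by (intro sum.cong) auto
      also have "\<dots> = W (T (Suc n + i)) \<omega> - W (T (Suc n + 0)) \<omega>"
        by (rule sum_lessThan_telescope)
      finally show ?thesis by (simp only: T_hi) simp
    qed
    have lo: "- (\<Sum>l\<in>{i..<n}. restrict (\<lambda>i. ?I i \<omega>) ?J l) =
        W (0 + (q - 0) * (real i / real n)) \<omega> + - W q \<omega>" if "i \<le> n" for i
    proof -
      have "(\<Sum>l\<in>{i..<n}. restrict (\<lambda>i. ?I i \<omega>) ?J l) = (\<Sum>l\<in>{i..<n}. ?I l \<omega>)"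
        by (intro sum.cong) auto
      also have "\<dots> = W (T n) \<omega> - W (T i) \<omega>"
        by (rule sum_Suc_diff'[OF that])
      finally show ?thesis by (simp only: T_lo[OF that] Tn)
    qed
    have "(\<lambda>i. \<Sum>l<i. restrict (\<lambda>i. ?I i \<omega>) ?J (Suc n + l)) ` {..n} =
        (\<lambda>i. W (q' + (r - q') * (real i / real n)) \<omega> + - W q' \<omega>) ` {..n}"
      by (intro image_cong refl hi) simp
    moreover have "(\<lambda>i. - (\<Sum>l\<in>{i..<n}. restrict (\<lambda>i. ?I i \<omega>) ?J l)) ` {..n} =
        (\<lambda>i. W (0 + (q - 0) * (real i / real n)) \<omega> + - W q \<omega>) ` {..n}"
      by (intro image_cong refl lo) simp
    ultimately show ?thesis
      unfolding grid_max_def by (simp only: Max_add_commute finite_atMost not_Iic_eq_empty simp_thms)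
  qed
  have "distributed M lborel (\<lambda>\<omega>. W q' \<omega> - W q \<omega>) (normal_density 0 (sqrt (q' - q)))"
    using q by (intro normal_increments) auto
  from prob_normal_plus_indep_le[OF indep this _ \<open>\<delta> > 0\<close>] q
  show ?thesis unfolding Y by simp
qed

text \<open>The uniform bound for the grid maxima is carried to the limit by a continuous tent
  function between the indicators of {0} and {-\<delta>..\<delta>}, as the indicators themselves may
  fail to converge. Then \<delta> is made small.\<close>

lemma AE_maxima_neq:
  assumes q: "0 < q" "q < q'" "q' < r"
  shows "AE \<omega> in M. running_max (path \<omega>) q \<noteq> (SUP s\<in>{q'..r}. W s \<omega>)"
proof -
  let ?A = "\<lambda>\<omega>. running_max (path \<omega>) q" and ?B = "\<lambda>\<omega>. SUP s\<in>{q'..r}. W s \<omega>"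
  let ?An = "\<lambda>n \<omega>. grid_max (path \<omega>) 0 q n" and ?Bn = "\<lambda>n \<omega>. grid_max (path \<omega>) q' r n"
  define K where "K = 2 / (sqrt (2 * pi) * sqrt (q' - q))"
  have K: "K > 0" using q by (simp add: K_def)
  have [measurable]: "?A \<in> borel_measurable M" "?B \<in> borel_measurable M"
    using q by (auto intro: measurable_Sup_path)
  have [measurable]: "?An n \<in> borel_measurable M" "?Bn n \<in> borel_measurable M" for n
    using q by (auto intro: measurable_grid_max)
  have conv: "(\<lambda>n. ?Bn n \<omega> - ?An n \<omega>) \<longlonglongrightarrow> ?B \<omega> - ?A \<omega>" if "\<omega> \<in> space M" for \<omega>
  proof -
    interpret continuous_path "path \<omega>" using that by (rule continuous_path)
    show ?thesis unfolding running_max_def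
      by (intro tendsto_diff grid_max_tendsto_Sup cont_interval) (use q in auto)
  qed
  have bound: "prob {\<omega> \<in> space M. ?A \<omega> = ?B \<omega>} \<le> K * \<delta>" if "\<delta> > 0" for \<delta>
  proof -
    let ?\<phi> = "\<lambda>x :: real. max 0 (1 - \<bar>x\<bar> / \<delta>)"
    have \<phi>: "\<bar>?\<phi> x\<bar> \<le> 1" "?\<phi> x \<le> indicator {x. \<bar>x\<bar> \<le> \<delta>} x" for x
      using that by (auto simp: indicator_def field_simps)
    have "(\<lambda>n. expectation (\<lambda>\<omega>. ?\<phi> (?Bn n \<omega> - ?An n \<omega>))) \<longlonglongrightarrow> expectation (\<lambda>\<omega>. ?\<phi> (?B \<omega> - ?A \<omega>))"
    proof (rule integral_dominated_convergence[where w = "\<lambda>_. 1"])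
      show "AE \<omega> in M. (\<lambda>n. ?\<phi> (?Bn n \<omega> - ?An n \<omega>)) \<longlonglongrightarrow> ?\<phi> (?B \<omega> - ?A \<omega>)"
        using that by (intro AE_I2 tendsto_intros conv) auto
    qed (use \<phi> in auto)
    moreover have "expectation (\<lambda>\<omega>. ?\<phi> (?Bn n \<omega> - ?An n \<omega>)) \<le> K * \<delta>" if "n > 0" for n
    proof -
      have "expectation (\<lambda>\<omega>. ?\<phi> (?Bn n \<omega> - ?An n \<omega>)) \<le>
          expectation (\<lambda>\<omega>. indicator {\<omega> \<in> space M. \<bar>?Bn n \<omega> - ?An n \<omega>\<bar> \<le> \<delta>} \<omega>)"
      proof (rule integral_mono)
        show "integrable M (\<lambda>\<omega>. ?\<phi> (?Bn n \<omega> - ?An n \<omega>))"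
          by (rule integrable_const_bound[where B = 1]) (use \<phi> in auto)
        show "?\<phi> (?Bn n \<omega> - ?An n \<omega>) \<le> indicator {\<omega> \<in> space M. \<bar>?Bn n \<omega> - ?An n \<omega>\<bar> \<le> \<delta>} \<omega>"
          if "\<omega> \<in> space M" for \<omega>
          using \<phi>(2)[of "?Bn n \<omega> - ?An n \<omega>"] that by (simp add: indicator_def)
      qed (auto simp: emeasure_eq_measure intro!: integrable_real_indicator)
      also have "\<dots> = prob {\<omega> \<in> space M. \<bar>?Bn n \<omega> - ?An n \<omega>\<bar> \<le> \<delta>}"
        by (simp add: Int_absorb1)
      also have "\<dots> \<le> K * \<delta>"
        using prob_grid_maxima_close[OF q that \<open>\<delta> > 0\<close>] unfolding K_def by simp
      finally show ?thesis .
    qed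
    ultimately have "expectation (\<lambda>\<omega>. ?\<phi> (?B \<omega> - ?A \<omega>)) \<le> K * \<delta>"
      by (intro tendsto_upperbound[where F = sequentially]) (auto intro: eventually_mono[OF eventually_gt_at_top[of 0]])
    moreover have "prob {\<omega> \<in> space M. ?A \<omega> = ?B \<omega>} \<le> expectation (\<lambda>\<omega>. ?\<phi> (?B \<omega> - ?A \<omega>))"
    proof -
      have "prob {\<omega> \<in> space M. ?A \<omega> = ?B \<omega>} = expectation (indicator {\<omega> \<in> space M. ?A \<omega> = ?B \<omega>})"
        by (simp add: Int_absorb1)
      also have "\<dots> \<le> expectation (\<lambda>\<omega>. ?\<phi> (?B \<omega> - ?A \<omega>))"
      proof (rule integral_mono)
        show "integrable M (\<lambda>\<omega>. ?\<phi> (?B \<omega> - ?A \<omega>))"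
          by (rule integrable_const_bound[where B = 1]) (use \<phi> in auto)
      qed (auto simp: indicator_def emeasure_eq_measure intro!: integrable_real_indicator)
      finally show ?thesis .
    qed
    ultimately show ?thesis by simp
  qed
  have "prob {\<omega> \<in> space M. ?A \<omega> = ?B \<omega>} = 0"
  proof (rule ccontr)
    let ?p = "prob {\<omega> \<in> space M. ?A \<omega> = ?B \<omega>}"
    assume "?p \<noteq> 0"
    then have "?p > 0" by (simp add: zero_less_measure_iff)
    then show False using bound[of "?p / (2 * K)"] K by simp
  qed
  then show ?thesis
    by (subst (asm) prob_eq_0) auto
qed

lemma AE_no_ties:
  "AE \<omega> in M. \<forall>q\<in>\<rat>. \<forall>q'\<in>\<rat>. \<forall>r\<in>\<rat>. 0 < q \<longrightarrow> q < q' \<longrightarrow> q' < r \<longrightarrow>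
    running_max (path \<omega>) q \<noteq> (SUP s\<in>{q'..r}. W s \<omega>)"
proof -
  have "AE \<omega> in M. 0 < q \<longrightarrow> q < q' \<longrightarrow> q' < r \<longrightarrow>
    running_max (path \<omega>) q \<noteq> (SUP s\<in>{q'..r}. W s \<omega>)" for q q' r
    using AE_maxima_neq[of q q' r] by (cases "0 < q \<and> q < q' \<and> q' < r") (auto elim: eventually_mono)
  then show ?thesis by (simp only: AE_ball_countable[OF countable_rat]) blast
qed

subsection \<open>The Laplace transform of the Brownian avalanche length\<close>

text \<open>The value 0 stands for exp (- \<infinity>): before \<open>AE_stop_set_nonempty\<close>
  an empty stopping set cannot be excluded, and the grid lengths then tend to infinity.\<close>

definition stopped_exp :: "real \<Rightarrow> real \<Rightarrow> 'a \<Rightarrow> real" where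
  "stopped_exp \<epsilon> \<theta> \<omega> = (if stop_set \<epsilon> (path \<omega>) \<noteq> {}
     then exp (- (\<theta> * path_avalanche_length \<epsilon> (path \<omega>))) else 0)"

lemma measurable_stopped_exp [measurable]:
  "\<epsilon> > 0 \<Longrightarrow> stopped_exp \<epsilon> \<theta> \<in> borel_measurable M"
  unfolding stopped_exp_def[abs_def]
  using sets_stop_nonempty[of \<epsilon>] measurable_path_avalanche_length[of \<epsilon>]
  by (intro measurable_If) auto

lemma path_avalanche_length_nonneg:
  assumes "\<omega> \<in> space M" "\<epsilon> > 0" "stop_set \<epsilon> (path \<omega>) \<noteq> {}"
  shows "path_avalanche_length \<epsilon> (path \<omega>) \<ge> 0"
  using continuous_path.path_avalanche_length_in_stop_set[OF continuous_path[OF assms(1)] assms(2,3)]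
  by (simp add: stop_set_def)

lemma stopped_exp_bounds:
  assumes "\<omega> \<in> space M" "\<epsilon> > 0" "\<theta> \<ge> 0"
  shows "0 \<le> stopped_exp \<epsilon> \<theta> \<omega>" "stopped_exp \<epsilon> \<theta> \<omega> \<le> 1"
  using path_avalanche_length_nonneg[OF assms(1,2)] assms(3) by (auto simp: stopped_exp_def)

text \<open>The grid lengths are not known to converge, so a bound on a limit superior is phrased
  with an error \<open>e\<close>. By \<open>eventually_stalls_late\<close> they eventually exceed
  every \<open>t\<close> below the length, or every \<open>t\<close> at all if the stopping set is
  empty.\<close>

lemma AE_grid_le_stopped_exp:
  assumes "\<epsilon> > 0" "\<theta> > 0"
  shows "AE \<omega> in M. \<forall>e>0. \<forall>\<^sub>F m in sequentially.
    exp (- (\<theta> * grid_length \<epsilon> m \<omega>)) \<le> stopped_exp \<epsilon> \<theta> \<omega> + e"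
  using AE_grid_stalls[OF assms(1)] AE_space
proof eventually_elim
  case (elim \<omega>)
  then interpret continuous_path "path \<omega>" by (intro continuous_path)
  have late: "\<forall>\<^sub>F m in sequentially. exp (- (\<theta> * grid_length \<epsilon> m \<omega>)) \<le> exp (- (\<theta> * t))"
    if "t \<ge> 0" "\<And>s. s \<in> stop_set \<epsilon> (path \<omega>) \<Longrightarrow> s > t" for t
  proof -
    have "\<forall>\<^sub>F m in sequentially. \<forall>k. stalls (nat \<lfloor>real m * \<epsilon>\<rfloor>) (\<lambda>k. W (real k / real m) \<omega>) k \<longrightarrow> real k / real m > t"
      by (rule eventually_stalls_late[OF assms(1)]) (use that in auto)
    then show ?thesis using elim(1)
    proof eventually_elim
      case (elim m)
      then have "grid_length \<epsilon> m \<omega> > t"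
        unfolding grid_length_def using stall_time_eq_iff by metis
      then show ?case using assms by simp
    qed
  qed
  show ?case
  proof (intro allI impI)
    fix e :: real assume "e > 0"
    let ?L = "path_avalanche_length \<epsilon> (path \<omega>)"
    show "\<forall>\<^sub>F m in sequentially. exp (- (\<theta> * grid_length \<epsilon> m \<omega>)) \<le> stopped_exp \<epsilon> \<theta> \<omega> + e"
    proof (cases "stop_set \<epsilon> (path \<omega>) = {}")
      case True
      have "((\<lambda>t. exp (- (\<theta> * t))) \<longlongrightarrow> 0) at_top"
        using assms by real_asymp
      then have "\<forall>\<^sub>F t in at_top. exp (- (\<theta> * t)) < e"
        using \<open>e > 0\<close> by (rule order_tendstoD)
      then have "\<forall>\<^sub>F t in at_top. exp (- (\<theta> * t)) < e \<and> t \<ge> 0"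
        using eventually_ge_at_top by (rule eventually_conj)
      then obtain t where t: "exp (- (\<theta> * t)) < e" "t \<ge> 0"
        using eventually_happens'[OF trivial_limit_at_top_linorder] by blast
      have "\<forall>\<^sub>F m in sequentially. exp (- (\<theta> * grid_length \<epsilon> m \<omega>)) \<le> exp (- (\<theta> * t))"
        using True by (intro late t(2)) auto
      moreover have "stopped_exp \<epsilon> \<theta> \<omega> = 0" using True by (simp add: stopped_exp_def)
      ultimately show ?thesis using t(1) by (elim eventually_mono) linarith
    next
      case False
      have in_stop: "?L \<in> stop_set \<epsilon> (path \<omega>)"
        by (rule path_avalanche_length_in_stop_set[OF assms(1) False])
      then have "?L \<ge> 0" by (simp add: stop_set_def)
      show ?thesis
      \<comment> \<open>A length 0 leaves no nonnegative \<open>t\<close> to its left, but then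
        \<open>stopped_exp\<close> is 1 and the bound is trivial.\<close>
      proof (cases "?L = 0")
        case True
        then show ?thesis
          using False assms \<open>e > 0\<close> grid_length_nonneg[of \<epsilon> _ \<omega>]
          by (intro always_eventually) (auto simp: stopped_exp_def intro!: add_increasing2)
      next
        case L: False
        have "((\<lambda>t. exp (- (\<theta> * t))) \<longlongrightarrow> exp (- (\<theta> * ?L))) (at_left ?L)"
          by (intro tendsto_intros)
        then have "\<forall>\<^sub>F t in at_left ?L. exp (- (\<theta> * t)) < exp (- (\<theta> * ?L)) + e"
          using \<open>e > 0\<close> by (intro order_tendstoD(2)) auto
        moreover have "\<forall>\<^sub>F t in at_left ?L. t \<in> {0<..<?L}"
          using L \<open>?L \<ge> 0\<close> by (intro eventually_at_leftI) auto
        ultimately have "\<forall>\<^sub>F t in at_left ?L. exp (- (\<theta> * t)) < exp (- (\<theta> * ?L)) + e \<and> t \<in> {0<..<?L}"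
          by (rule eventually_conj)
        then obtain t where t: "exp (- (\<theta> * t)) < exp (- (\<theta> * ?L)) + e" "t \<in> {0<..<?L}"
          using eventually_happens'[OF trivial_limit_at_left_real] by blast
        have "s > t" if "s \<in> stop_set \<epsilon> (path \<omega>)" for s
          using path_avalanche_length_le[OF that] t(2) by simp
        with t have "\<forall>\<^sub>F m in sequentially. exp (- (\<theta> * grid_length \<epsilon> m \<omega>)) \<le> exp (- (\<theta> * t))"
          by (intro late) auto
        moreover have "stopped_exp \<epsilon> \<theta> \<omega> = exp (- (\<theta> * ?L))"
          using False by (simp add: stopped_exp_def)
        ultimately show ?thesis using t(1) by (elim eventually_mono) linarith
      qed
    qed
  qed
qed

lemma AE_stopped_exp_le_grid:
  assumes "0 < \<epsilon>'" "\<epsilon>' < \<epsilon>" "\<theta> > 0"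
  shows "AE \<omega> in M. \<forall>e>0. \<forall>\<^sub>F m in sequentially.
    stopped_exp \<epsilon> \<theta> \<omega> \<le> exp (- (\<theta> * grid_length \<epsilon>' m \<omega>)) + e"
  using AE_no_ties AE_space
proof eventually_elim
  case (elim \<omega>)
  then interpret continuous_path "path \<omega>" by (intro continuous_path)
  show ?case
  proof (intro allI impI)
    fix e :: real assume "e > 0"
    let ?L = "path_avalanche_length \<epsilon> (path \<omega>)"
    show "\<forall>\<^sub>F m in sequentially. stopped_exp \<epsilon> \<theta> \<omega> \<le> exp (- (\<theta> * grid_length \<epsilon>' m \<omega>)) + e"
    proof (cases "stop_set \<epsilon> (path \<omega>) = {}")
      case True
      then show ?thesis using \<open>e > 0\<close> by (auto simp: stopped_exp_def intro!: always_eventually add_nonneg_nonneg)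
    next
      case False
      have "((\<lambda>t. exp (- (\<theta> * t))) \<longlongrightarrow> exp (- (\<theta> * ?L))) (at_right ?L)"
        by (intro tendsto_intros)
      then have "\<forall>\<^sub>F t in at_right ?L. exp (- (\<theta> * t)) > exp (- (\<theta> * ?L)) - e"
        using \<open>e > 0\<close> by (intro order_tendstoD(1)) auto
      then have "\<forall>\<^sub>F t in at_right ?L. exp (- (\<theta> * t)) > exp (- (\<theta> * ?L)) - e \<and> t > ?L"
        using eventually_at_right_less by (rule eventually_conj)
      then obtain t where t: "exp (- (\<theta> * t)) > exp (- (\<theta> * ?L)) - e" "t > ?L"
        using eventually_happens'[OF trivial_limit_at_right_real] by blast
      have "\<forall>\<^sub>F m in sequentially. \<exists>k. stalls (nat \<lfloor>real m * \<epsilon>'\<rfloor>) (\<lambda>k. W (real k / real m) \<omega>) k \<and>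
          real k / real m \<le> ?L + (t - ?L)"
        using elim(1) t(2) by (intro eventually_stalls_early[OF assms(1,2) False]) auto
      then show ?thesis
      proof eventually_elim
        case (elim m)
        then obtain k where k: "stalls (nat \<lfloor>real m * \<epsilon>'\<rfloor>) (\<lambda>k. W (real k / real m) \<omega>) k" "real k / real m \<le> t"
          by auto
        have "stall_time (nat \<lfloor>real m * \<epsilon>'\<rfloor>) (\<lambda>k. W (real k / real m) \<omega>) \<le> k"
          using k(1) by (auto simp: stall_time_def intro: Least_le)
        then have "grid_length \<epsilon>' m \<omega> \<le> real k / real m"
          unfolding grid_length_def by (intro divide_right_mono) auto
        then have "exp (- (\<theta> * t)) \<le> exp (- (\<theta> * grid_length \<epsilon>' m \<omega>))"
          using k(2) assms by simp
        moreover have "stopped_exp \<epsilon> \<theta> \<omega> = exp (- (\<theta> * ?L))"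
          using False by (simp add: stopped_exp_def)
        ultimately show ?case using t(1) by linarith
      qed
    qed
  qed
qed

end

text \<open>The positive part of \<open>f n - g n\<close> is bounded and tends to 0 almost surely,
  hence in expectation. Only the expectations of \<open>f n\<close> and \<open>g n\<close> converge,
  which is the situation of the grid lengths.\<close>

lemma (in prob_space) expectation_limit_mono:
  fixes f g :: "nat \<Rightarrow> 'a \<Rightarrow> real"
  assumes [measurable]: "\<And>n. f n \<in> borel_measurable M" "\<And>n. g n \<in> borel_measurable M"
    and bounds: "\<And>n \<omega>. \<omega> \<in> space M \<Longrightarrow> 0 \<le> f n \<omega> \<and> f n \<omega> \<le> 1"
      "\<And>n \<omega>. \<omega> \<in> space M \<Longrightarrow> 0 \<le> g n \<omega> \<and> g n \<omega> \<le> 1"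
    and le: "AE \<omega> in M. \<forall>e>0. \<forall>\<^sub>F n in sequentially. f n \<omega> \<le> g n \<omega> + e"
    and lim: "(\<lambda>n. expectation (f n)) \<longlonglongrightarrow> a" "(\<lambda>n. expectation (g n)) \<longlonglongrightarrow> b"
  shows "a \<le> b"
proof -
  let ?h = "\<lambda>n \<omega>. max 0 (f n \<omega> - g n \<omega>)"
  have int: "integrable M (f n)" "integrable M (g n)" "integrable M (?h n)" for n
  proof -
    show "integrable M (f n)" by (rule integrable_const_bound[where B = 1]) (use bounds in auto)
    show "integrable M (g n)" by (rule integrable_const_bound[where B = 1]) (use bounds in auto)
    have "\<bar>?h n \<omega>\<bar> \<le> 1" if "\<omega> \<in> space M" for \<omega>
      using bounds(1)[OF that, of n] bounds(2)[OF that, of n] by auto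
    then show "integrable M (?h n)" by (intro integrable_const_bound[where B = 1]) auto
  qed
  have "(\<lambda>n. expectation (?h n)) \<longlonglongrightarrow> expectation (\<lambda>_. 0)"
  proof (rule integral_dominated_convergence[where w = "\<lambda>_. 1"])
    show "AE \<omega> in M. (\<lambda>n. ?h n \<omega>) \<longlonglongrightarrow> 0"
      using le
    proof eventually_elim
      case (elim \<omega>)
      show ?case
      proof (rule tendstoI)
        fix e :: real assume "e > 0"
        then have "\<forall>\<^sub>F n in sequentially. f n \<omega> \<le> g n \<omega> + e / 2" using elim by simp
        then show "\<forall>\<^sub>F n in sequentially. dist (?h n \<omega>) 0 < e"
          by eventually_elim (use \<open>e > 0\<close> in \<open>auto simp: dist_real_def max_def\<close>)
      qed
    qed
    show "AE \<omega> in M. norm (?h n \<omega>) \<le> 1" for n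
      using AE_space
    proof eventually_elim
      case (elim \<omega>)
      then show ?case using bounds(1)[OF elim, of n] bounds(2)[OF elim, of n] by auto
    qed
  qed auto
  then have "(\<lambda>n. expectation (g n) + expectation (?h n)) \<longlonglongrightarrow> b + 0"
    using lim(2) by (intro tendsto_add) auto
  moreover have "expectation (f n) \<le> expectation (g n) + expectation (?h n)" for n
  proof -
    have "expectation (f n) \<le> expectation (\<lambda>\<omega>. g n \<omega> + ?h n \<omega>)"
      by (intro integral_mono int Bochner_Integration.integrable_add) auto
    then show ?thesis by (simp add: Bochner_Integration.integral_add[OF int(2,3)])
  qed
  ultimately show ?thesis
    using LIMSEQ_le[OF lim(1)] by fastforce
qed

context standard_brownian_motion
begin

lemma expectation_stopped_exp:
  assumes "\<epsilon> > 0" "\<theta> > 0"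
  shows "expectation (stopped_exp \<epsilon> \<theta>) = laplace (\<theta> * \<epsilon>)"
proof (rule antisym)
  have grid_bounds: "0 \<le> exp (- (\<theta> * grid_length \<epsilon> m \<omega>)) \<and> exp (- (\<theta> * grid_length \<epsilon> m \<omega>)) \<le> 1" for \<epsilon> m \<omega>
    using assms grid_length_nonneg[of \<epsilon> m \<omega>] by simp
  have stop_bounds: "0 \<le> stopped_exp \<epsilon> \<theta> \<omega> \<and> stopped_exp \<epsilon> \<theta> \<omega> \<le> 1" if "\<omega> \<in> space M" for \<omega>
    using stopped_exp_bounds[OF that] assms by simp
  show "laplace (\<theta> * \<epsilon>) \<le> expectation (stopped_exp \<epsilon> \<theta>)"
    by (rule expectation_limit_mono[OF _ _ _ _ AE_grid_le_stopped_exp[OF assms] grid_laplace_limit tendsto_const])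
       (use assms grid_bounds stop_bounds in auto)
  have le: "expectation (stopped_exp \<epsilon> \<theta>) \<le> laplace (\<theta> * \<epsilon>')" if "\<epsilon>' \<in> {0<..<\<epsilon>}" for \<epsilon>'
  proof (rule expectation_limit_mono)
    show "AE \<omega> in M. \<forall>e>0. \<forall>\<^sub>F m in sequentially.
        stopped_exp \<epsilon> \<theta> \<omega> \<le> exp (- (\<theta> * grid_length \<epsilon>' m \<omega>)) + e"
      using that assms by (intro AE_stopped_exp_le_grid) auto
    show "(\<lambda>m. expectation (\<lambda>\<omega>. exp (- (\<theta> * grid_length \<epsilon>' m \<omega>)))) \<longlonglongrightarrow> laplace (\<theta> * \<epsilon>')"
      using that assms by (intro grid_laplace_limit) auto
  qed (use assms grid_bounds stop_bounds in auto)
  have "isCont (\<lambda>x. laplace (\<theta> * x)) \<epsilon>"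
    using assms by (intro isCont_o2[OF _ isCont_laplace]) (auto intro: continuous_intros)
  then have "((\<lambda>x. laplace (\<theta> * x)) \<longlongrightarrow> laplace (\<theta> * \<epsilon>)) (at_left \<epsilon>)"
    unfolding isCont_def by (meson tendsto_mono at_le subset_UNIV)
  moreover have "\<forall>\<^sub>F x in at_left \<epsilon>. expectation (stopped_exp \<epsilon> \<theta>) \<le> laplace (\<theta> * x)"
    using le assms by (intro eventually_at_leftI[of 0]) auto
  ultimately show "expectation (stopped_exp \<epsilon> \<theta>) \<le> laplace (\<theta> * \<epsilon>)"
    by (rule tendsto_lowerbound) simp
qed

text \<open>The probability of a nonempty stopping set is at least
  \<open>laplace (\<theta> * \<epsilon>)\<close> for every \<theta> > 0, and this tends to
  \<open>laplace 0 = 1\<close> as \<theta> decreases to 0.\<close>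

lemma AE_stop_set_nonempty:
  assumes "\<epsilon> > 0"
  shows "AE \<omega> in M. stop_set \<epsilon> (path \<omega>) \<noteq> {}"
proof -
  let ?E = "{\<omega> \<in> space M. stop_set \<epsilon> (path \<omega>) \<noteq> {}}"
  have E: "?E \<in> sets M" by (rule sets_stop_nonempty[OF assms])
  have "laplace (\<theta> * \<epsilon>) \<le> prob ?E" if "\<theta> > 0" for \<theta>
  proof -
    have "expectation (stopped_exp \<epsilon> \<theta>) \<le> expectation (indicator ?E)"
    proof (rule integral_mono)
      show "integrable M (stopped_exp \<epsilon> \<theta>)"
      proof (rule integrable_const_bound[where B = 1])
        show "AE \<omega> in M. norm (stopped_exp \<epsilon> \<theta> \<omega>) \<le> 1"
          using AE_space by eventually_elim (use stopped_exp_bounds assms that in \<open>simp add: less_imp_le\<close>)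
      qed (use assms in simp)
      show "stopped_exp \<epsilon> \<theta> \<omega> \<le> indicator ?E \<omega>" if "\<omega> \<in> space M" for \<omega>
      proof (cases "stop_set \<epsilon> (path \<omega>) = {}")
        case True
        then show ?thesis by (simp add: stopped_exp_def)
      next
        case False
        then show ?thesis
          using stopped_exp_bounds(2)[OF that assms, of \<theta>] \<open>\<theta> > 0\<close> that by (simp add: indicator_def)
      qed
    qed (use E in \<open>auto simp: emeasure_eq_measure intro!: integrable_real_indicator\<close>)
    then show ?thesis using expectation_stopped_exp[OF assms that] E by (simp add: Int_absorb1)
  qed
  then have "\<forall>\<^sub>F \<theta> in at_right 0. laplace (\<theta> * \<epsilon>) \<le> prob ?E"
    by (intro eventually_at_rightI[of 0 1]) auto
  moreover have "((\<lambda>\<theta>. laplace (\<theta> * \<epsilon>)) \<longlongrightarrow> laplace (0 * \<epsilon>)) (at_right 0)"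
  proof -
    have "isCont (\<lambda>\<theta>. laplace (\<theta> * \<epsilon>)) 0"
      by (intro isCont_o2[OF _ isCont_laplace]) (auto intro: continuous_intros)
    then show ?thesis unfolding isCont_def by (meson tendsto_mono at_le subset_UNIV)
  qed
  ultimately have "laplace (0 * \<epsilon>) \<le> prob ?E"
    by (intro tendsto_upperbound[where F = "at_right (0::real)"]) auto
  then have "prob ?E = 1" using prob_le_1[of ?E] by (simp add: laplace_def)
  then have "AE \<omega> in M. \<omega> \<in> ?E" using E by (simp add: prob_eq_1)
  then show ?thesis by eventually_elim simp
qed

lemma laplace_path_avalanche_length:
  assumes "\<epsilon> > 0" "\<theta> > 0"
  shows "expectation (\<lambda>\<omega>. exp (- (\<theta> * path_avalanche_length \<epsilon> (path \<omega>)))) = laplace (\<theta> * \<epsilon>)"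
proof -
  have "expectation (\<lambda>\<omega>. exp (- (\<theta> * path_avalanche_length \<epsilon> (path \<omega>)))) = expectation (stopped_exp \<epsilon> \<theta>)"
  proof (rule integral_cong_AE)
    show "AE \<omega> in M. exp (- (\<theta> * path_avalanche_length \<epsilon> (path \<omega>))) = stopped_exp \<epsilon> \<theta> \<omega>"
      using AE_stop_set_nonempty[OF assms(1)] by eventually_elim (simp add: stopped_exp_def)
  qed (use assms measurable_path_avalanche_length[OF assms(1)] in simp_all)
  then show ?thesis using expectation_stopped_exp[OF assms] by simp
qed

end

theorem theorem1:
  fixes M :: "'a measure" and S :: "nat \<Rightarrow> 'a \<Rightarrow> int" and \<epsilon> :: real
    and L :: "nat \<Rightarrow> 'a \<Rightarrow> real"
  assumes "simple_symmetric_random_walk M S"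
    and "\<epsilon> > 0"
    and "L = (\<lambda>n \<omega>. real (avalanche_length (nat \<lfloor>real n * \<epsilon>\<rfloor>) (\<lambda>k. S k \<omega>)))"
  shows
    "(\<forall>(N :: 'b measure) W. standard_brownian_motion N W \<longrightarrow>
        weak_conv_m (\<lambda>n. distr M borel (\<lambda>\<omega>. L n \<omega> / real n))
          (distr N borel (\<lambda>\<omega>. path_avalanche_length \<epsilon> (\<lambda>t. W t \<omega>)))) \<and>
     (\<forall>z::complex. Re z > 0 \<longrightarrow>
        (\<lambda>n. prob_space.expectation M (\<lambda>\<omega>. exp (- (z / of_nat n) * of_real (L n \<omega>))))
          \<longlonglongrightarrow> 1 / (csqrt (z * of_real \<epsilon> * of_real pi) * erf (csqrt (z * of_real \<epsilon>))
                 + exp (- (z * of_real \<epsilon>)))) \<and>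
     (\<lambda>n. prob_space.expectation M (\<lambda>\<omega>. L n \<omega> / real n)) \<longlonglongrightarrow> \<epsilon> \<and>
     (\<lambda>n. prob_space.variance M (\<lambda>\<omega>. L n \<omega> / real n)) \<longlonglongrightarrow> 4 / 3 * \<epsilon>\<^sup>2"
proof -
  interpret simple_symmetric_random_walk M S by fact
  let ?w = "\<lambda>n. nat \<lfloor>real n * \<epsilon>\<rfloor>"
  have L: "L n \<omega> = real (stall (?w n) \<omega>)" if "\<omega> \<in> space M" for n \<omega>
    using that by (simp add: assms(3) stall_eq_avalanche_length)
  have meas: "(\<lambda>\<omega>. L n \<omega> / real n) \<in> borel_measurable M" for n
  proof -
    have "(\<lambda>\<omega>. real (stall (?w n) \<omega>) / real n) \<in> borel_measurable M"
      by (rule measurable_compose[OF measurable_stall]) simp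
    then show ?thesis by (subst measurable_cong[OF arg_cong[where f = "\<lambda>x. x / real n", OF L]])
  qed
  note window = floor_window[OF assms(2)]
  have laplace_complex: "(\<lambda>n. expectation (\<lambda>\<omega>. exp (- (z / of_nat n) * of_real (L n \<omega>))))
      \<longlonglongrightarrow> avalanche_laplace (z * of_real \<epsilon>)" if "Re z \<ge> 0" for z :: complex
  proof -
    have "expectation (\<lambda>\<omega>. exp (- (z / of_nat n) * of_real (L n \<omega>))) =
        expectation (\<lambda>\<omega>. exp (- (z / of_nat n) * of_real (real (stall (?w n) \<omega>))))" for n
      by (intro Bochner_Integration.integral_cong refl) (simp add: L)
    then show ?thesis
      using stall_laplace_limit(1)[of M "\<lambda>_. step" stay, OF symmetric_walk_axioms refl
          inverse_sqrt_decay_stay_step window that] by simp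
  qed
  have mean: "(\<lambda>n. expectation (\<lambda>\<omega>. L n \<omega> / real n)) \<longlonglongrightarrow> \<epsilon>"
    and var: "(\<lambda>n. variance (\<lambda>\<omega>. L n \<omega> / real n)) \<longlonglongrightarrow> 4 / 3 * \<epsilon>\<^sup>2"
  proof -
    have e: "expectation (\<lambda>\<omega>. L n \<omega> / real n) = expectation (\<lambda>\<omega>. real (stall (?w n) \<omega>) / real n)" for n
      by (intro Bochner_Integration.integral_cong refl) (simp add: L)
    have v: "variance (\<lambda>\<omega>. L n \<omega> / real n) = variance (\<lambda>\<omega>. real (stall (?w n) \<omega>) / real n)" for n
      unfolding e by (intro Bochner_Integration.integral_cong refl) (simp add: L)
    note lim = stall_moment_limits[OF inverse_sqrt_decay_stay_step window]
    show "(\<lambda>n. expectation (\<lambda>\<omega>. L n \<omega> / real n)) \<longlonglongrightarrow> \<epsilon>" using lim(1) by (simp only: e)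
    show "(\<lambda>n. variance (\<lambda>\<omega>. L n \<omega> / real n)) \<longlonglongrightarrow> 4 / 3 * \<epsilon>\<^sup>2" using lim(2) by (simp only: v)
  qed
  have "weak_conv_m (\<lambda>n. distr M borel (\<lambda>\<omega>. L n \<omega> / real n))
      (distr N borel (\<lambda>\<omega>. path_avalanche_length \<epsilon> (\<lambda>t. W t \<omega>)))"
    if "standard_brownian_motion N W" for N :: "'b measure" and W
  proof -
    interpret B: standard_brownian_motion N W by fact
    show ?thesis
    proof (rule weak_conv_m_laplace)
      show "prob_space M" "prob_space N" by unfold_locales
      show "(\<lambda>\<omega>. path_avalanche_length \<epsilon> (\<lambda>t. W t \<omega>)) \<in> borel_measurable N"
        by (rule B.measurable_path_avalanche_length[OF assms(2)])
      show "AE \<omega> in M. L n \<omega> / real n \<ge> 0" for n by (simp add: assms(3))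
      show "AE \<omega> in N. path_avalanche_length \<epsilon> (\<lambda>t. W t \<omega>) \<ge> 0"
        using B.AE_stop_set_nonempty[OF assms(2)] AE_space
        by eventually_elim (rule B.path_avalanche_length_nonneg[OF _ assms(2)])
      fix k :: nat assume "k > 0"
      \<comment> \<open>At a real argument the complex transform is the real one embedded in the
        complex numbers, so the walk and the Brownian length are both evaluated by
        \<open>avalanche_laplace\<close>. This agreement is all that links the two.\<close>
      have "expectation (\<lambda>\<omega>. exp (- (of_real (real k) / of_nat n) * of_real (L n \<omega>)) :: complex) =
          of_real (expectation (\<lambda>\<omega>. exp (- (real k * (L n \<omega> / real n)))))" for n
        by (simp add: exp_of_real[symmetric] flip: integral_complex_of_real)
      then have "(\<lambda>n. expectation (\<lambda>\<omega>. exp (- (real k * (L n \<omega> / real n))))) \<longlonglongrightarrow>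
          Re (avalanche_laplace (of_real (real k) * of_real \<epsilon>))"
        using tendsto_Re[OF laplace_complex[of "of_real (real k)"]] by simp
      then show "(\<lambda>n. expectation (\<lambda>\<omega>. exp (- (real k * (L n \<omega> / real n))))) \<longlonglongrightarrow>
          (\<integral>\<omega>. exp (- (real k * path_avalanche_length \<epsilon> (\<lambda>t. W t \<omega>))) \<partial>N)"
        using B.laplace_path_avalanche_length[OF assms(2), of "real k"] \<open>k > 0\<close>
        by (simp add: B.laplace_def)
    qed (rule meas)
  qed
  moreover have "(\<lambda>n. expectation (\<lambda>\<omega>. exp (- (z / of_nat n) * of_real (L n \<omega>))))
      \<longlonglongrightarrow> 1 / (csqrt (z * of_real \<epsilon> * of_real pi) * erf (csqrt (z * of_real \<epsilon>))
        + exp (- (z * of_real \<epsilon>)))" if "Re z > 0" for z :: complex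
    using laplace_complex[of z] that assms(2) by (simp add: avalanche_laplace_eq_erf)
  ultimately show ?thesis using mean var by blast
qed

end
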